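(* Let $\mathcal{N}$ be an exact category. The natural homomorphism $\Phi\colon K_1^N(\mathcal{N})\to K_0(\Omega\mathcal{N})$, which sends the generator of $K_1^N(\mathcal{N})$ given by a binary acyclic complex of length two to the class of this complex in $K_0(\Omega\mathcal{N})$, is an isomorphism.
   Context: All chain complexes are bounded and $\mathbb{N}$-graded (concentrated in degrees $\ge 0$). A chain complex $(P_*,d)$ in $\mathcal{N}$ is acyclic if each differential factors as an admissible epimorphism followed by an admissible monomorphism $d_n\colon P_n\twoheadrightarrow J_{n-1}\rightarrowtail P_{n-1}$ such that $J_n\rightarrowtail P_n\twoheadrightarrow J_{n-1}$ is a short exact sequence for every $n$. A binary acyclic complex $(P_*,d,d')$ is a graded object $P_*$ over $\mathcal{N}$ with two degree $-1$ maps $d$ (top differential) and $d'$ (bottom differential) such that $(P_*,d)$ and $(P_*,d')$ are both acyclic chain complexes. Morphisms are degree $0$ maps that are chain maps for both top and both bottom differentials; the resulting category $B^q\mathcal{N}$ is exact with the degreewise exact structure. $K_0(\Omega\mathcal{N})$ is the Grothendieck group $K_0(B^q\mathcal{N})$ modulo the subgroup generated by the classes of binary acyclic complexes whose top and bottom differentials coincide. (It is naturally isomorphic to $K_1(\mathcal{N})$ by a theorem of Grayson.) A binary acyclic complex of length two is one concentrated in degrees $0,1,2$. A binary acyclic double complex is a bounded bigraded object $(P_{k,l})_{k,l\in\mathbb{N}}$ in $\mathcal{N}$ with morphisms $d^h,d'^{h}\colon P_{k,l}\to P_{k-1,l}$ and $d^v,d'^{v}\colon P_{k,l}\to P_{k,l-1}$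 such that $d^hd^v=d^vd^h$, $d'^{h}d'^{v}=d'^{v}d'^{h}$, every row $(P_{*,l},d^h,d'^{h})$ is a binary acyclic complex, and every column $(P_{k,*},d^v,d'^{v})$ is a binary acyclic complex (no commutation between primed and unprimed maps is required). $K_1^N(\mathcal{N})$ (Nenashev's group) is the abelian group generated by binary acyclic complexes of length two, subject to the relations: (1) a complex whose top and bottom differentials coincide represents zero; (2) for every binary acyclic double complex concentrated in bidegrees $0\le k,l\le 2$, one has $\sum_{l=0}^{2}(-1)^l[P_{*,l},d^h,d'^{h}]=\sum_{k=0}^{2}(-1)^k[P_{k,*},d^v,d'^{v}]$. The same relations hold in $K_0(\Omega\mathcal{N})$, so that $\Phi$ is well defined. *)

theory Defs
  imports "HOL-Algebra.Free_Abelian_Groups"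
begin

section \<open>Additive and exact categories\<close>

record ('o, 'a) cat =
  Ob :: "'o set"
  Ar :: "'a set"
  Src :: "'a \<Rightarrow> 'o"
  Trg :: "'a \<Rightarrow> 'o"
  Ident :: "'o \<Rightarrow> 'a"
  Comp :: "'a \<Rightarrow> 'a \<Rightarrow> 'a"  (infixr "\<odot>\<index>" 70)

definition Hom :: "('o, 'a, 'm) cat_scheme \<Rightarrow> 'o \<Rightarrow> 'o \<Rightarrow> 'a set" where
  "Hom C A B = {f \<in> Ar C. Src C f = A \<and> Trg C f = B}"

locale category =
  fixes C :: "('o, 'a, 'm) cat_scheme" (structure)
  assumes Src_Ob: "f \<in> Ar C \<Longrightarrow> Src C f \<in> Ob C"
    and Trg_Ob: "f \<in> Ar C \<Longrightarrow> Trg C f \<in> Ob C"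
    and Ident_Hom: "A \<in> Ob C \<Longrightarrow> Ident C A \<in> Hom C A A"
    and Comp_Hom: "\<lbrakk>f \<in> Hom C A B; g \<in> Hom C B D\<rbrakk> \<Longrightarrow> g \<odot> f \<in> Hom C A D"
    and Comp_Ident: "f \<in> Hom C A B \<Longrightarrow> f \<odot> Ident C A = f"
    and Ident_Comp: "f \<in> Hom C A B \<Longrightarrow> Ident C B \<odot> f = f"
    and Comp_assoc: "\<lbrakk>f \<in> Hom C A B; g \<in> Hom C B D; h \<in> Hom C D E\<rbrakk>
      \<Longrightarrow> h \<odot> (g \<odot> f) = (h \<odot> g) \<odot> f"

definition isomorphism :: "('o, 'a, 'm) cat_scheme \<Rightarrow> 'a \<Rightarrow> bool" where
  "isomorphism C f \<longleftrightarrow> f \<in> Ar C \<and>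
     (\<exists>g \<in> Hom C (Trg C f) (Src C f).
        g \<odot>\<^bsub>C\<^esub> f = Ident C (Src C f) \<and> f \<odot>\<^bsub>C\<^esub> g = Ident C (Trg C f))"

definition zero_object :: "('o, 'a, 'm) cat_scheme \<Rightarrow> 'o \<Rightarrow> bool" where
  "zero_object C Z \<longleftrightarrow> Z \<in> Ob C \<and>
     (\<forall>A \<in> Ob C. (\<exists>!f. f \<in> Hom C A Z) \<and> (\<exists>!f. f \<in> Hom C Z A))"

text \<open>The square \<open>f' \<odot> i = i' \<odot> f\<close> with \<open>i : A \<rightarrow> B\<close>, \<open>f : A \<rightarrow> A'\<close> is a pushout.\<close>

definition pushout :: "('o, 'a, 'm) cat_scheme \<Rightarrow> 'a \<Rightarrow> 'a \<Rightarrow> 'a \<Rightarrow> 'a \<Rightarrow> bool" where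
  "pushout C i f i' f' \<longleftrightarrow> {i, f, i', f'} \<subseteq> Ar C \<and>
     Src C f = Src C i \<and> Src C i' = Trg C f \<and> Src C f' = Trg C i \<and> Trg C f' = Trg C i' \<and>
     f' \<odot>\<^bsub>C\<^esub> i = i' \<odot>\<^bsub>C\<^esub> f \<and>
     (\<forall>X \<in> Ob C. \<forall>u \<in> Hom C (Trg C i) X. \<forall>v \<in> Hom C (Trg C f) X.
        u \<odot>\<^bsub>C\<^esub> i = v \<odot>\<^bsub>C\<^esub> f \<longrightarrow>
        (\<exists>!w. w \<in> Hom C (Trg C i') X \<and> w \<odot>\<^bsub>C\<^esub> f' = u \<and> w \<odot>\<^bsub>C\<^esub> i' = v))"

text \<open>The square \<open>p \<odot> f' = f \<odot> p'\<close> with \<open>p : B \<rightarrow> A\<close>, \<open>f : A' \<rightarrow> A\<close> is a pullback.\<close>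

definition pullback :: "('o, 'a, 'm) cat_scheme \<Rightarrow> 'a \<Rightarrow> 'a \<Rightarrow> 'a \<Rightarrow> 'a \<Rightarrow> bool" where
  "pullback C p f p' f' \<longleftrightarrow> {p, f, p', f'} \<subseteq> Ar C \<and>
     Trg C f = Trg C p \<and> Trg C p' = Src C f \<and> Trg C f' = Src C p \<and> Src C f' = Src C p' \<and>
     p \<odot>\<^bsub>C\<^esub> f' = f \<odot>\<^bsub>C\<^esub> p' \<and>
     (\<forall>X \<in> Ob C. \<forall>u \<in> Hom C X (Src C p). \<forall>v \<in> Hom C X (Src C f).
        p \<odot>\<^bsub>C\<^esub> u = f \<odot>\<^bsub>C\<^esub> v \<longrightarrow>
        (\<exists>!w. w \<in> Hom C X (Src C p') \<and> f' \<odot>\<^bsub>C\<^esub> w = u \<and> p' \<odot>\<^bsub>C\<^esub> w = v))"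

record ('o, 'a) precat = "('o, 'a) cat" +
  Plus :: "'a \<Rightarrow> 'a \<Rightarrow> 'a"  (infixl "\<boxplus>\<index>" 65)
  Zero :: "'o \<Rightarrow> 'o \<Rightarrow> 'a"

definition hom_group :: "('o, 'a, 'm) precat_scheme \<Rightarrow> 'o \<Rightarrow> 'o \<Rightarrow> 'a monoid" where
  "hom_group C A B = \<lparr>carrier = Hom C A B, monoid.mult = Plus C, one = Zero C A B\<rparr>"

locale preadditive_category = category C
  for C :: "('o, 'a, 'm) precat_scheme" (structure) +
  assumes comm_group_Hom: "\<lbrakk>A \<in> Ob C; B \<in> Ob C\<rbrakk> \<Longrightarrow> comm_group (hom_group C A B)"
    and Comp_Plus: "\<lbrakk>f \<in> Hom C A B; f' \<in> Hom C A B; g \<in> Hom C B D\<rbrakk>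
      \<Longrightarrow> g \<odot> (f \<boxplus> f') = g \<odot> f \<boxplus> g \<odot> f'"
    and Plus_Comp: "\<lbrakk>f \<in> Hom C A B; g \<in> Hom C B D; g' \<in> Hom C B D\<rbrakk>
      \<Longrightarrow> (g \<boxplus> g') \<odot> f = g \<odot> f \<boxplus> g' \<odot> f"

definition biproduct ::
  "('o, 'a, 'm) precat_scheme \<Rightarrow> 'o \<Rightarrow> 'o \<Rightarrow> 'o \<Rightarrow> 'a \<Rightarrow> 'a \<Rightarrow> 'a \<Rightarrow> 'a \<Rightarrow> bool" where
  "biproduct C A B S i j p q \<longleftrightarrow>
     i \<in> Hom C A S \<and> j \<in> Hom C B S \<and> p \<in> Hom C S A \<and> q \<in> Hom C S B \<and>
     p \<odot>\<^bsub>C\<^esub> i = Ident C A \<and> q \<odot>\<^bsub>C\<^esub> j = Ident C B \<and>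
     p \<odot>\<^bsub>C\<^esub> j = Zero C B A \<and> q \<odot>\<^bsub>C\<^esub> i = Zero C A B \<and>
     i \<odot>\<^bsub>C\<^esub> p \<boxplus>\<^bsub>C\<^esub> j \<odot>\<^bsub>C\<^esub> q = Ident C S"

locale additive_category = preadditive_category +
  assumes ex_zero_object: "\<exists>Z. zero_object C Z"
    and ex_biproduct: "\<lbrakk>A \<in> Ob C; B \<in> Ob C\<rbrakk>
      \<Longrightarrow> \<exists>S \<in> Ob C. \<exists>i j p q. biproduct C A B S i j p q"

text \<open>\<open>i\<close> is a kernel of \<open>p\<close> and \<open>p\<close> is a cokernel of \<open>i\<close>.\<close>

definition kernel_cokernel_pair :: "('o, 'a, 'm) precat_scheme \<Rightarrow> 'a \<Rightarrow> 'a \<Rightarrow> bool" where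
  "kernel_cokernel_pair C i p \<longleftrightarrow> i \<in> Ar C \<and> p \<in> Ar C \<and> Trg C i = Src C p \<and>
     p \<odot>\<^bsub>C\<^esub> i = Zero C (Src C i) (Trg C p) \<and>
     (\<forall>X \<in> Ob C. \<forall>f \<in> Hom C X (Src C p).
        p \<odot>\<^bsub>C\<^esub> f = Zero C X (Trg C p) \<longrightarrow> (\<exists>!g. g \<in> Hom C X (Src C i) \<and> i \<odot>\<^bsub>C\<^esub> g = f)) \<and>
     (\<forall>X \<in> Ob C. \<forall>f \<in> Hom C (Trg C i) X.
        f \<odot>\<^bsub>C\<^esub> i = Zero C (Src C i) X \<longrightarrow> (\<exists>!g. g \<in> Hom C (Trg C p) X \<and> g \<odot>\<^bsub>C\<^esub> p = f))"

text \<open>\<open>(i, p) \<in> Ses C\<close> says that \<open>i\<close> followed by \<open>p\<close> is a short exact sequence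
  (conflation) of the exact structure.\<close>

record ('o, 'a) excat = "('o, 'a) precat" +
  Ses :: "('a \<times> 'a) set"

definition admissible_mono :: "('o, 'a, 'm) excat_scheme \<Rightarrow> 'a \<Rightarrow> bool" where
  "admissible_mono C i \<longleftrightarrow> (\<exists>p. (i, p) \<in> Ses C)"

definition admissible_epi :: "('o, 'a, 'm) excat_scheme \<Rightarrow> 'a \<Rightarrow> bool" where
  "admissible_epi C p \<longleftrightarrow> (\<exists>i. (i, p) \<in> Ses C)"

text \<open>Quillen's axioms, in the form given in Buehler's survey \<open>Exact categories\<close>
  (no idempotent completeness is assumed).\<close>

locale exact_category = additive_category C
  for C :: "('o, 'a, 'm) excat_scheme" (structure) +
  assumes Ses_kernel_cokernel: "(i, p) \<in> Ses C \<Longrightarrow> kernel_cokernel_pair C i p"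
    and Ses_closed_iso: "\<lbrakk>(i, p) \<in> Ses C;
        isomorphism C a; isomorphism C b; isomorphism C c;
        Src C a = Src C i; Src C b = Trg C i; Src C c = Trg C p;
        i' \<in> Hom C (Trg C a) (Trg C b); p' \<in> Hom C (Trg C b) (Trg C c);
        i' \<odot> a = b \<odot> i; p' \<odot> b = c \<odot> p\<rbrakk> \<Longrightarrow> (i', p') \<in> Ses C"
    and Ident_admissible_mono: "A \<in> Ob C \<Longrightarrow> admissible_mono C (Ident C A)"
    and Ident_admissible_epi: "A \<in> Ob C \<Longrightarrow> admissible_epi C (Ident C A)"
    and Comp_admissible_mono: "\<lbrakk>admissible_mono C i; admissible_mono C j; Trg C i = Src C j\<rbrakk>
      \<Longrightarrow> admissible_mono C (j \<odot> i)"
    and Comp_admissible_epi: "\<lbrakk>admissible_epi C p; admissible_epi C q; Trg C p = Src C q\<rbrakk>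
      \<Longrightarrow> admissible_epi C (q \<odot> p)"
    and pushout_admissible_mono: "\<lbrakk>admissible_mono C i; f \<in> Ar C; Src C f = Src C i\<rbrakk>
      \<Longrightarrow> \<exists>i' f'. pushout C i f i' f' \<and> admissible_mono C i'"
    and pullback_admissible_epi: "\<lbrakk>admissible_epi C p; f \<in> Ar C; Trg C f = Trg C p\<rbrakk>
      \<Longrightarrow> \<exists>p' f'. pullback C p f p' f' \<and> admissible_epi C p'"

section \<open>Acyclic and binary acyclic complexes\<close>

text \<open>Complexes live in degrees \<open>0, 1, 2, \<dots>\<close>; the differential \<open>d n\<close> goes from degree
  \<open>n + 1\<close> to degree \<open>n\<close>.\<close>

definition chain_complex :: "('o, 'a, 'm) excat_scheme \<Rightarrow> (nat \<Rightarrow> 'o) \<Rightarrow> (nat \<Rightarrow> 'a) \<Rightarrow> bool" where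
  "chain_complex N P d \<longleftrightarrow>
     (\<forall>n. P n \<in> Ob N) \<and> (\<exists>b. \<forall>n>b. zero_object N (P n)) \<and>
     (\<forall>n. d n \<in> Hom N (P (Suc n)) (P n)) \<and>
     (\<forall>n. d n \<odot>\<^bsub>N\<^esub> d (Suc n) = Zero N (P (Suc (Suc n))) (P n))"

text \<open>The index of \<open>J\<close> is shifted by one: \<open>J n\<close> plays the role of $J_{n-1}$, the
  object through which the differential out of degree \<open>n\<close> factors.  Since the complex is zero
  in degree $-1$, the object $J_{-1}$, that is \<open>J 0\<close>, is zero.\<close>

definition acyclic_complex :: "('o, 'a, 'm) excat_scheme \<Rightarrow> (nat \<Rightarrow> 'o) \<Rightarrow> (nat \<Rightarrow> 'a) \<Rightarrow> bool" where
  "acyclic_complex N P d \<longleftrightarrow> chain_complex N P d \<and>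
     (\<exists>J i p. zero_object N (J 0) \<and>
        (\<forall>n. i n \<in> Hom N (J (Suc n)) (P n) \<and> p n \<in> Hom N (P n) (J n) \<and> (i n, p n) \<in> Ses N) \<and>
        (\<forall>n. d n = i n \<odot>\<^bsub>N\<^esub> p (Suc n)))"

record ('o, 'a) bcx =
  obj :: "nat \<Rightarrow> 'o"
  top_diff :: "nat \<Rightarrow> 'a"
  bot_diff :: "nat \<Rightarrow> 'a"

definition binary_acyclic :: "('o, 'a, 'm) excat_scheme \<Rightarrow> ('o, 'a) bcx \<Rightarrow> bool" where
  "binary_acyclic N P \<longleftrightarrow>
     acyclic_complex N (obj P) (top_diff P) \<and> acyclic_complex N (obj P) (bot_diff P)"

definition diagonal :: "('o, 'a) bcx \<Rightarrow> bool" where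
  "diagonal P \<longleftrightarrow> top_diff P = bot_diff P"

definition length_two :: "('o, 'a, 'm) excat_scheme \<Rightarrow> ('o, 'a) bcx \<Rightarrow> bool" where
  "length_two N P \<longleftrightarrow> (\<forall>n>2. zero_object N (obj P n))"

record ('o, 'a) bcx_map =
  map_src :: "('o, 'a) bcx"
  map_trg :: "('o, 'a) bcx"
  map_at :: "nat \<Rightarrow> 'a"

definition binary_chain_map :: "('o, 'a, 'm) excat_scheme \<Rightarrow> ('o, 'a) bcx_map \<Rightarrow> bool" where
  "binary_chain_map N f \<longleftrightarrow> (let P = map_src f; Q = map_trg f in
     binary_acyclic N P \<and> binary_acyclic N Q \<and>
     (\<forall>n. map_at f n \<in> Hom N (obj P n) (obj Q n)) \<and>
     (\<forall>n. map_at f n \<odot>\<^bsub>N\<^esub> top_diff P n = top_diff Q n \<odot>\<^bsub>N\<^esub> map_at f (Suc n)) \<and>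
     (\<forall>n. map_at f n \<odot>\<^bsub>N\<^esub> bot_diff P n = bot_diff Q n \<odot>\<^bsub>N\<^esub> map_at f (Suc n)))"

definition Bq :: "('o, 'a, 'm) excat_scheme \<Rightarrow> (('o, 'a) bcx, ('o, 'a) bcx_map) excat" where
  "Bq N = \<lparr>
     Ob = {P. binary_acyclic N P},
     Ar = {f. binary_chain_map N f},
     Src = map_src,
     Trg = map_trg,
     Ident = (\<lambda>P. \<lparr>map_src = P, map_trg = P, map_at = \<lambda>n. Ident N (obj P n)\<rparr>),
     Comp = (\<lambda>g f. \<lparr>map_src = map_src f, map_trg = map_trg g,
                     map_at = \<lambda>n. map_at g n \<odot>\<^bsub>N\<^esub> map_at f n\<rparr>),
     Plus = (\<lambda>f g. \<lparr>map_src = map_src f, map_trg = map_trg f,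
                     map_at = \<lambda>n. map_at f n \<boxplus>\<^bsub>N\<^esub> map_at g n\<rparr>),
     Zero = (\<lambda>P Q. \<lparr>map_src = P, map_trg = Q, map_at = \<lambda>n. Zero N (obj P n) (obj Q n)\<rparr>),
     Ses = {(i, p). binary_chain_map N i \<and> binary_chain_map N p \<and> map_trg i = map_src p \<and>
              (\<forall>n. (map_at i n, map_at p n) \<in> Ses N)}\<rparr>"

section \<open>The groups\<close>

text \<open>The abelian group with generators \<open>S\<close> and relators \<open>R\<close>, and the class of a generator.\<close>

definition presented_group :: "'g set \<Rightarrow> ('g \<Rightarrow>\<^sub>0 int) set \<Rightarrow> ('g \<Rightarrow>\<^sub>0 int) set monoid" where
  "presented_group S R = free_Abelian_group S Mod generate (free_Abelian_group S) R"

definition presented_class :: "'g set \<Rightarrow> ('g \<Rightarrow>\<^sub>0 int) set \<Rightarrow> 'g \<Rightarrow> ('g \<Rightarrow>\<^sub>0 int) set" where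
  "presented_class S R x =
     generate (free_Abelian_group S) R #>\<^bsub>free_Abelian_group S\<^esub> frag_of x"

text \<open>The generators of \<open>K0\<close> are objects; isomorphic objects get the same class because
  of the short exact sequences with a zero object as kernel.\<close>

definition K0_relators :: "('o, 'a, 'm) excat_scheme \<Rightarrow> ('o \<Rightarrow>\<^sub>0 int) set" where
  "K0_relators E =
     {frag_of (Src E p) - frag_of (Src E i) - frag_of (Trg E p) | i p. (i, p) \<in> Ses E}"

definition K0 :: "('o, 'a, 'm) excat_scheme \<Rightarrow> ('o \<Rightarrow>\<^sub>0 int) set monoid" where
  "K0 E = presented_group (Ob E) (K0_relators E)"

definition K0_class :: "('o, 'a, 'm) excat_scheme \<Rightarrow> 'o \<Rightarrow> ('o \<Rightarrow>\<^sub>0 int) set" where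
  "K0_class E = presented_class (Ob E) (K0_relators E)"

definition diagonal_subgroup ::
  "('o, 'a, 'm) excat_scheme \<Rightarrow> (('o, 'a) bcx \<Rightarrow>\<^sub>0 int) set set" where
  "diagonal_subgroup N =
     generate (K0 (Bq N)) {K0_class (Bq N) P | P. P \<in> Ob (Bq N) \<and> diagonal P}"

definition K0_Omega ::
  "('o, 'a, 'm) excat_scheme \<Rightarrow> (('o, 'a) bcx \<Rightarrow>\<^sub>0 int) set set monoid" where
  "K0_Omega N = K0 (Bq N) Mod diagonal_subgroup N"

definition K0_Omega_class ::
  "('o, 'a, 'm) excat_scheme \<Rightarrow> ('o, 'a) bcx \<Rightarrow> (('o, 'a) bcx \<Rightarrow>\<^sub>0 int) set set" where
  "K0_Omega_class N P = diagonal_subgroup N #>\<^bsub>K0 (Bq N)\<^esub> K0_class (Bq N) P"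

text \<open>\<open>horiz D k l\<close> goes from bidegree \<open>(k + 1, l)\<close> to \<open>(k, l)\<close>,
  and \<open>vert D k l\<close> from \<open>(k, l + 1)\<close> to \<open>(k, l)\<close>; likewise for the primed differentials
  \<open>horiz'\<close>, \<open>vert'\<close>.\<close>

record ('o, 'a) bdcx =
  dobj :: "nat \<Rightarrow> nat \<Rightarrow> 'o"
  horiz :: "nat \<Rightarrow> nat \<Rightarrow> 'a"
  horiz' :: "nat \<Rightarrow> nat \<Rightarrow> 'a"
  vert :: "nat \<Rightarrow> nat \<Rightarrow> 'a"
  vert' :: "nat \<Rightarrow> nat \<Rightarrow> 'a"

definition row :: "('o, 'a) bdcx \<Rightarrow> nat \<Rightarrow> ('o, 'a) bcx" where
  "row D l = \<lparr>obj = \<lambda>k. dobj D k l, top_diff = \<lambda>k. horiz D k l, bot_diff = \<lambda>k. horiz' D k l\<rparr>"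

definition col :: "('o, 'a) bdcx \<Rightarrow> nat \<Rightarrow> ('o, 'a) bcx" where
  "col D k = \<lparr>obj = \<lambda>l. dobj D k l, top_diff = \<lambda>l. vert D k l, bot_diff = \<lambda>l. vert' D k l\<rparr>"

definition binary_acyclic_double :: "('o, 'a, 'm) excat_scheme \<Rightarrow> ('o, 'a) bdcx \<Rightarrow> bool" where
  "binary_acyclic_double N D \<longleftrightarrow>
     (\<exists>b. \<forall>k l. k > b \<or> l > b \<longrightarrow> zero_object N (dobj D k l)) \<and>
     (\<forall>k l. horiz D k l \<odot>\<^bsub>N\<^esub> vert D (Suc k) l = vert D k l \<odot>\<^bsub>N\<^esub> horiz D k (Suc l)) \<and>
     (\<forall>k l. horiz' D k l \<odot>\<^bsub>N\<^esub> vert' D (Suc k) l = vert' D k l \<odot>\<^bsub>N\<^esub> horiz' D k (Suc l)) \<and>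
     (\<forall>l. binary_acyclic N (row D l)) \<and> (\<forall>k. binary_acyclic N (col D k))"

definition double_length_two :: "('o, 'a, 'm) excat_scheme \<Rightarrow> ('o, 'a) bdcx \<Rightarrow> bool" where
  "double_length_two N D \<longleftrightarrow> (\<forall>k l. k > 2 \<or> l > 2 \<longrightarrow> zero_object N (dobj D k l))"

definition K1N_generators :: "('o, 'a, 'm) excat_scheme \<Rightarrow> ('o, 'a) bcx set" where
  "K1N_generators N = {P. binary_acyclic N P \<and> length_two N P}"

definition K1N_relators :: "('o, 'a, 'm) excat_scheme \<Rightarrow> (('o, 'a) bcx \<Rightarrow>\<^sub>0 int) set" where
  "K1N_relators N =
     {frag_of P | P. P \<in> K1N_generators N \<and> diagonal P} \<union>
     {(\<Sum>l\<le>2. frag_cmul ((-1) ^ l) (frag_of (row D l))) -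
      (\<Sum>k\<le>2. frag_cmul ((-1) ^ k) (frag_of (col D k))) | D.
        binary_acyclic_double N D \<and> double_length_two N D}"

definition K1N :: "('o, 'a, 'm) excat_scheme \<Rightarrow> (('o, 'a) bcx \<Rightarrow>\<^sub>0 int) set monoid" where
  "K1N N = presented_group (K1N_generators N) (K1N_relators N)"

definition K1N_class ::
  "('o, 'a, 'm) excat_scheme \<Rightarrow> ('o, 'a) bcx \<Rightarrow> (('o, 'a) bcx \<Rightarrow>\<^sub>0 int) set" where
  "K1N_class N = presented_class (K1N_generators N) (K1N_relators N)"

text \<open>\<open>\<Phi>\<close> is the natural homomorphism; it is determined on \<open>carrier (K1N N)\<close> by
  its values on the generators.\<close>

definition natural_hom :: "('o, 'a, 'm) excat_scheme \<Rightarrow>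
    ((('o, 'a) bcx \<Rightarrow>\<^sub>0 int) set \<Rightarrow> (('o, 'a) bcx \<Rightarrow>\<^sub>0 int) set set) \<Rightarrow> bool" where
  "natural_hom N \<Phi> \<longleftrightarrow> \<Phi> \<in> hom (K1N N) (K0_Omega N) \<and>
     (\<forall>P \<in> K1N_generators N. \<Phi> (K1N_class N P) = K0_Omega_class N P)"

end

theory Submission
  imports Defs
begin

text \<open>Let \<open>J\<close>, \<open>K\<close> be the kernels of the top and bottom differentials \<open>P 1 \<rightarrow> P 0\<close> of a binary acyclic
  complex \<open>P\<close>. Cut the top at \<open>J\<close> and the bottom at \<open>K\<close>; the pieces \<open>\<dots> \<rightarrow> P 3 \<rightarrow> P 2 \<rightarrow> J\<close>,
  \<open>J \<rightarrow> P 1 \<rightarrow> P 0\<close> and their bottom counterparts can be reassembled, with some extra copies of \<open>J\<close> and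
  \<open>K\<close>, into a binary acyclic complex which is one degree shorter if \<open>P\<close> has length at least three.
  This shortening respects short exact sequences. If \<open>P\<close> is diagonal above degree one, its
  shortening is an extension of a length-two complex, equivalent to \<open>J \<rightarrow> P 1 \<rightarrow> P 0\<close>, by a diagonal
  complex; hence shortening kills diagonal complexes and fixes the classes of complexes of length
  two. Iterating it gives a left inverse of \<open>\<Phi>\<close>.

  Filtering total complexes of double complexes by rows and by columns shows that \<open>\<Phi>\<close> is well
  defined and that shifting a complex changes the sign of its class in \<open>K0_Omega\<close>. By
  additivity the shortenings of \<open>P\<close> and \<open>P[1]\<close> therefore have opposite classes. But the shortening of
  \<open>P[1]\<close> is, modulo complexes of length two, \<open>P\<close> with its two differentials exchanged, so surjectivity
  follows by induction on the length.\<close>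

section \<open>Additive categories\<close>

text \<open>The obstacle is that \<open>J\<close> and \<open>K\<close> need not be isomorphic, so
  the cut pieces of top and bottom do not live on a common graded object; contractible complexes on
  \<open>J\<close> and \<open>K\<close> equalise the objects. The piece above the cut moves down one
  degree, which reverses the sign of a class; it is therefore inserted with top and bottom
  exchanged, which reverses the sign once more. The kernels are merely chosen: conflations of
  complexes induce conflations of kernels, and this makes the class of a shortening additive and
  independent of the cut. Without idempotent completeness, that exactness statement
  (\<open>kernels_short_exact\<close>) is derived from pushouts and pullbacks. The predicate
  \<open>nenashev R b\<close> isolates what is used about a set of relators, so the same
  computations serve both groups. Each complex is shortened just often enough to reach length two;
  shortening more often does not change the class, so the left inverse needs no common length
  bound.\<close>

context preadditive_category
begin

lemma HomI: "f \<in> Ar C \<Longrightarrow> Src C f = A \<Longrightarrow> Trg C f = B \<Longrightarrow> f \<in> Hom C A B"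
  by (simp add: Hom_def)

lemma HomD: assumes "f \<in> Hom C A B" shows "f \<in> Ar C" "Src C f = A" "Trg C f = B"
  using assms by (auto simp: Hom_def)

lemma Ar_Hom: "f \<in> Ar C \<Longrightarrow> f \<in> Hom C (Src C f) (Trg C f)"
  by (simp add: Hom_def)

declare Src_Ob[simp] Trg_Ob[simp]

text \<open>Arrows are typed by rewriting sources and targets instead of by membership in
  \<open>Hom\<close>, so that the simplifier discharges the typing conditions of later
  equations.\<close>

lemma Comp_Ar[simp]:
  assumes "f \<in> Ar C" "g \<in> Ar C" "Src C g = Trg C f"
  shows "g \<odot> f \<in> Ar C" "Src C (g \<odot> f) = Src C f" "Trg C (g \<odot> f) = Trg C g"
  using HomD[OF Comp_Hom[OF Ar_Hom[OF assms(1)], of g "Trg C g"]] assms by (auto simp: Hom_def)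

lemma Ident_Ar[simp]:
  assumes "A \<in> Ob C"
  shows "Ident C A \<in> Ar C" "Src C (Ident C A) = A" "Trg C (Ident C A) = A"
  using HomD[OF Ident_Hom[OF assms]] by auto

lemma Comp_Ident'[simp]: "f \<in> Ar C \<Longrightarrow> Src C f = A \<Longrightarrow> f \<odot> Ident C A = f"
  using Comp_Ident Ar_Hom by metis

lemma Ident_Comp'[simp]: "f \<in> Ar C \<Longrightarrow> Trg C f = A \<Longrightarrow> Ident C A \<odot> f = f"
  using Ident_Comp Ar_Hom by metis

lemma Comp_assoc'[simp]:
  assumes "f \<in> Ar C" "g \<in> Ar C" "h \<in> Ar C" "Src C g = Trg C f" "Src C h = Trg C g"
  shows "(h \<odot> g) \<odot> f = h \<odot> (g \<odot> f)"
  using Comp_assoc[OF Ar_Hom[OF assms(1)], of g "Trg C g" h "Trg C h"] assms by (simp add: Hom_def)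

abbreviation par :: "'a \<Rightarrow> 'a \<Rightarrow> bool" where
  "par f g \<equiv> Src C f = Src C g \<and> Trg C f = Trg C g"

lemma hom_group_carrier: "carrier (hom_group C A B) = Hom C A B"
  and hom_group_mult: "monoid.mult (hom_group C A B) = Plus C"
  and hom_group_one: "one (hom_group C A B) = Zero C A B"
  by (auto simp: hom_group_def)

lemmas hom_group_simps = hom_group_carrier hom_group_mult hom_group_one

definition ng :: "'a \<Rightarrow> 'a" where
  "ng f = m_inv (hom_group C (Src C f) (Trg C f)) f"

lemma Zero_Ar[simp]:
  assumes "A \<in> Ob C" "B \<in> Ob C"
  shows "Zero C A B \<in> Ar C" "Src C (Zero C A B) = A" "Trg C (Zero C A B) = B"
proof -
  interpret comm_group "hom_group C A B" using comm_group_Hom[OF assms] .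
  have "Zero C A B \<in> Hom C A B" using one_closed by (simp add: hom_group_simps)
  then show "Zero C A B \<in> Ar C" "Src C (Zero C A B) = A" "Trg C (Zero C A B) = B"
    by (auto simp: Hom_def)
qed

lemma Plus_Ar[simp]:
  assumes "f \<in> Ar C" "g \<in> Ar C" "Src C g = Src C f" "Trg C g = Trg C f"
  shows "f \<boxplus> g \<in> Ar C" "Src C (f \<boxplus> g) = Src C f" "Trg C (f \<boxplus> g) = Trg C f"
proof -
  interpret comm_group "hom_group C (Src C f) (Trg C f)"
    by (rule comm_group_Hom) (simp_all add: assms(1))
  have "f \<boxplus> g \<in> Hom C (Src C f) (Trg C f)"
    using m_closed[of f g] assms by (simp add: hom_group_simps Hom_def)
  then show "f \<boxplus> g \<in> Ar C" "Src C (f \<boxplus> g) = Src C f" "Trg C (f \<boxplus> g) = Trg C f"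
    by (auto simp: Hom_def)
qed

lemma ng_Ar[simp]:
  assumes "f \<in> Ar C"
  shows "ng f \<in> Ar C" "Src C (ng f) = Src C f" "Trg C (ng f) = Trg C f"
proof -
  interpret comm_group "hom_group C (Src C f) (Trg C f)"
    by (rule comm_group_Hom) (simp_all add: assms(1))
  have "ng f \<in> Hom C (Src C f) (Trg C f)"
    using inv_closed[of f] assms by (simp add: hom_group_simps Hom_def ng_def)
  then show "ng f \<in> Ar C" "Src C (ng f) = Src C f" "Trg C (ng f) = Trg C f"
    by (auto simp: Hom_def)
qed

lemma Plus_assoc:
  assumes "f \<in> Ar C" "g \<in> Ar C" "h \<in> Ar C" "par g f" "par h f"
  shows "(f \<boxplus> g) \<boxplus> h = f \<boxplus> (g \<boxplus> h)"
proof -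
  interpret comm_group "hom_group C (Src C f) (Trg C f)"
    by (rule comm_group_Hom) (simp_all add: assms(1))
  show ?thesis using m_assoc[of f g h] assms by (simp add: hom_group_simps Hom_def)
qed

lemma Plus_comm:
  assumes "f \<in> Ar C" "g \<in> Ar C" "par g f"
  shows "f \<boxplus> g = g \<boxplus> f"
proof -
  interpret comm_group "hom_group C (Src C f) (Trg C f)"
    by (rule comm_group_Hom) (simp_all add: assms(1))
  show ?thesis using m_comm[of f g] assms by (simp add: hom_group_simps Hom_def)
qed

lemma Plus_left_comm:
  assumes "f \<in> Ar C" "g \<in> Ar C" "h \<in> Ar C" "par g f" "par h f"
  shows "f \<boxplus> (g \<boxplus> h) = g \<boxplus> (f \<boxplus> h)"
  using Plus_assoc[of f g h] Plus_assoc[of g f h] Plus_comm[of f g] assms by simp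

lemmas Plus_ac = Plus_assoc Plus_comm Plus_left_comm

lemma Plus_Zero[simp]:
  assumes "f \<in> Ar C" "Src C f = A" "Trg C f = B"
  shows "f \<boxplus> Zero C A B = f" "Zero C A B \<boxplus> f = f"
proof -
  interpret comm_group "hom_group C (Src C f) (Trg C f)"
    by (rule comm_group_Hom) (simp_all add: assms(1))
  show "f \<boxplus> Zero C A B = f" "Zero C A B \<boxplus> f = f"
    using r_one[of f] l_one[of f] assms by (auto simp: hom_group_simps Hom_def)
qed

lemma Plus_ng[simp]:
  assumes "f \<in> Ar C"
  shows "f \<boxplus> ng f = Zero C (Src C f) (Trg C f)" "ng f \<boxplus> f = Zero C (Src C f) (Trg C f)"
proof -
  interpret comm_group "hom_group C (Src C f) (Trg C f)"
    by (rule comm_group_Hom) (simp_all add: assms(1))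
  show "f \<boxplus> ng f = Zero C (Src C f) (Trg C f)" "ng f \<boxplus> f = Zero C (Src C f) (Trg C f)"
    using r_inv[of f] l_inv[of f] assms by (auto simp: hom_group_simps Hom_def ng_def)
qed

lemma Plus_ng_cancel[simp]:
  assumes "f \<in> Ar C" "g \<in> Ar C" "par g f"
  shows "f \<boxplus> (ng f \<boxplus> g) = g" "ng f \<boxplus> (f \<boxplus> g) = g"
  using Plus_assoc[of f "ng f" g] Plus_assoc[of "ng f" f g] assms by auto

lemma ng_unique:
  assumes "f \<in> Ar C" "g \<in> Ar C" "par g f" "f \<boxplus> g = Zero C (Src C f) (Trg C f)"
  shows "g = ng f"
  using Plus_ng_cancel(2)[of f g] assms by auto

lemma ng_ng[simp]: "f \<in> Ar C \<Longrightarrow> ng (ng f) = f"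
  by (rule ng_unique[symmetric]) auto

lemma Plus_cancel:
  assumes "f \<in> Ar C" "g \<in> Ar C" "h \<in> Ar C" "par g f" "par h f" "f \<boxplus> g = f \<boxplus> h"
  shows "g = h"
  using Plus_ng_cancel(2)[of f g] Plus_ng_cancel(2)[of f h] assms by metis

lemma Comp_Plus'[simp]:
  assumes "f \<in> Ar C" "g \<in> Ar C" "h \<in> Ar C" "par g f" "Src C h = Trg C f"
  shows "h \<odot> (f \<boxplus> g) = h \<odot> f \<boxplus> h \<odot> g"
  using Comp_Plus[OF Ar_Hom[OF assms(1)], of g h "Trg C h"] assms by (simp add: Hom_def)

lemma Plus_Comp'[simp]:
  assumes "f \<in> Ar C" "g \<in> Ar C" "h \<in> Ar C" "par g f" "Trg C h = Src C f"
  shows "(f \<boxplus> g) \<odot> h = f \<odot> h \<boxplus> g \<odot> h"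
  using Plus_Comp[OF Ar_Hom[OF assms(3)], of f "Trg C f" g] assms by (simp add: Hom_def)

lemma Comp_Zero[simp]:
  assumes "h \<in> Ar C" "A \<in> Ob C" "Src C h = B"
  shows "h \<odot> Zero C A B = Zero C A (Trg C h)"
proof -
  have B: "B \<in> Ob C" using assms by auto
  have "h \<odot> Zero C A B \<boxplus> h \<odot> Zero C A B = h \<odot> Zero C A B \<boxplus> Zero C A (Trg C h)"
    using Comp_Plus'[of "Zero C A B" "Zero C A B" h] assms B by simp
  then show ?thesis using Plus_cancel[of "h \<odot> Zero C A B" "h \<odot> Zero C A B" "Zero C A (Trg C h)"] assms B by simp
qed

lemma Zero_Comp[simp]:
  assumes "h \<in> Ar C" "A \<in> Ob C" "Trg C h = B"
  shows "Zero C B A \<odot> h = Zero C (Src C h) A"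
proof -
  have B: "B \<in> Ob C" using assms by auto
  have "Zero C B A \<odot> h \<boxplus> Zero C B A \<odot> h = Zero C B A \<odot> h \<boxplus> Zero C (Src C h) A"
    using Plus_Comp'[of "Zero C B A" "Zero C B A" h] assms B by simp
  then show ?thesis using Plus_cancel[of "Zero C B A \<odot> h" "Zero C B A \<odot> h" "Zero C (Src C h) A"] assms B by simp
qed

lemma ng_Zero[simp]: "A \<in> Ob C \<Longrightarrow> B \<in> Ob C \<Longrightarrow> ng (Zero C A B) = Zero C A B"
  by (rule ng_unique[symmetric]) auto

lemma Comp_ng[simp]:
  assumes "f \<in> Ar C" "h \<in> Ar C" "Src C h = Trg C f"
  shows "h \<odot> ng f = ng (h \<odot> f)"
proof -
  have "h \<odot> f \<boxplus> h \<odot> ng f = h \<odot> (f \<boxplus> ng f)"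
    using assms by (intro Comp_Plus'[symmetric]) auto
  then have "h \<odot> f \<boxplus> h \<odot> ng f = Zero C (Src C f) (Trg C h)"
    using assms by (simp del: Comp_Plus')
  then show ?thesis using assms by (intro ng_unique) auto
qed

lemma ng_Comp[simp]:
  assumes "f \<in> Ar C" "h \<in> Ar C" "Src C h = Trg C f"
  shows "ng h \<odot> f = ng (h \<odot> f)"
proof -
  have "h \<odot> f \<boxplus> ng h \<odot> f = (h \<boxplus> ng h) \<odot> f"
    using assms by (intro Plus_Comp'[symmetric]) auto
  then have "h \<odot> f \<boxplus> ng h \<odot> f = Zero C (Src C f) (Trg C h)"
    using assms by (simp del: Plus_Comp')
  then show ?thesis using assms by (intro ng_unique) auto
qed

lemma ng_Plus[simp]:
  assumes "f \<in> Ar C" "g \<in> Ar C" "par g f"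
  shows "ng (f \<boxplus> g) = ng f \<boxplus> ng g"
proof -
  have "g \<boxplus> (ng f \<boxplus> ng g) = ng f"
    using assms Plus_left_comm[of g "ng f" "ng g"] by simp
  then have "(f \<boxplus> g) \<boxplus> (ng f \<boxplus> ng g) = Zero C (Src C f) (Trg C f)"
    using assms Plus_assoc[of f g "ng f \<boxplus> ng g"] by simp
  then show ?thesis using ng_unique[of "f \<boxplus> g" "ng f \<boxplus> ng g"] assms by simp
qed

lemma zero_objectD:
  assumes "zero_object C Z"
  shows "Z \<in> Ob C"
  using assms by (simp add: zero_object_def)

lemma to_zero_eq:
  assumes "zero_object C Z" "f \<in> Ar C" "Trg C f = Z"
  shows "f = Zero C (Src C f) Z"
  using assms unfolding zero_object_def
  by (metis (no_types, lifting) Src_Ob HomI Zero_Ar)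

lemma from_zero_eq:
  assumes "zero_object C Z" "f \<in> Ar C" "Src C f = Z"
  shows "f = Zero C Z (Trg C f)"
  using assms unfolding zero_object_def
  by (metis (no_types, lifting) Trg_Ob HomI Zero_Ar)

text \<open>If the identity of \<open>Z\<close> vanishes, every arrow into or out of
  \<open>Z\<close> equals its composite with a zero arrow. This trades a universal property for one
  equation.\<close>

lemma zero_object_iff: "zero_object C Z \<longleftrightarrow> Z \<in> Ob C \<and> Ident C Z = Zero C Z Z"
proof
  assume a: "zero_object C Z"
  then show "Z \<in> Ob C \<and> Ident C Z = Zero C Z Z"
    using to_zero_eq[OF a, of "Ident C Z"] zero_objectD[OF a] by simp
next
  assume a: "Z \<in> Ob C \<and> Ident C Z = Zero C Z Z"
  have 1: "f = Zero C A Z" if "f \<in> Hom C A Z" for f A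
    using that a Ident_Comp'[of f Z] Zero_Comp[of f Z Z] by (auto simp: Hom_def)
  have 2: "f = Zero C Z A" if "f \<in> Hom C Z A" for f A
    using that a Comp_Ident'[of f Z] Comp_Zero[of f Z Z] by (auto simp: Hom_def)
  show "zero_object C Z"
    unfolding zero_object_def
  proof (intro conjI ballI)
    show "Z \<in> Ob C" using a by simp
    fix A assume A: "A \<in> Ob C"
    show "\<exists>!f. f \<in> Hom C A Z"
      by (rule ex1I[of _ "Zero C A Z"]) (use 1 a A in \<open>auto simp: Hom_def\<close>)
    show "\<exists>!f. f \<in> Hom C Z A"
      by (rule ex1I[of _ "Zero C Z A"]) (use 2 a A in \<open>auto simp: Hom_def\<close>)
  qed
qed

end

section \<open>Chosen biproducts and matrices of arrows\<close>

context additive_category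
begin

definition Z0 :: 'a where "Z0 = (SOME Z. zero_object C Z)"

lemma zero_object_Z0[simp]: "zero_object C Z0"
  unfolding Z0_def using ex_zero_object by (rule someI_ex)

lemma Z0_Ob[simp]: "Z0 \<in> Ob C"
  using zero_objectD by simp

lemma Ident_Z0[simp]: "Ident C Z0 = Zero C Z0 Z0"
  using zero_object_iff[of Z0] by simp

definition bip :: "'a \<Rightarrow> 'a \<Rightarrow> 'a \<times> 'b \<times> 'b \<times> 'b \<times> 'b" where
  "bip A B = (SOME (S, i, j, p, q). S \<in> Ob C \<and> biproduct C A B S i j p q)"

definition dsum :: "'a \<Rightarrow> 'a \<Rightarrow> 'a"  (infixr "\<oplus>\<oplus>" 65) where "dsum A B = fst (bip A B)"
definition in1 :: "'a \<Rightarrow> 'a \<Rightarrow> 'b" where "in1 A B = fst (snd (bip A B))"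
definition in2 :: "'a \<Rightarrow> 'a \<Rightarrow> 'b" where "in2 A B = fst (snd (snd (bip A B)))"
definition pr1 :: "'a \<Rightarrow> 'a \<Rightarrow> 'b" where "pr1 A B = fst (snd (snd (snd (bip A B))))"
definition pr2 :: "'a \<Rightarrow> 'a \<Rightarrow> 'b" where "pr2 A B = snd (snd (snd (snd (bip A B))))"

lemma bip:
  assumes "A \<in> Ob C" "B \<in> Ob C"
  shows "A \<oplus>\<oplus> B \<in> Ob C \<and> biproduct C A B (A \<oplus>\<oplus> B) (in1 A B) (in2 A B) (pr1 A B) (pr2 A B)"
proof -
  have "\<exists>x. case x of (S, i, j, p, q) \<Rightarrow> S \<in> Ob C \<and> biproduct C A B S i j p q"
    using ex_biproduct[OF assms] by fastforce
  then have "case bip A B of (S, i, j, p, q) \<Rightarrow> S \<in> Ob C \<and> biproduct C A B S i j p q"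
    unfolding bip_def by (rule someI_ex)
  then show ?thesis
    by (auto simp: dsum_def in1_def in2_def pr1_def pr2_def split: prod.splits)
qed

context
  fixes A B assumes AB[simp]: "A \<in> Ob C" "B \<in> Ob C"
begin

lemma dsum_Ob[simp]: "A \<oplus>\<oplus> B \<in> Ob C" using bip AB by blast

lemma bip_Ar[simp]:
  "in1 A B \<in> Ar C" "Src C (in1 A B) = A" "Trg C (in1 A B) = A \<oplus>\<oplus> B"
  "in2 A B \<in> Ar C" "Src C (in2 A B) = B" "Trg C (in2 A B) = A \<oplus>\<oplus> B"
  "pr1 A B \<in> Ar C" "Trg C (pr1 A B) = A" "Src C (pr1 A B) = A \<oplus>\<oplus> B"
  "pr2 A B \<in> Ar C" "Trg C (pr2 A B) = B" "Src C (pr2 A B) = A \<oplus>\<oplus> B"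
  using bip[OF AB] by (auto simp: biproduct_def Hom_def)

lemma bip_eqs:
  "pr1 A B \<odot> in1 A B = Ident C A" "pr2 A B \<odot> in2 A B = Ident C B"
  "pr1 A B \<odot> in2 A B = Zero C B A" "pr2 A B \<odot> in1 A B = Zero C A B"
  "in1 A B \<odot> pr1 A B \<boxplus> in2 A B \<odot> pr2 A B = Ident C (A \<oplus>\<oplus> B)"
  using bip[OF AB] by (auto simp: biproduct_def)

end

text \<open>Matrix notation: \<open>pr f g\<close> is a column, mapping into a direct sum, and
  \<open>cp f g\<close> is a row, mapping out of one. Larger matrices are nested, with
  \<open>cp\<close> outermost.\<close>

definition pr :: "'b \<Rightarrow> 'b \<Rightarrow> 'b" where
  "pr f g = in1 (Trg C f) (Trg C g) \<odot> f \<boxplus> in2 (Trg C f) (Trg C g) \<odot> g"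

definition cp :: "'b \<Rightarrow> 'b \<Rightarrow> 'b" where
  "cp f g = f \<odot> pr1 (Src C f) (Src C g) \<boxplus> g \<odot> pr2 (Src C f) (Src C g)"

lemma pr_Ar[simp]:
  assumes "f \<in> Ar C" "g \<in> Ar C" "Src C g = Src C f"
  shows "pr f g \<in> Ar C" "Src C (pr f g) = Src C f" "Trg C (pr f g) = Trg C f \<oplus>\<oplus> Trg C g"
  using assms by (auto simp: pr_def)

lemma cp_Ar[simp]:
  assumes "f \<in> Ar C" "g \<in> Ar C" "Trg C g = Trg C f"
  shows "cp f g \<in> Ar C" "Trg C (cp f g) = Trg C f" "Src C (cp f g) = Src C f \<oplus>\<oplus> Src C g"
  using assms by (auto simp: cp_def)

text \<open>Composites are normalised to the right, which hides a known product
  \<open>h \<odot> g\<close> inside \<open>h \<odot> (g \<odot> f)\<close>; this recovers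
  it.\<close>

lemma Comp_red:
  assumes "f \<in> Ar C" "g \<in> Ar C" "h \<in> Ar C" "Src C g = Trg C f" "Src C h = Trg C g" "h \<odot> g = k"
  shows "h \<odot> (g \<odot> f) = k \<odot> f"
  using Comp_assoc'[OF assms(1-5)] assms(6) by simp

lemma pr_pr:
  assumes "f \<in> Ar C" "g \<in> Ar C" "Src C g = Src C f" "Trg C f = A" "Trg C g = B"
  shows "pr1 A B \<odot> pr f g = f" "pr2 A B \<odot> pr f g = g"
  using assms Comp_red[of f "in1 A B" "pr1 A B"] Comp_red[of g "in2 A B" "pr1 A B"]
    Comp_red[of f "in1 A B" "pr2 A B"] Comp_red[of g "in2 A B" "pr2 A B"]
  by (auto simp: pr_def bip_eqs)

lemma cp_in:
  assumes "f \<in> Ar C" "g \<in> Ar C" "Trg C g = Trg C f" "Src C f = A" "Src C g = B"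
  shows "cp f g \<odot> in1 A B = f" "cp f g \<odot> in2 A B = g"
  using assms by (auto simp: cp_def bip_eqs)

lemma cp_pr[simp]:
  assumes "f \<in> Ar C" "g \<in> Ar C" "h \<in> Ar C" "k \<in> Ar C"
    "Trg C g = Trg C f" "Src C k = Src C h" "Src C f = Trg C h" "Src C g = Trg C k"
  shows "cp f g \<odot> pr h k = f \<odot> h \<boxplus> g \<odot> k"
  using assms by (simp add: cp_def pr_pr[of h k])

lemma pr_Comp[simp]:
  assumes "f \<in> Ar C" "g \<in> Ar C" "h \<in> Ar C" "Src C g = Src C f" "Trg C h = Src C f"
  shows "pr f g \<odot> h = pr (f \<odot> h) (g \<odot> h)"
  using assms by (simp add: pr_def)

lemma Comp_cp[simp]:
  assumes "f \<in> Ar C" "g \<in> Ar C" "h \<in> Ar C" "Trg C g = Trg C f" "Src C h = Trg C f"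
  shows "h \<odot> cp f g = cp (h \<odot> f) (h \<odot> g)"
  using assms by (simp add: cp_def)

lemma pr_Plus[simp]:
  assumes "f \<in> Ar C" "g \<in> Ar C" "h \<in> Ar C" "k \<in> Ar C" "Src C g = Src C f" "par h f" "par k g"
  shows "pr f g \<boxplus> pr h k = pr (f \<boxplus> h) (g \<boxplus> k)"
  using assms by (simp add: pr_def Plus_ac)

lemma cp_Plus[simp]:
  assumes "f \<in> Ar C" "g \<in> Ar C" "h \<in> Ar C" "k \<in> Ar C" "Trg C g = Trg C f" "par h f" "par k g"
  shows "cp f g \<boxplus> cp h k = cp (f \<boxplus> h) (g \<boxplus> k)"
  using assms by (simp add: cp_def Plus_ac)

lemma pr_eta:
  assumes "f \<in> Ar C" "Trg C f = A \<oplus>\<oplus> B" "A \<in> Ob C" "B \<in> Ob C"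
  shows "pr (pr1 A B \<odot> f) (pr2 A B \<odot> f) = f"
proof -
  have "pr (pr1 A B \<odot> f) (pr2 A B \<odot> f) = (in1 A B \<odot> pr1 A B \<boxplus> in2 A B \<odot> pr2 A B) \<odot> f"
    using assms by (simp add: pr_def del: Plus_Comp') (simp add: assms)
  then show ?thesis using assms by (simp add: bip_eqs)
qed

lemma cp_eta:
  assumes "f \<in> Ar C" "Src C f = A \<oplus>\<oplus> B" "A \<in> Ob C" "B \<in> Ob C"
  shows "cp (f \<odot> in1 A B) (f \<odot> in2 A B) = f"
proof -
  have "cp (f \<odot> in1 A B) (f \<odot> in2 A B) = f \<odot> (in1 A B \<odot> pr1 A B \<boxplus> in2 A B \<odot> pr2 A B)"
    using assms by (simp add: cp_def del: Comp_Plus') (simp add: assms)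
  then show ?thesis using assms by (simp add: bip_eqs)
qed

lemma pr_eq_iff[simp]:
  assumes "f \<in> Ar C" "g \<in> Ar C" "h \<in> Ar C" "k \<in> Ar C" "Src C g = Src C f" "Src C k = Src C h"
    "par h f" "par k g"
  shows "pr f g = pr h k \<longleftrightarrow> f = h \<and> g = k"
  using pr_pr[of f g] pr_pr[of h k] assms by metis

lemma cp_eq_iff[simp]:
  assumes "f \<in> Ar C" "g \<in> Ar C" "h \<in> Ar C" "k \<in> Ar C" "Trg C g = Trg C f" "Trg C k = Trg C h"
    "par h f" "par k g"
  shows "cp f g = cp h k \<longleftrightarrow> f = h \<and> g = k"
  using cp_in[of f g] cp_in[of h k] assms by metis

text \<open>Orients matrices towards rows of columns. In this normal form equality of arrows between
  direct sums is decided entry by entry with \<open>cp_eq_iff\<close> and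
  \<open>pr_eq_iff\<close>.\<close>

lemma pr_cp[simp]:
  assumes "a \<in> Ar C" "b \<in> Ar C" "c \<in> Ar C" "d \<in> Ar C"
    "Trg C b = Trg C a" "Trg C d = Trg C c" "Src C c = Src C a" "Src C d = Src C b"
  shows "pr (cp a b) (cp c d) = cp (pr a c) (pr b d)"
  using cp_eta[of "pr (cp a b) (cp c d)" "Src C a" "Src C b"] assms by (simp add: cp_in)

lemma pr_Zero[simp]: "A \<in> Ob C \<Longrightarrow> B \<in> Ob C \<Longrightarrow> D \<in> Ob C \<Longrightarrow> pr (Zero C A B) (Zero C A D) = Zero C A (B \<oplus>\<oplus> D)"
  by (simp add: pr_def)

lemma cp_Zero[simp]: "A \<in> Ob C \<Longrightarrow> B \<in> Ob C \<Longrightarrow> D \<in> Ob C \<Longrightarrow> cp (Zero C A D) (Zero C B D) = Zero C (A \<oplus>\<oplus> B) D"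
  by (simp add: cp_def)

lemma ng_pr[simp]: "f \<in> Ar C \<Longrightarrow> g \<in> Ar C \<Longrightarrow> Src C g = Src C f \<Longrightarrow> ng (pr f g) = pr (ng f) (ng g)"
  by (rule ng_unique[symmetric]) auto

lemma ng_cp[simp]: "f \<in> Ar C \<Longrightarrow> g \<in> Ar C \<Longrightarrow> Trg C g = Trg C f \<Longrightarrow> ng (cp f g) = cp (ng f) (ng g)"
  by (rule ng_unique[symmetric]) auto

lemma Ident_dsum: "A \<in> Ob C \<Longrightarrow> B \<in> Ob C \<Longrightarrow>
  Ident C (A \<oplus>\<oplus> B) = cp (pr (Ident C A) (Zero C A B)) (pr (Zero C B A) (Ident C B))"
  by (simp add: bip_eqs(5)[symmetric] cp_def pr_def)

end

section \<open>Exact categories\<close>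

context additive_category
begin

text \<open>\<open>cp_Zero\<close> contracts a zero row to a single \<open>Zero\<close>, after which
  \<open>pr_cp\<close> no longer matches; these variants still reach the normal form.\<close>

lemma pr_Zero_cp[simp]:
  assumes "f \<in> Ar C" "g \<in> Ar C" "Trg C g = Trg C f" "S = Src C f \<oplus>\<oplus> Src C g" "A \<in> Ob C"
  shows "pr (Zero C S A) (cp f g) = cp (pr (Zero C (Src C f) A) f) (pr (Zero C (Src C g) A) g)"
    "pr (cp f g) (Zero C S A) = cp (pr f (Zero C (Src C f) A)) (pr g (Zero C (Src C g) A))"
  using pr_cp[of "Zero C (Src C f) A" "Zero C (Src C g) A" f g]
    pr_cp[of f g "Zero C (Src C f) A" "Zero C (Src C g) A"] assms
  by (simp_all del: pr_cp)

lemma pr_eq_Zero[simp]: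
  assumes "f \<in> Ar C" "g \<in> Ar C" "Src C g = Src C f" "A = Src C f" "T = Trg C f \<oplus>\<oplus> Trg C g"
  shows "pr f g = Zero C A T \<longleftrightarrow> f = Zero C A (Trg C f) \<and> g = Zero C A (Trg C g)"
    "Zero C A T = pr f g \<longleftrightarrow> f = Zero C A (Trg C f) \<and> g = Zero C A (Trg C g)"
  using pr_eq_iff[of f g "Zero C A (Trg C f)" "Zero C A (Trg C g)"] assms by auto

lemma cp_eq_Zero[simp]:
  assumes "f \<in> Ar C" "g \<in> Ar C" "Trg C g = Trg C f" "A = Trg C f" "S = Src C f \<oplus>\<oplus> Src C g"
  shows "cp f g = Zero C S A \<longleftrightarrow> f = Zero C (Src C f) A \<and> g = Zero C (Src C g) A"
    "Zero C S A = cp f g \<longleftrightarrow> f = Zero C (Src C f) A \<and> g = Zero C (Src C g) A"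
  using cp_eq_iff[of f g "Zero C (Src C f) A" "Zero C (Src C g) A"] assms by auto

definition dg :: "'b \<Rightarrow> 'b \<Rightarrow> 'b" where
  "dg f g = cp (pr f (Zero C (Src C f) (Trg C g))) (pr (Zero C (Src C g) (Trg C f)) g)"

lemma dg_Ar[simp]:
  assumes "f \<in> Ar C" "g \<in> Ar C"
  shows "dg f g \<in> Ar C" "Src C (dg f g) = Src C f \<oplus>\<oplus> Src C g" "Trg C (dg f g) = Trg C f \<oplus>\<oplus> Trg C g"
  using assms by (auto simp: dg_def)

lemma dg_pr[simp]:
  assumes "f \<in> Ar C" "g \<in> Ar C" "h \<in> Ar C" "k \<in> Ar C" "Src C k = Src C h" "Src C f = Trg C h" "Src C g = Trg C k"
  shows "dg f g \<odot> pr h k = pr (f \<odot> h) (g \<odot> k)"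
  using assms by (simp add: dg_def)

lemma cp_dg[simp]:
  assumes "f \<in> Ar C" "g \<in> Ar C" "h \<in> Ar C" "k \<in> Ar C" "Trg C k = Trg C h" "Src C h = Trg C f" "Src C k = Trg C g"
  shows "cp h k \<odot> dg f g = cp (h \<odot> f) (k \<odot> g)"
  using assms by (simp add: dg_def)

lemma dg_dg[simp]:
  assumes "f \<in> Ar C" "g \<in> Ar C" "h \<in> Ar C" "k \<in> Ar C" "Src C f = Trg C h" "Src C g = Trg C k"
  shows "dg f g \<odot> dg h k = dg (f \<odot> h) (g \<odot> k)"
  using assms by (simp add: dg_def)

lemma dg_eq_iff[simp]:
  assumes "f \<in> Ar C" "g \<in> Ar C" "h \<in> Ar C" "k \<in> Ar C" "par h f" "par k g"
  shows "dg f g = dg h k \<longleftrightarrow> f = h \<and> g = k"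
  using assms by (auto simp: dg_def)

lemma dg_Zero[simp]: "A \<in> Ob C \<Longrightarrow> B \<in> Ob C \<Longrightarrow> D \<in> Ob C \<Longrightarrow> E \<in> Ob C \<Longrightarrow>
  dg (Zero C A B) (Zero C D E) = Zero C (A \<oplus>\<oplus> D) (B \<oplus>\<oplus> E)"
  by (simp add: dg_def)

lemma dg_Ident[simp]: "A \<in> Ob C \<Longrightarrow> B \<in> Ob C \<Longrightarrow> dg (Ident C A) (Ident C B) = Ident C (A \<oplus>\<oplus> B)"
  by (simp add: dg_def Ident_dsum)

lemma dsum_decomp:
  assumes "f \<in> Ar C" "Trg C f = A \<oplus>\<oplus> B" "A \<in> Ob C" "B \<in> Ob C"
  obtains g h where "g \<in> Ar C" "h \<in> Ar C" "Trg C g = A" "Trg C h = B" "Src C h = Src C g" "f = pr g h"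
proof (rule that)
  show "f = pr (pr1 A B \<odot> f) (pr2 A B \<odot> f)" by (rule pr_eta[OF assms, symmetric])
qed (use assms in simp_all)

lemma isomorphismI:
  assumes "f \<in> Ar C" "g \<in> Ar C" "Src C g = Trg C f" "Trg C g = Src C f"
    "g \<odot> f = Ident C (Src C f)" "f \<odot> g = Ident C (Trg C f)"
  shows "isomorphism C f"
  unfolding isomorphism_def using assms by (auto simp: Hom_def)

lemma isomorphismE:
  assumes "isomorphism C f"
  obtains g where "f \<in> Ar C" "g \<in> Ar C" "Src C g = Trg C f" "Trg C g = Src C f"
    "g \<odot> f = Ident C (Src C f)" "f \<odot> g = Ident C (Trg C f)"
  using assms unfolding isomorphism_def by (auto simp: Hom_def)

lemma isomorphism_Ident[simp]: "A \<in> Ob C \<Longrightarrow> isomorphism C (Ident C A)"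
  by (rule isomorphismI[of _ "Ident C A"]) auto

lemma isomorphism_Zero_Z0[simp]: "isomorphism C (Zero C Z0 Z0)"
  using isomorphism_Ident[of Z0] by simp

section \<open>Universal properties of kernels, cokernels, pullbacks and pushouts\<close>

definition is_kernel :: "'b \<Rightarrow> 'b \<Rightarrow> bool" where
  "is_kernel i p \<longleftrightarrow> i \<in> Ar C \<and> p \<in> Ar C \<and> Src C p = Trg C i \<and> p \<odot> i = Zero C (Src C i) (Trg C p) \<and>
     (\<forall>f. f \<in> Ar C \<longrightarrow> Trg C f = Src C p \<longrightarrow> p \<odot> f = Zero C (Src C f) (Trg C p) \<longrightarrow>
        (\<exists>g. g \<in> Hom C (Src C f) (Src C i) \<and> i \<odot> g = f)) \<and>
     (\<forall>g h. g \<in> Ar C \<longrightarrow> h \<in> Ar C \<longrightarrow> par g h \<longrightarrow> Trg C g = Src C i \<longrightarrow> i \<odot> g = i \<odot> h \<longrightarrow> g = h)"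

definition is_cokernel :: "'b \<Rightarrow> 'b \<Rightarrow> bool" where
  "is_cokernel i p \<longleftrightarrow> i \<in> Ar C \<and> p \<in> Ar C \<and> Src C p = Trg C i \<and> p \<odot> i = Zero C (Src C i) (Trg C p) \<and>
     (\<forall>f. f \<in> Ar C \<longrightarrow> Src C f = Trg C i \<longrightarrow> f \<odot> i = Zero C (Src C i) (Trg C f) \<longrightarrow>
        (\<exists>g. g \<in> Hom C (Trg C p) (Trg C f) \<and> g \<odot> p = f)) \<and>
     (\<forall>g h. g \<in> Ar C \<longrightarrow> h \<in> Ar C \<longrightarrow> par g h \<longrightarrow> Src C g = Trg C p \<longrightarrow> g \<odot> p = h \<odot> p \<longrightarrow> g = h)"

lemma kernel_cokernel_pair_kernel:
  assumes "kernel_cokernel_pair C i p"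
  shows "is_kernel i p"
proof -
  have u: "\<And>X f. X \<in> Ob C \<Longrightarrow> f \<in> Hom C X (Src C p) \<Longrightarrow> p \<odot> f = Zero C X (Trg C p) \<Longrightarrow>
      \<exists>!g. g \<in> Hom C X (Src C i) \<and> i \<odot> g = f"
    and t: "i \<in> Ar C" "p \<in> Ar C" "Src C p = Trg C i" "p \<odot> i = Zero C (Src C i) (Trg C p)"
    using assms unfolding kernel_cokernel_pair_def by auto
  have "g = h" if "g \<in> Ar C" "h \<in> Ar C" "par g h" "Trg C g = Src C i" "i \<odot> g = i \<odot> h" for g h
    using u[of "Src C g" "i \<odot> g"] that t Comp_red[of g i p] by (auto simp: Hom_def)
  then show ?thesis unfolding is_kernel_def using t u
    by (auto simp: Hom_def) metis+
qed

lemma kernel_cokernel_pair_cokernel: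
  assumes "kernel_cokernel_pair C i p"
  shows "is_cokernel i p"
proof -
  have u: "\<And>X f. X \<in> Ob C \<Longrightarrow> f \<in> Hom C (Trg C i) X \<Longrightarrow> f \<odot> i = Zero C (Src C i) X \<Longrightarrow>
      \<exists>!g. g \<in> Hom C (Trg C p) X \<and> g \<odot> p = f"
    and t: "i \<in> Ar C" "p \<in> Ar C" "Src C p = Trg C i" "p \<odot> i = Zero C (Src C i) (Trg C p)"
    using assms unfolding kernel_cokernel_pair_def by auto
  have "g = h" if "g \<in> Ar C" "h \<in> Ar C" "par g h" "Src C g = Trg C p" "g \<odot> p = h \<odot> p" for g h
    using u[of "Trg C g" "g \<odot> p"] that t by (auto simp: Hom_def)
  then show ?thesis unfolding is_cokernel_def using t u
    by (auto simp: Hom_def) metis+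
qed

lemma is_kernel_factor:
  assumes "is_kernel i p" "f \<in> Ar C" "Trg C f = Trg C i" "p \<odot> f = Zero C (Src C f) (Trg C p)"
  obtains g where "g \<in> Ar C" "Src C g = Src C f" "Trg C g = Src C i" "i \<odot> g = f"
proof -
  have "Trg C f = Src C p" using assms unfolding is_kernel_def by simp
  then obtain g where "g \<in> Hom C (Src C f) (Src C i)" "i \<odot> g = f"
    using assms unfolding is_kernel_def by blast
  then show ?thesis by (intro that) (simp_all add: Hom_def)
qed

lemma is_kernel_mono:
  assumes "is_kernel i p" "i \<odot> g = i \<odot> h" "g \<in> Ar C" "h \<in> Ar C" "Src C g = Src C h"
    "Trg C g = Src C i" "Trg C h = Src C i"
  shows "g = h"
  using assms unfolding is_kernel_def by auto

lemma is_cokernel_factor: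
  assumes "is_cokernel i p" "f \<in> Ar C" "Src C f = Trg C i" "f \<odot> i = Zero C (Src C i) (Trg C f)"
  obtains g where "g \<in> Ar C" "Src C g = Trg C p" "Trg C g = Trg C f" "g \<odot> p = f"
proof -
  obtain g where "g \<in> Hom C (Trg C p) (Trg C f)" "g \<odot> p = f"
    using assms unfolding is_cokernel_def by blast
  then show ?thesis by (intro that) (simp_all add: Hom_def)
qed

lemma is_cokernel_epi:
  assumes "is_cokernel i p" "g \<odot> p = h \<odot> p" "g \<in> Ar C" "h \<in> Ar C" "Trg C g = Trg C h"
    "Src C g = Trg C p" "Src C h = Trg C p"
  shows "g = h"
  using assms unfolding is_cokernel_def by auto

lemma pullback_factor:
  assumes "pullback C p f p' f'" "u \<in> Ar C" "v \<in> Ar C" "Src C v = Src C u" "Trg C u = Src C p"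
    "Trg C v = Src C f" "p \<odot> u = f \<odot> v"
  obtains w where "w \<in> Ar C" "Src C w = Src C u" "Trg C w = Src C p'" "f' \<odot> w = u" "p' \<odot> w = v"
proof -
  have "\<exists>!w. w \<in> Hom C (Src C u) (Src C p') \<and> f' \<odot> w = u \<and> p' \<odot> w = v"
    using assms unfolding pullback_def by (auto simp: Hom_def)
  then show ?thesis using that by (auto simp: Hom_def)
qed

lemma pullbackD:
  assumes "pullback C p f p' f'"
  shows "p \<in> Ar C" "f \<in> Ar C" "p' \<in> Ar C" "f' \<in> Ar C" "Trg C f = Trg C p" "Trg C p' = Src C f"
    "Trg C f' = Src C p" "Src C f' = Src C p'" "p \<odot> f' = f \<odot> p'"
  using assms unfolding pullback_def by auto

lemma pullback_unique:
  assumes "pullback C p f p' f'" "w \<in> Ar C" "w' \<in> Ar C" "Src C w = Src C w'" "Trg C w = Src C p'"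
    "Trg C w' = Src C p'" "f' \<odot> w = f' \<odot> w'" "p' \<odot> w = p' \<odot> w'"
  shows "w = w'"
proof -
  note t = pullbackD[OF assms(1)]
  have "p \<odot> (f' \<odot> w) = f \<odot> (p' \<odot> w)"
    using t assms Comp_red[of w f' p "f \<odot> p'"] by simp
  then have "\<exists>!x. x \<in> Hom C (Src C w) (Src C p') \<and> f' \<odot> x = f' \<odot> w \<and> p' \<odot> x = p' \<odot> w"
    using assms t unfolding pullback_def by (auto simp: Hom_def)
  then show ?thesis using assms by (auto simp: Hom_def)
qed

lemma pullbackI:
  assumes "p \<in> Ar C" "f \<in> Ar C" "p' \<in> Ar C" "f' \<in> Ar C" "Trg C f = Trg C p" "Trg C p' = Src C f"
    "Trg C f' = Src C p" "Src C f' = Src C p'" "p \<odot> f' = f \<odot> p'"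
    "\<And>u v. u \<in> Ar C \<Longrightarrow> v \<in> Ar C \<Longrightarrow> Src C v = Src C u \<Longrightarrow> Trg C u = Src C p \<Longrightarrow> Trg C v = Src C f
      \<Longrightarrow> p \<odot> u = f \<odot> v \<Longrightarrow> \<exists>w. w \<in> Ar C \<and> Src C w = Src C u \<and> Trg C w = Src C p' \<and> f' \<odot> w = u \<and> p' \<odot> w = v"
    "\<And>w w'. w \<in> Ar C \<Longrightarrow> w' \<in> Ar C \<Longrightarrow> Src C w = Src C w' \<Longrightarrow> Trg C w = Src C p' \<Longrightarrow>
      Trg C w' = Src C p' \<Longrightarrow> f' \<odot> w = f' \<odot> w' \<Longrightarrow> p' \<odot> w = p' \<odot> w' \<Longrightarrow> w = w'"
  shows "pullback C p f p' f'"
  unfolding pullback_def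
proof (intro conjI ballI impI)
  fix X u v assume a: "X \<in> Ob C" "u \<in> Hom C X (Src C p)" "v \<in> Hom C X (Src C f)" "p \<odot> u = f \<odot> v"
  then obtain w where "w \<in> Ar C" "Src C w = X" "Trg C w = Src C p'" "f' \<odot> w = u" "p' \<odot> w = v"
    using assms(10)[of u v] by (auto simp: Hom_def)
  then show "\<exists>!w. w \<in> Hom C X (Src C p') \<and> f' \<odot> w = u \<and> p' \<odot> w = v"
    by (intro ex1I[of _ w]) (auto simp: Hom_def intro: assms(11))
qed (use assms in auto)

lemma pullback_sym:
  assumes "pullback C p f p' f'"
  shows "pullback C f p f' p'"
proof -
  note t = pullbackD[OF assms]
  show ?thesis
  proof (rule pullbackI)
    fix u v assume "u \<in> Ar C" "v \<in> Ar C" "Src C v = Src C u" "Trg C u = Src C f" "Trg C v = Src C p"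
      "f \<odot> u = p \<odot> v"
    then obtain w where "w \<in> Ar C" "Src C w = Src C v" "Trg C w = Src C p'" "f' \<odot> w = v" "p' \<odot> w = u"
      using pullback_factor[OF assms, of v u] by metis
    then show "\<exists>w. w \<in> Ar C \<and> Src C w = Src C u \<and> Trg C w = Src C f' \<and> p' \<odot> w = u \<and> f' \<odot> w = v"
      using t \<open>Src C v = Src C u\<close> by metis
  next
    fix w w' assume "w \<in> Ar C" "w' \<in> Ar C" "Src C w = Src C w'" "Trg C w = Src C f'"
      "Trg C w' = Src C f'" "p' \<odot> w = p' \<odot> w'" "f' \<odot> w = f' \<odot> w'"
    then show "w = w'" using pullback_unique[OF assms, of w w'] t by metis
  qed (use t in auto)
qed

lemma pushout_factor:
  assumes "pushout C i f i' f'" "u \<in> Ar C" "v \<in> Ar C" "Trg C v = Trg C u" "Src C u = Trg C i"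
    "Src C v = Trg C f" "u \<odot> i = v \<odot> f"
  obtains w where "w \<in> Ar C" "Src C w = Trg C i'" "Trg C w = Trg C u" "w \<odot> f' = u" "w \<odot> i' = v"
proof -
  have "\<exists>!w. w \<in> Hom C (Trg C i') (Trg C u) \<and> w \<odot> f' = u \<and> w \<odot> i' = v"
    using assms unfolding pushout_def by (auto simp: Hom_def)
  then show ?thesis using that by (auto simp: Hom_def)
qed

lemma pushoutD:
  assumes "pushout C i f i' f'"
  shows "i \<in> Ar C" "f \<in> Ar C" "i' \<in> Ar C" "f' \<in> Ar C" "Src C f = Src C i" "Src C i' = Trg C f"
    "Src C f' = Trg C i" "Trg C f' = Trg C i'" "f' \<odot> i = i' \<odot> f"
  using assms unfolding pushout_def by auto

lemma pushout_unique:
  assumes "pushout C i f i' f'" "w \<in> Ar C" "w' \<in> Ar C" "Trg C w = Trg C w'" "Src C w = Trg C i'"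
    "Src C w' = Trg C i'" "w \<odot> f' = w' \<odot> f'" "w \<odot> i' = w' \<odot> i'"
  shows "w = w'"
proof -
  note t = pushoutD[OF assms(1)]
  have "(w \<odot> f') \<odot> i = (w \<odot> i') \<odot> f"
    using t assms(2-6) by simp
  then have "\<exists>!x. x \<in> Hom C (Trg C i') (Trg C w) \<and> x \<odot> f' = w \<odot> f' \<and> x \<odot> i' = w \<odot> i'"
    using assms t unfolding pushout_def by (auto simp: Hom_def)
  then show ?thesis using assms by (auto simp: Hom_def)
qed

end

section \<open>Consequences of Quillen's axioms: stability, short five lemma, sums of
  conflations\<close>

context exact_category
begin

lemma SesD:
  assumes "(i, p) \<in> Ses C"
  shows "i \<in> Ar C" "p \<in> Ar C" "Src C p = Trg C i" "p \<odot> i = Zero C (Src C i) (Trg C p)"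
  using Ses_kernel_cokernel[OF assms] unfolding kernel_cokernel_pair_def by auto

lemma Ses_kernel: "(i, p) \<in> Ses C \<Longrightarrow> is_kernel i p"
  using Ses_kernel_cokernel kernel_cokernel_pair_kernel by blast

lemma Ses_cokernel: "(i, p) \<in> Ses C \<Longrightarrow> is_cokernel i p"
  using Ses_kernel_cokernel kernel_cokernel_pair_cokernel by blast

lemmas Ses_kernel_factor = is_kernel_factor[OF Ses_kernel]
lemmas Ses_mono = is_kernel_mono[OF Ses_kernel]
lemmas Ses_cokernel_factor = is_cokernel_factor[OF Ses_cokernel]
lemmas Ses_epi = is_cokernel_epi[OF Ses_cokernel]

lemma admissible_epiI: "(i, p) \<in> Ses C \<Longrightarrow> admissible_epi C p"
  and admissible_monoI: "(i, p) \<in> Ses C \<Longrightarrow> admissible_mono C i"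
  unfolding admissible_epi_def admissible_mono_def by blast+

text \<open>Kernels of \<open>p\<close> are unique up to isomorphism and \<open>Ses\<close> is
  closed under isomorphism. Conflations can thus be produced from an admissible epi and a verified
  universal property.\<close>

lemma kernel_Ses:
  assumes "admissible_epi C p" "is_kernel i p"
  shows "(i, p) \<in> Ses C"
proof -
  obtain j where j: "(j, p) \<in> Ses C" using assms(1) unfolding admissible_epi_def by blast
  note kj = Ses_kernel[OF j] and tj = SesD[OF j]
  have ti: "i \<in> Ar C" "Src C p = Trg C i" "p \<odot> i = Zero C (Src C i) (Trg C p)"
    using assms(2) unfolding is_kernel_def by auto
  obtain a where a: "a \<in> Ar C" "Src C a = Src C j" "Trg C a = Src C i" "i \<odot> a = j"
    using is_kernel_factor[OF assms(2), of j] tj ti by auto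
  obtain b where b: "b \<in> Ar C" "Src C b = Src C i" "Trg C b = Src C j" "j \<odot> b = i"
    using is_kernel_factor[OF kj, of i] tj ti by auto
  have "b \<odot> a = Ident C (Src C j)"
    by (rule is_kernel_mono[OF kj]) (use a b tj ti Comp_red[of a b j i] in auto)
  moreover have "a \<odot> b = Ident C (Src C i)"
    by (rule is_kernel_mono[OF assms(2)]) (use a b tj ti Comp_red[of b a i j] in auto)
  ultimately have "isomorphism C a" by (intro isomorphismI[of a b]) (use a b in auto)
  then show ?thesis
    by (rule Ses_closed_iso[OF j, of a "Ident C (Trg C i)" "Ident C (Trg C p)"])
      (use a tj ti in \<open>auto simp: Hom_def\<close>)
qed

lemma cokernel_Ses:
  assumes "admissible_mono C i" "is_cokernel i p"
  shows "(i, p) \<in> Ses C"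
proof -
  obtain q where q: "(i, q) \<in> Ses C" using assms(1) unfolding admissible_mono_def by blast
  note kq = Ses_cokernel[OF q] and tq = SesD[OF q]
  have tp: "p \<in> Ar C" "Src C p = Trg C i" "p \<odot> i = Zero C (Src C i) (Trg C p)"
    using assms(2) unfolding is_cokernel_def by auto
  obtain a where a: "a \<in> Ar C" "Src C a = Trg C q" "Trg C a = Trg C p" "a \<odot> q = p"
    using is_cokernel_factor[OF kq, of p] tq tp by auto
  obtain b where b: "b \<in> Ar C" "Src C b = Trg C p" "Trg C b = Trg C q" "b \<odot> p = q"
    using is_cokernel_factor[OF assms(2), of q] tq tp by auto
  have "b \<odot> a = Ident C (Trg C q)"
    by (rule is_cokernel_epi[OF kq]) (use a b tq tp in auto)
  moreover have "a \<odot> b = Ident C (Trg C p)"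
    by (rule is_cokernel_epi[OF assms(2)]) (use a b tq tp in auto)
  ultimately have "isomorphism C a" by (intro isomorphismI[of a b]) (use a b in auto)
  then show ?thesis
    by (intro Ses_closed_iso[OF q, of "Ident C (Src C i)" "Ident C (Trg C i)" a])
      (use a tq tp in \<open>auto simp: Hom_def\<close>)
qed

text \<open>An identity has the chosen zero object as kernel; the resulting conflation is
  transported along \<open>f\<close>.\<close>

lemma Ses_iso_epi:
  assumes "isomorphism C f"
  shows "(Zero C Z0 (Src C f), f) \<in> Ses C"
proof -
  obtain g where f: "f \<in> Ar C" using isomorphismE[OF assms] by metis
  have "is_kernel (Zero C Z0 (Src C f)) (Ident C (Src C f))"
    unfolding is_kernel_def
  proof (intro conjI allI impI)
    fix h assume "h \<in> Ar C" "Trg C h = Src C (Ident C (Src C f))"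
      "Ident C (Src C f) \<odot> h = Zero C (Src C h) (Trg C (Ident C (Src C f)))"
    then show "\<exists>g. g \<in> Hom C (Src C h) (Src C (Zero C Z0 (Src C f))) \<and> Zero C Z0 (Src C f) \<odot> g = h"
      by (intro exI[of _ "Zero C (Src C h) Z0"]) (use f in \<open>auto simp: Hom_def\<close>)
  next
    fix g h assume "g \<in> Ar C" "h \<in> Ar C" "Src C g = Src C h \<and> Trg C g = Trg C h"
      "Trg C g = Src C (Zero C Z0 (Src C f))"
    then have "g \<in> Ar C" "h \<in> Ar C" "Src C g = Src C h" "Trg C g = Z0" "Trg C h = Z0"
      using f by auto
    then show "g = h" using to_zero_eq[OF zero_object_Z0] by metis
  qed (use f in auto)
  then have "(Zero C Z0 (Src C f), Ident C (Src C f)) \<in> Ses C"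
    using kernel_Ses Ident_admissible_epi f by simp
  then show ?thesis
    by (rule Ses_closed_iso[of _ _ "Ident C Z0" "Ident C (Src C f)" f])
      (use f assms in \<open>auto simp: Hom_def\<close>)
qed

lemma Ses_iso_mono:
  assumes "isomorphism C f"
  shows "(f, Zero C (Trg C f) Z0) \<in> Ses C"
proof -
  obtain g where f: "f \<in> Ar C" using isomorphismE[OF assms] by metis
  have "is_cokernel (Ident C (Src C f)) (Zero C (Src C f) Z0)"
    unfolding is_cokernel_def
  proof (intro conjI allI impI)
    fix h assume "h \<in> Ar C" "Src C h = Trg C (Ident C (Src C f))"
      "h \<odot> Ident C (Src C f) = Zero C (Src C (Ident C (Src C f))) (Trg C h)"
    then show "\<exists>g. g \<in> Hom C (Trg C (Zero C (Src C f) Z0)) (Trg C h) \<and> g \<odot> Zero C (Src C f) Z0 = h"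
      by (intro exI[of _ "Zero C Z0 (Trg C h)"]) (use f in \<open>auto simp: Hom_def\<close>)
  next
    fix g h assume "g \<in> Ar C" "h \<in> Ar C" "Src C g = Src C h \<and> Trg C g = Trg C h"
      "Src C g = Trg C (Zero C (Src C f) Z0)"
    then have "g \<in> Ar C" "h \<in> Ar C" "Trg C g = Trg C h" "Src C g = Z0" "Src C h = Z0"
      using f by auto
    then show "g = h" using from_zero_eq[OF zero_object_Z0] by metis
  qed (use f in auto)
  then have "(Ident C (Src C f), Zero C (Src C f) Z0) \<in> Ses C"
    using cokernel_Ses Ident_admissible_mono f by simp
  then show ?thesis
    by (rule Ses_closed_iso[of _ _ "Ident C (Src C f)" f "Ident C Z0"])
      (use f assms in \<open>auto simp: Hom_def\<close>)
qed

text \<open>The axiom provides one pullback with an admissible epi. Any other differs from it by an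
  isomorphism, and isomorphisms are admissible epis.\<close>

lemma pullback_epi:
  assumes "pullback C p f p' f'" "admissible_epi C p"
  shows "admissible_epi C p'"
proof -
  note t = pullbackD[OF assms(1)]
  obtain q g where q: "pullback C p f q g" "admissible_epi C q"
    using pullback_admissible_epi[OF assms(2), of f] t by auto
  note s = pullbackD[OF q(1)]
  obtain w where w: "w \<in> Ar C" "Src C w = Src C p'" "Trg C w = Src C q" "g \<odot> w = f'" "q \<odot> w = p'"
    by (rule pullback_factor[OF q(1), of f' p']) (use t in auto)
  obtain v where v: "v \<in> Ar C" "Src C v = Src C q" "Trg C v = Src C p'" "f' \<odot> v = g" "p' \<odot> v = q"
    by (rule pullback_factor[OF assms(1), of g q]) (use s in auto)
  have "w \<odot> v = Ident C (Src C q)"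
    by (rule pullback_unique[OF q(1)])
      (use v w s t Comp_red[of v w g f'] Comp_red[of v w q p'] in auto)
  moreover have "v \<odot> w = Ident C (Src C p')"
    by (rule pullback_unique[OF assms(1)])
      (use v w s t Comp_red[of w v f' g] Comp_red[of w v p' q] in auto)
  ultimately have "isomorphism C w" by (intro isomorphismI[of w v]) (use v w in auto)
  then have "admissible_epi C w" using Ses_iso_epi admissible_epiI by blast
  then have "admissible_epi C (q \<odot> w)" using Comp_admissible_epi q(2) w by auto
  then show ?thesis using w by simp
qed

text \<open>The inverse is built on the fibre product \<open>V\<close> of the two middle terms. For
  a pair \<open>(a, b)\<close> in \<open>V\<close>, the elements \<open>b\<close> and
  \<open>w a\<close> agree in the quotient, so \<open>b - w a\<close> comes from the common kernel;
  adding this correction to \<open>a\<close> gives the preimage of \<open>b\<close>.\<close>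

lemma five_lemma:
  assumes s: "(i, p) \<in> Ses C" and s': "(i', p') \<in> Ses C"
    and w: "w \<in> Ar C" "Src C w = Trg C i" "Trg C w = Trg C i'" "w \<odot> i = i'" "p' \<odot> w = p"
  shows "isomorphism C w"
proof -
  note t = SesD[OF s] SesD[OF s']
  have t2: "Src C i' = Src C i" "Trg C p' = Trg C p" "Src C p' = Trg C w" "Src C p = Trg C i"
    using t w Comp_Ar(2)[of i w] Comp_Ar(3)[of w p'] by auto
  obtain q r where pb: "pullback C p p' q r" and q: "admissible_epi C q"
    using pullback_admissible_epi[of p p'] admissible_epiI[OF s] t t2 by auto
  note u = pullbackD[OF pb]
  define W where "W = Trg C i"
  define A where "A = Src C i"
  define V where "V = Src C q"
  have tr: "Trg C r = W" "Src C r = V" "Trg C q = Trg C w" "Src C q = V"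
    using u t t2 by (auto simp: W_def V_def)
  obtain e where e: "e \<in> Ar C" "Src C e = W" "Trg C e = V" "r \<odot> e = Ident C W" "q \<odot> e = w"
    by (rule pullback_factor[OF pb, of "Ident C W" w]) (use t w t2 in \<open>auto simp: W_def V_def\<close>)
  obtain k where k: "k \<in> Ar C" "Src C k = A" "Trg C k = V" "r \<odot> k = Zero C A W" "q \<odot> k = i'"
    by (rule pullback_factor[OF pb, of "Zero C A W" i']) (use t w t2 in \<open>auto simp: W_def A_def V_def\<close>)
  obtain \<alpha> where \<alpha>: "\<alpha> \<in> Ar C" "Src C \<alpha> = A" "Trg C \<alpha> = V" "r \<odot> \<alpha> = i" "q \<odot> \<alpha> = Zero C A (Trg C w)"
    by (rule pullback_factor[OF pb, of i "Zero C A (Trg C w)"]) (use t w t2 in \<open>auto simp: W_def A_def V_def\<close>)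
  have VO: "V \<in> Ob C" "W \<in> Ob C" "A \<in> Ob C" using t u by (auto simp: V_def W_def A_def)
  define d where "d = q \<boxplus> ng (w \<odot> r)"
  have d: "d \<in> Ar C" "Src C d = V" "Trg C d = Trg C w"
    using u w tr by (auto simp: d_def W_def)
  have "p' \<odot> (w \<odot> r) = p' \<odot> q"
    using Comp_red[of r w p' p] u w t t2 tr by (simp add: W_def)
  then have "p' \<odot> d = Zero C V (Trg C p')"
    using u w tr t t2 by (simp add: d_def W_def)
  then obtain \<rho> where \<rho>: "\<rho> \<in> Ar C" "Src C \<rho> = V" "Trg C \<rho> = A" "i' \<odot> \<rho> = d"
    using Ses_kernel_factor[OF s', of d] d t2 w A_def by metis
  have krho: "k \<odot> \<rho> = Ident C V \<boxplus> ng (e \<odot> r)"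
  proof (rule pullback_unique[OF pb])
    show "r \<odot> (k \<odot> \<rho>) = r \<odot> (Ident C V \<boxplus> ng (e \<odot> r))"
      using Comp_red[of \<rho> k r "Zero C A W"] Comp_red[of r e r "Ident C W"] k e \<rho> tr u VO by simp
    show "q \<odot> (k \<odot> \<rho>) = q \<odot> (Ident C V \<boxplus> ng (e \<odot> r))"
      using Comp_red[of \<rho> k q i'] Comp_red[of r e q w] k e \<rho> tr u VO by (simp add: d_def)
  qed (use k e \<rho> tr u VO in auto)
  have ra: "\<rho> \<odot> \<alpha> = ng (Ident C A)"
  proof (rule Ses_mono[OF s'])
    have "i' \<odot> (\<rho> \<odot> \<alpha>) = d \<odot> \<alpha>"
      by (rule Comp_red) (use \<rho> \<alpha> t t2 in \<open>auto simp: A_def\<close>)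
    also have "\<dots> = ng i'" using \<alpha> u w tr t t2 by (simp add: d_def W_def A_def)
    also have "\<dots> = i' \<odot> ng (Ident C A)" using VO t t2 by (simp add: A_def)
    finally show "i' \<odot> (\<rho> \<odot> \<alpha>) = i' \<odot> ng (Ident C A)" .
  qed (use \<rho> \<alpha> VO t2 in \<open>auto simp: A_def\<close>)
  have "is_kernel \<alpha> q"
    unfolding is_kernel_def
  proof (intro conjI allI impI)
    fix f assume f: "f \<in> Ar C" "Trg C f = Src C q" "q \<odot> f = Zero C (Src C f) (Trg C q)"
    have "p \<odot> (r \<odot> f) = p' \<odot> (q \<odot> f)"
      using Comp_red[of f r p "p' \<odot> q"] f u t tr t2 by simp
    then have "p \<odot> (r \<odot> f) = Zero C (Src C f) (Trg C p)"
      using f t t2 tr u by simp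
    then obtain g where g: "g \<in> Ar C" "Src C g = Src C f" "Trg C g = A" "i \<odot> g = r \<odot> f"
      using Ses_kernel_factor[OF s, of "r \<odot> f"] f u tr t t2 unfolding W_def A_def
      by (metis Comp_Ar)
    have "\<alpha> \<odot> g = f"
      by (rule pullback_unique[OF pb])
        (use Comp_red[of g \<alpha> r i] Comp_red[of g \<alpha> q "Zero C A (Trg C w)"] g \<alpha> u tr f in auto)
    then show "\<exists>g. g \<in> Hom C (Src C f) (Src C \<alpha>) \<and> \<alpha> \<odot> g = f" using g \<alpha> by (auto simp: Hom_def)
  next
    fix g h assume g: "g \<in> Ar C" "h \<in> Ar C" "par g h" "Trg C g = Src C \<alpha>" "\<alpha> \<odot> g = \<alpha> \<odot> h"
    have "i \<odot> g = r \<odot> (\<alpha> \<odot> g)" "i \<odot> h = r \<odot> (\<alpha> \<odot> h)"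
      using Comp_red[of g \<alpha> r i] Comp_red[of h \<alpha> r i] g \<alpha> u tr by auto
    then have "i \<odot> g = i \<odot> h" using g by simp
    then show "g = h" by (rule Ses_mono[OF s]) (use g \<alpha> in \<open>auto simp: A_def\<close>)
  qed (use \<alpha> u tr in auto)
  then have sq: "(\<alpha>, q) \<in> Ses C" using kernel_Ses q by blast
  \<comment> \<open>The corrected first coordinate. It vanishes on the kernel \<alpha> of
    \<open>q\<close>, because \<rho> is minus the identity there, and so it descends to the inverse
    \<open>x\<close>.\<close>
  define h where "h = r \<boxplus> i \<odot> \<rho>"
  have h: "h \<in> Ar C" "Src C h = V" "Trg C h = W"
    using u \<rho> tr t by (auto simp: h_def W_def A_def)
  have "h \<odot> \<alpha> = Zero C A W"
    using ra u \<rho> tr t \<alpha> VO by (simp add: h_def W_def A_def)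
  then obtain x where x: "x \<in> Ar C" "Src C x = Trg C w" "Trg C x = W" "x \<odot> q = h"
    using Ses_cokernel_factor[OF sq, of h] h \<alpha> tr by metis
  \<comment> \<open>On the graph \<open>e\<close> of \<open>w\<close> the two coordinates already
    match, so the correction \<rho> must vanish there.\<close>
  have "k \<odot> (\<rho> \<odot> e) = Zero C W V"
    using Comp_red[of e \<rho> k "Ident C V \<boxplus> ng (e \<odot> r)"] krho e \<rho> k u tr VO by simp
  then have "q \<odot> (k \<odot> (\<rho> \<odot> e)) = Zero C W (Trg C w)" using u tr VO by simp
  then have "i' \<odot> (\<rho> \<odot> e) = Zero C W (Trg C w)"
    using Comp_red[of "\<rho> \<odot> e" k q i'] \<rho> e k u tr by simp
  also have "\<dots> = i' \<odot> Zero C W A" using t t2 VO w by (simp add: A_def)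
  finally have re: "\<rho> \<odot> e = Zero C W A"
    by (rule Ses_mono[OF s']) (use \<rho> e VO t2 in \<open>auto simp: A_def\<close>)
  have xw: "x \<odot> w = Ident C W"
  proof -
    have "x \<odot> w = h \<odot> e"
      using Comp_red[of e q x h] x e u tr by simp
    also have "\<dots> = Ident C W"
      using re u \<rho> tr t e VO by (simp add: h_def W_def A_def)
    finally show ?thesis .
  qed
  have "w \<odot> x = Ident C (Trg C w)"
  proof (rule Ses_epi[OF sq])
    have "(w \<odot> x) \<odot> q = w \<odot> h" using x w u tr by (simp add: W_def)
    also have "\<dots> = w \<odot> r \<boxplus> i' \<odot> \<rho>"
      using Comp_red[of \<rho> i w i'] u \<rho> tr t w by (simp add: h_def W_def A_def)
    also have "\<dots> = q" using u w tr \<rho>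
      by (simp add: d_def W_def Plus_comm[of "w \<odot> r" "q \<boxplus> ng (w \<odot> r)"] Plus_assoc)
    finally show "(w \<odot> x) \<odot> q = Ident C (Trg C w) \<odot> q" using u tr w by simp
  qed (use x w u tr in \<open>auto simp: W_def\<close>)
  then show ?thesis
    using xw by (intro isomorphismI[of w x]) (use x w in \<open>auto simp: W_def\<close>)
qed

text \<open>Arrows out of the pushout that kill \<open>i'\<close> correspond to arrows out of the
  target of \<open>i\<close> that kill \<open>i\<close>, so both have the same cokernel
  object.\<close>

lemma cokernel_of_pushout:
  assumes po: "pushout C i a i' f" and m: "admissible_mono C i'"
    and s: "(i, p) \<in> Ses C"
  obtains p' where "(i', p') \<in> Ses C" "Src C p' = Trg C f" "Trg C p' = Trg C p" "p' \<odot> f = p"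
proof -
  note u = pushoutD[OF po] note t = SesD[OF s]
  obtain p' where p': "p' \<in> Ar C" "Src C p' = Trg C i'" "Trg C p' = Trg C p" "p' \<odot> f = p"
      "p' \<odot> i' = Zero C (Trg C a) (Trg C p)"
    by (rule pushout_factor[OF po, of p "Zero C (Trg C a) (Trg C p)"]) (use t u in auto)
  have "is_cokernel i' p'"
    unfolding is_cokernel_def
  proof (intro conjI allI impI)
    fix h assume h: "h \<in> Ar C" "Src C h = Trg C i'" "h \<odot> i' = Zero C (Src C i') (Trg C h)"
    have "(h \<odot> f) \<odot> i = (h \<odot> i') \<odot> a" using h(1,2) u by simp
    then have "(h \<odot> f) \<odot> i = Zero C (Src C i) (Trg C h)" using h u by simp
    then obtain g where g: "g \<in> Ar C" "Src C g = Trg C p" "Trg C g = Trg C h" "g \<odot> p = h \<odot> f"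
      using Ses_cokernel_factor[OF s, of "h \<odot> f"] h u t by (metis Comp_Ar)
    have "g \<odot> p' = h"
      by (rule pushout_unique[OF po]) (use g h p' u t in auto)
    then show "\<exists>g. g \<in> Hom C (Trg C p') (Trg C h) \<and> g \<odot> p' = h" using g p' by (auto simp: Hom_def)
  next
    fix g h assume g: "g \<in> Ar C" "h \<in> Ar C" "par g h" "Src C g = Trg C p'" "g \<odot> p' = h \<odot> p'"
    have "(g \<odot> p') \<odot> f = (h \<odot> p') \<odot> f" using g by simp
    then have "g \<odot> p = h \<odot> p" using g(1-4) p' u by simp
    then show "g = h" by (rule Ses_epi[OF s]) (use g p' in auto)
  qed (use p' u in auto)
  then have "(i', p') \<in> Ses C" using cokernel_Ses m by blast
  then show ?thesis using that p' u by auto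
qed

text \<open>By \<open>five_lemma\<close> the second sequence is, up to isomorphism, the pushout of
  the first along \<open>a\<close>. Pushing out the cokernel \<open>a\<close> of \<open>k\<close>
  gives the cokernel of \<open>i \<odot> k\<close>, which is an admissible mono as a
  composite.\<close>

lemma pushout_of_epi:
  assumes s: "(i, p) \<in> Ses C" and s': "(i', p') \<in> Ses C"
    and g: "g \<in> Ar C" "Src C g = Trg C i" "Trg C g = Trg C i'"
    and a: "Src C a = Src C i" "Trg C a = Src C i'" "g \<odot> i = i' \<odot> a" "p' \<odot> g = p"
    and k: "(k, a) \<in> Ses C"
  shows "(i \<odot> k, g) \<in> Ses C"
proof -
  note t = SesD[OF s] SesD[OF s'] SesD[OF k]
  obtain j f where po: "pushout C i a j f" and j: "admissible_mono C j"
    using pushout_admissible_mono[of i a] admissible_monoI[OF s] t a by auto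
  note u = pushoutD[OF po]
  obtain q where q: "(j, q) \<in> Ses C" "Src C q = Trg C f" "Trg C q = Trg C p" "q \<odot> f = p"
    by (rule cokernel_of_pushout[OF po j s])
  note tq = SesD[OF q(1)]
  obtain w where w: "w \<in> Ar C" "Src C w = Trg C j" "Trg C w = Trg C g" "w \<odot> f = g" "w \<odot> j = i'"
    by (rule pushout_factor[OF po, of g i']) (use t g a u in auto)
  have pp: "Trg C p' = Trg C p" using a(4) g t(5,6) Comp_Ar(3)[of g p'] t by auto
  have "p' \<odot> w = q"
  proof (rule pushout_unique[OF po])
    show "(p' \<odot> w) \<odot> f = q \<odot> f" using w q a u t g by simp
    show "(p' \<odot> w) \<odot> j = q \<odot> j" using w a u t g tq pp q by simp
  qed (use w u t g tq pp q in auto)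
  then have iw: "isomorphism C w"
    by (intro five_lemma[OF q(1) s']) (use w g in auto)
  have "is_cokernel (i \<odot> k) f"
    unfolding is_cokernel_def
  proof (intro conjI allI impI)
    show "f \<odot> (i \<odot> k) = Zero C (Src C (i \<odot> k)) (Trg C f)"
      using Comp_red[of k i f "j \<odot> a"] u t a by simp
  next
    fix h assume h: "h \<in> Ar C" "Src C h = Trg C (i \<odot> k)" "h \<odot> (i \<odot> k) = Zero C (Src C (i \<odot> k)) (Trg C h)"
    then have "(h \<odot> i) \<odot> k = Zero C (Src C k) (Trg C h)" using t a by simp
    then obtain v where v: "v \<in> Ar C" "Src C v = Trg C a" "Trg C v = Trg C h" "v \<odot> a = h \<odot> i"
      using Ses_cokernel_factor[OF k, of "h \<odot> i"] h t a by (metis Comp_Ar)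
    obtain x where "x \<in> Ar C" "Src C x = Trg C j" "Trg C x = Trg C h" "x \<odot> f = h"
      by (rule pushout_factor[OF po, of h v]) (use v h t a u in auto)
    then show "\<exists>g. g \<in> Hom C (Trg C f) (Trg C h) \<and> g \<odot> f = h" using u by (auto simp: Hom_def)
  next
    fix x y assume x: "x \<in> Ar C" "y \<in> Ar C" "par x y" "Src C x = Trg C f" "x \<odot> f = y \<odot> f"
    have "(x \<odot> f) \<odot> i = (y \<odot> f) \<odot> i" using x by simp
    then have "(x \<odot> j) \<odot> a = (y \<odot> j) \<odot> a" using x(1-4) u by simp
    then have "x \<odot> j = y \<odot> j" by (rule Ses_epi[OF k]) (use x(1-4) u(1-8) t(1-3,9-11) a(1,2) in auto)
    then show "x = y" by (rule pushout_unique[OF po, rotated 6]) (use x u(1-8) in auto)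
  qed (use u t a in auto)
  moreover have "admissible_mono C (i \<odot> k)"
    using Comp_admissible_mono[OF admissible_monoI[OF k] admissible_monoI[OF s]] t a by auto
  ultimately have "(i \<odot> k, f) \<in> Ses C" using cokernel_Ses by blast
  then show ?thesis
    by (rule Ses_closed_iso[of _ _ "Ident C (Src C k)" "Ident C (Trg C i)" w])
      (use iw w t a u g in \<open>auto simp: Hom_def\<close>)
qed

text \<open>Dual to \<open>cokernel_of_pushout\<close>: an arrow into the pullback killed by
  \<open>q\<close> is the same as an arrow killed by \<open>p\<close>.\<close>

lemma kernel_of_pullback:
  assumes pb: "pullback C p f q r" and s: "(i, p) \<in> Ses C"
  obtains j where "(j, q) \<in> Ses C" "Src C j = Src C i" "Trg C j = Src C q" "r \<odot> j = i"
proof -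
  note u = pullbackD[OF pb] note t = SesD[OF s]
  obtain j where j: "j \<in> Ar C" "Src C j = Src C i" "Trg C j = Src C q" "r \<odot> j = i"
      "q \<odot> j = Zero C (Src C i) (Src C f)"
    by (rule pullback_factor[OF pb, of i "Zero C (Src C i) (Src C f)"]) (use t u in auto)
  have "is_kernel j q"
    unfolding is_kernel_def
  proof (intro conjI allI impI)
    fix h assume h: "h \<in> Ar C" "Trg C h = Src C q" "q \<odot> h = Zero C (Src C h) (Trg C q)"
    have "p \<odot> (r \<odot> h) = f \<odot> (q \<odot> h)"
      using Comp_red[of h r p "f \<odot> q"] h(1,2) u by simp
    then have "p \<odot> (r \<odot> h) = Zero C (Src C h) (Trg C p)" using h u by simp
    then obtain g where g: "g \<in> Ar C" "Src C g = Src C h" "Trg C g = Src C i" "i \<odot> g = r \<odot> h"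
      using Ses_kernel_factor[OF s, of "r \<odot> h"] h u t by (metis Comp_Ar)
    have "j \<odot> g = h"
      by (rule pullback_unique[OF pb])
        (use Comp_red[of g j r i] Comp_red[of g j q "Zero C (Src C i) (Src C f)"] g h j u t in auto)
    then show "\<exists>g. g \<in> Hom C (Src C h) (Src C j) \<and> j \<odot> g = h" using g j by (auto simp: Hom_def)
  next
    fix g h assume g: "g \<in> Ar C" "h \<in> Ar C" "par g h" "Trg C g = Src C j" "j \<odot> g = j \<odot> h"
    have "i \<odot> g = r \<odot> (j \<odot> g)" "i \<odot> h = r \<odot> (j \<odot> h)"
      using Comp_red[of g j r i] Comp_red[of h j r i] g(1-4) j u by auto
    then have "i \<odot> g = i \<odot> h" using g by simp
    then show "g = h" by (rule Ses_mono[OF s]) (use g j in auto)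
  qed (use j u in auto)
  moreover have "admissible_epi C q" using pullback_epi[OF pb admissible_epiI[OF s]] .
  ultimately show ?thesis using that j kernel_Ses by blast
qed

text \<open>The middle map of a morphism of short exact sequences with admissible epic ends factors
  as a pushout of the left end followed by a pullback of the right end.\<close>

lemma kernels_short_exact:
  assumes s1: "(i1, p1) \<in> Ses C" and s0: "(i0, p0) \<in> Ses C"
    and b: "b \<in> Ar C" "Src C b = Trg C i1" "Trg C b = Trg C i0"
    and a: "Src C a = Src C i1" "Trg C a = Src C i0" "b \<odot> i1 = i0 \<odot> a"
    and c: "Src C c = Trg C p1" "Trg C c = Trg C p0" "c \<odot> p1 = p0 \<odot> b"
    and ka: "(ka, a) \<in> Ses C" and kc: "(kc, c) \<in> Ses C"
  shows "admissible_epi C b"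
    and "(kb, b) \<in> Ses C \<Longrightarrow> \<exists>s t. (s, t) \<in> Ses C \<and> Src C s = Src C ka \<and> Trg C s = Src C kb \<and>
      Trg C t = Src C kc \<and> kb \<odot> s = i1 \<odot> ka \<and> kc \<odot> t = p1 \<odot> kb"
proof -
  note t = SesD[OF s1] SesD[OF s0] SesD[OF ka] SesD[OF kc]
  obtain q f where pb: "pullback C p0 c q f"
    using pullback_admissible_epi[of p0 c] admissible_epiI[OF s0] t c by auto
  note u = pullbackD[OF pb]
  obtain j where j: "(j, q) \<in> Ses C" "Src C j = Src C i0" "Trg C j = Src C q" "f \<odot> j = i0"
    by (rule kernel_of_pullback[OF pb s0])
  note tj = SesD[OF j(1)]
  obtain m where m: "(m, f) \<in> Ses C" "Src C m = Src C kc" "Trg C m = Src C f" "q \<odot> m = kc"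
    by (rule kernel_of_pullback[OF pullback_sym[OF pb] kc])
  note tm = SesD[OF m(1)]
  obtain g where g: "g \<in> Ar C" "Src C g = Src C b" "Trg C g = Src C q" "f \<odot> g = b" "q \<odot> g = p1"
    by (rule pullback_factor[OF pb, of b p1]) (use t(1-3,5-7) b c in auto)
  have gi: "g \<odot> i1 = j \<odot> a"
  proof (rule pullback_unique[OF pb])
    have "f \<odot> (g \<odot> i1) = b \<odot> i1"
      by (rule Comp_red) (use g(1-4) b(1,2) u(1-8) t(1) in auto)
    moreover have "f \<odot> (j \<odot> a) = i0 \<odot> a"
      by (rule Comp_red) (use a(1,2) j(2-4) tj(1,2) u(1-8) t(9-11) in auto)
    ultimately show "f \<odot> (g \<odot> i1) = f \<odot> (j \<odot> a)" using a(3) by simp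
    have "q \<odot> (g \<odot> i1) = p1 \<odot> i1"
      by (rule Comp_red) (use g(1-3,5) b(1,2) u(1-8) t(1) in auto)
    moreover have "q \<odot> (j \<odot> a) = Zero C (Src C j) (Trg C q) \<odot> a"
      by (rule Comp_red) (use a(1,2) j(2-4) tj(1,2,4) u(1-8) t(9-11) in auto)
    ultimately show "q \<odot> (g \<odot> i1) = q \<odot> (j \<odot> a)"
      using t(1-4,9-11) a(1,2) c(1) j(2) u(1-8) tj(1) by simp
  qed (use g(1-3) b u(1-8) t(1-3,5-7,9-11) a(1,2) j(2,3) tj(1,2) in auto)
  have sg: "(i1 \<odot> ka, g) \<in> Ses C"
    by (rule pushout_of_epi[OF s1 j(1), of g a ka]) (use g b a gi j ka in auto)
  show "admissible_epi C b"
    using Comp_admissible_epi[OF admissible_epiI[OF sg] admissible_epiI[OF m(1)]] g u by simp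
  assume kb: "(kb, b) \<in> Ses C"
  note tb = SesD[OF kb]
  have "f \<odot> (g \<odot> kb) = Zero C (Src C kb) (Trg C f)"
    using Comp_red[of kb g f b] g tb u b t by simp
  then obtain tt where tt: "tt \<in> Ar C" "Src C tt = Src C kb" "Trg C tt = Src C kc" "m \<odot> tt = g \<odot> kb"
    using Ses_kernel_factor[OF m(1), of "g \<odot> kb"] g tb u m by (metis Comp_Ar)
  have kt: "kc \<odot> tt = p1 \<odot> kb"
  proof -
    have "kc \<odot> tt = q \<odot> (m \<odot> tt)" using Comp_red[of tt m q kc] tt m tm(1,2,4) u(1-8) by simp
    also have "\<dots> = p1 \<odot> kb" using Comp_red[of kb g q p1] tt g tb u by simp
    finally show ?thesis .
  qed
  have "b \<odot> (i1 \<odot> ka) = Zero C (Src C ka) (Trg C b)"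
    using Comp_red[of ka i1 b "i0 \<odot> a"] b a t by simp
  then obtain ss where ss: "ss \<in> Ar C" "Src C ss = Src C ka" "Trg C ss = Src C kb" "kb \<odot> ss = i1 \<odot> ka"
    using Ses_kernel_factor[OF kb, of "i1 \<odot> ka"] b tb t a by (metis Comp_Ar)
  \<comment> \<open>Restricting \<open>g\<close> to the kernel of \<open>b\<close> amounts to
    pulling \<open>g\<close> back along the kernel \<open>m\<close> of \<open>f\<close>. Hence
    \<open>tt\<close> is an admissible epi with the same kernel object as \<open>g\<close>.\<close>
  have pb2: "pullback C g m tt kb"
  proof (rule pullbackI)
    fix x y assume x: "x \<in> Ar C" "y \<in> Ar C" "Src C y = Src C x" "Trg C x = Src C g" "Trg C y = Src C m"
      "g \<odot> x = m \<odot> y"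
    have "b \<odot> x = f \<odot> (m \<odot> y)" using Comp_red[of x g f b] x g u by simp
    also have "\<dots> = Zero C (Src C x) (Trg C b)"
      using Comp_red[of y m f "Zero C (Src C m) (Trg C f)"] x(1-5) m(2-4) tm(1,2,4) u(1-8) g(1-3) b(1,2,3) t(1-3,5-7) by simp
    finally obtain w where w: "w \<in> Ar C" "Src C w = Src C x" "Trg C w = Src C kb" "kb \<odot> w = x"
      using Ses_kernel_factor[OF kb, of x] x g tb by metis
    have "m \<odot> (tt \<odot> w) = m \<odot> y"
      using Comp_red[of w tt m "g \<odot> kb"] w tt m(2-4) tm(1,2) g(1-3) tb(1-3) x b(1,2,3) by simp
    then have "tt \<odot> w = y" by (rule Ses_mono[OF m(1)]) (use w tt m x in auto)
    then show "\<exists>w. w \<in> Ar C \<and> Src C w = Src C x \<and> Trg C w = Src C tt \<and> kb \<odot> w = x \<and> tt \<odot> w = y"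
      using w tt by auto
  next
    fix w w' assume "w \<in> Ar C" "w' \<in> Ar C" "Src C w = Src C w'" "Trg C w = Src C tt"
      "Trg C w' = Src C tt" "kb \<odot> w = kb \<odot> w'"
    then show "w = w'" using Ses_mono[OF kb] tt by simp
  qed (use g(1-3) m(2-4) tm(1,2) tt tb u(1-8) b in auto)
  obtain s' where s': "(s', tt) \<in> Ses C" "Src C s' = Src C (i1 \<odot> ka)" "Trg C s' = Src C tt" "kb \<odot> s' = i1 \<odot> ka"
    by (rule kernel_of_pullback[OF pb2 sg])
  have "s' = ss"
    by (rule Ses_mono[OF kb]) (use s' SesD[OF s'(1)] ss tt t a in auto)
  then show "\<exists>s t. (s, t) \<in> Ses C \<and> Src C s = Src C ka \<and> Trg C s = Src C kb \<and>
      Trg C t = Src C kc \<and> kb \<odot> s = i1 \<odot> ka \<and> kc \<odot> t = p1 \<odot> kb"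
    using s' ss tt kt by blast
qed

text \<open>The axioms speak of composites and pullbacks only: \<open>dg p p'\<close> is the
  composite of \<open>dg p (Ident C B)\<close> and \<open>dg (Ident C A) p'\<close>, which are
  pullbacks of \<open>p\<close> and \<open>p'\<close> along projections.\<close>

lemma Ses_dg:
  assumes s: "(i, p) \<in> Ses C" and s': "(i', p') \<in> Ses C"
  shows "(dg i i', dg p p') \<in> Ses C"
proof -
  note t = SesD[OF s] SesD[OF s']
  define A where "A = Trg C p" define B where "B = Trg C i'"
  define A' where "A' = Trg C p'" define B' where "B' = Trg C i"
  have O: "A \<in> Ob C" "B \<in> Ob C" "A' \<in> Ob C" "B' \<in> Ob C" using t by (auto simp: A_def B_def A'_def B'_def)
  have "pullback C p (cp (Ident C A) (Zero C B A)) (dg p (Ident C B)) (cp (Ident C B') (Zero C B B'))"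
  proof (rule pullbackI)
    fix u v assume a: "u \<in> Ar C" "v \<in> Ar C" "Src C v = Src C u" "Trg C u = Src C p"
      "Trg C v = Src C (cp (Ident C A) (Zero C B A))" "p \<odot> u = cp (Ident C A) (Zero C B A) \<odot> v"
    have "v \<in> Ar C" "Trg C v = (A) \<oplus>\<oplus> (B)" "A \<in> Ob C" "B \<in> Ob C"
      by (use a O in auto)
    then obtain x y where v: "x \<in> Ar C" "y \<in> Ar C" "Trg C x = A" "Trg C y = B" "Src C y = Src C x" "v = pr x y" by (rule dsum_decomp)
    have "x = p \<odot> u" using a v O by (auto simp: Hom_def)
    then show "\<exists>w. w \<in> Ar C \<and> Src C w = Src C u \<and> Trg C w = Src C (dg p (Ident C B)) \<and>
        cp (Ident C B') (Zero C B B') \<odot> w = u \<and> dg p (Ident C B) \<odot> w = v"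
      by (intro exI[of _ "pr u y"]) (use a v O t in \<open>auto simp: Hom_def B'_def\<close>)
  next
    fix w w' assume a: "w \<in> Ar C" "w' \<in> Ar C" "Src C w = Src C w'" "Trg C w = Src C (dg p (Ident C B))"
      "Trg C w' = Src C (dg p (Ident C B))"
      "cp (Ident C B') (Zero C B B') \<odot> w = cp (Ident C B') (Zero C B B') \<odot> w'"
      "dg p (Ident C B) \<odot> w = dg p (Ident C B) \<odot> w'"
    have "w \<in> Ar C" "Trg C w = (B') \<oplus>\<oplus> (B)" "B' \<in> Ob C" "B \<in> Ob C"
      by (use a O t in \<open>auto simp: B'_def\<close>)
    then obtain x y where v: "x \<in> Ar C" "y \<in> Ar C" "Trg C x = B'" "Trg C y = B" "Src C y = Src C x" "w = pr x y" by (rule dsum_decomp)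
    have "w' \<in> Ar C" "Trg C w' = (B') \<oplus>\<oplus> (B)" "B' \<in> Ob C" "B \<in> Ob C"
      by (use a O t in \<open>auto simp: B'_def\<close>)
    then obtain x' y' where v': "x' \<in> Ar C" "y' \<in> Ar C" "Trg C x' = B'" "Trg C y' = B" "Src C y' = Src C x'" "w' = pr x' y'" by (rule dsum_decomp)
    show "w = w'" using a v v' O t by (simp add: Hom_def B'_def)
  qed (use O t in \<open>auto simp: A_def B'_def dg_def\<close>)
  then have e1: "admissible_epi C (dg p (Ident C B))"
    using pullback_epi admissible_epiI[OF s] by blast
  have "pullback C p' (cp (Zero C A A') (Ident C A')) (dg (Ident C A) p') (cp (Zero C A B) (Ident C B))"
  proof (rule pullbackI)
    fix u v assume a: "u \<in> Ar C" "v \<in> Ar C" "Src C v = Src C u" "Trg C u = Src C p'"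
      "Trg C v = Src C (cp (Zero C A A') (Ident C A'))" "p' \<odot> u = cp (Zero C A A') (Ident C A') \<odot> v"
    have "v \<in> Ar C" "Trg C v = (A) \<oplus>\<oplus> (A')" "A \<in> Ob C" "A' \<in> Ob C"
      by (use a O in auto)
    then obtain x y where v: "x \<in> Ar C" "y \<in> Ar C" "Trg C x = A" "Trg C y = A'" "Src C y = Src C x" "v = pr x y" by (rule dsum_decomp)
    have "y = p' \<odot> u" using a v O by (auto simp: Hom_def)
    then show "\<exists>w. w \<in> Ar C \<and> Src C w = Src C u \<and> Trg C w = Src C (dg (Ident C A) p') \<and>
        cp (Zero C A B) (Ident C B) \<odot> w = u \<and> dg (Ident C A) p' \<odot> w = v"
      by (intro exI[of _ "pr x u"]) (use a v O t in \<open>auto simp: Hom_def B_def\<close>)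
  next
    fix w w' assume a: "w \<in> Ar C" "w' \<in> Ar C" "Src C w = Src C w'" "Trg C w = Src C (dg (Ident C A) p')"
      "Trg C w' = Src C (dg (Ident C A) p')"
      "cp (Zero C A B) (Ident C B) \<odot> w = cp (Zero C A B) (Ident C B) \<odot> w'"
      "dg (Ident C A) p' \<odot> w = dg (Ident C A) p' \<odot> w'"
    have "w \<in> Ar C" "Trg C w = (A) \<oplus>\<oplus> (B)" "A \<in> Ob C" "B \<in> Ob C"
      by (use a O t in \<open>auto simp: B_def\<close>)
    then obtain x y where v: "x \<in> Ar C" "y \<in> Ar C" "Trg C x = A" "Trg C y = B" "Src C y = Src C x" "w = pr x y" by (rule dsum_decomp)
    have "w' \<in> Ar C" "Trg C w' = (A) \<oplus>\<oplus> (B)" "A \<in> Ob C" "B \<in> Ob C"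
      by (use a O t in \<open>auto simp: B_def\<close>)
    then obtain x' y' where v': "x' \<in> Ar C" "y' \<in> Ar C" "Trg C x' = A" "Trg C y' = B" "Src C y' = Src C x'" "w' = pr x' y'" by (rule dsum_decomp)
    show "w = w'" using a v v' O t by (simp add: Hom_def B_def)
  qed (use O t in \<open>auto simp: A'_def B_def dg_def\<close>)
  then have e2: "admissible_epi C (dg (Ident C A) p')"
    using pullback_epi admissible_epiI[OF s'] by blast
  have "admissible_epi C (dg (Ident C A) p' \<odot> dg p (Ident C B))"
    by (rule Comp_admissible_epi[OF e1 e2]) (use t O in \<open>auto simp: A_def B_def\<close>)
  then have e: "admissible_epi C (dg p p')" using t by (simp add: A_def B_def)
  have "is_kernel (dg i i') (dg p p')"
    unfolding is_kernel_def
  proof (intro conjI allI impI)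
    fix f assume f: "f \<in> Ar C" "Trg C f = Src C (dg p p')"
      "dg p p' \<odot> f = Zero C (Src C f) (Trg C (dg p p'))"
    have "f \<in> Ar C" "Trg C f = (B') \<oplus>\<oplus> (B)" "B' \<in> Ob C" "B \<in> Ob C"
      by (use f O t in \<open>auto simp: B_def B'_def\<close>)
    then obtain x y where v: "x \<in> Ar C" "y \<in> Ar C" "Trg C x = B'" "Trg C y = B" "Src C y = Src C x" "f = pr x y" by (rule dsum_decomp)
    have "pr (p \<odot> x) (p' \<odot> y) = pr (Zero C (Src C f) A) (Zero C (Src C f) A')"
      using f v t by (simp add: Hom_def B_def B'_def A_def A'_def)
    then have "p \<odot> x = Zero C (Src C f) (Trg C p)" "p' \<odot> y = Zero C (Src C f) (Trg C p')"
      using v t f O by (simp_all add: Hom_def B_def B'_def A_def A'_def del: pr_Zero)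
    then obtain x' y' where x': "x' \<in> Ar C" "Src C x' = Src C f" "Trg C x' = Src C i" "i \<odot> x' = x"
       and y': "y' \<in> Ar C" "Src C y' = Src C f" "Trg C y' = Src C i'" "i' \<odot> y' = y"
      using Ses_kernel_factor[OF s, of x] Ses_kernel_factor[OF s', of y] v
      unfolding B_def B'_def by (smt (verit) pr_Ar(2))
    then show "\<exists>g. g \<in> Hom C (Src C f) (Src C (dg i i')) \<and> dg i i' \<odot> g = f"
      by (intro exI[of _ "pr x' y'"]) (use t v in \<open>auto simp: Hom_def\<close>)
  next
    fix g h assume g: "g \<in> Ar C" "h \<in> Ar C" "par g h" "Trg C g = Src C (dg i i')" "dg i i' \<odot> g = dg i i' \<odot> h"
    have "g \<in> Ar C" "Trg C g = (Src C i) \<oplus>\<oplus> (Src C i')" "Src C i \<in> Ob C" "Src C i' \<in> Ob C"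
      by (use g t in auto)
    then obtain x y where v: "x \<in> Ar C" "y \<in> Ar C" "Trg C x = (Src C i)" "Trg C y = (Src C i')" "Src C y = Src C x" "g = pr x y" by (rule dsum_decomp)
    have "h \<in> Ar C" "Trg C h = (Src C i) \<oplus>\<oplus> (Src C i')" "Src C i \<in> Ob C" "Src C i' \<in> Ob C"
      by (use g t in auto)
    then obtain x' y' where v': "x' \<in> Ar C" "y' \<in> Ar C" "Trg C x' = (Src C i)" "Trg C y' = (Src C i')" "Src C y' = Src C x'" "h = pr x' y'" by (rule dsum_decomp)
    have "i \<odot> x = i \<odot> x'" "i' \<odot> y = i' \<odot> y'" using g v v' t by (simp_all add: Hom_def)
    then have "x = x'" "y = y'" using Ses_mono[OF s, of x x'] Ses_mono[OF s', of y y'] v v' g(3)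
      by (auto simp: Hom_def)
    then show "g = h" using v v' by simp
  qed (use t in auto)
  then show ?thesis using kernel_Ses e by blast
qed

text \<open>The direct sum of the trivial conflations on \<open>A\<close> and on \<open>B\<close>,
  with the zero summands removed from its two ends.\<close>

lemma Ses_in1_pr2:
  assumes [simp]: "A \<in> Ob C" "B \<in> Ob C"
  shows "(pr (Ident C A) (Zero C A B), cp (Zero C A B) (Ident C B)) \<in> Ses C"
proof -
  have "(dg (Ident C A) (Zero C Z0 B), dg (Zero C A Z0) (Ident C B)) \<in> Ses C"
    using Ses_dg[OF Ses_iso_mono[of "Ident C A"] Ses_iso_epi[of "Ident C B"]] by simp
  moreover have "isomorphism C (cp (Ident C A) (Zero C Z0 A))"
    by (rule isomorphismI[of _ "pr (Ident C A) (Zero C A Z0)"]) (auto simp: Ident_dsum)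
  moreover have "isomorphism C (cp (Zero C Z0 B) (Ident C B))"
    by (rule isomorphismI[of _ "pr (Zero C B Z0) (Ident C B)"]) (auto simp: Ident_dsum)
  ultimately show ?thesis
    by (elim Ses_closed_iso[of _ _ "cp (Ident C A) (Zero C Z0 A)" "Ident C (A \<oplus>\<oplus> B)" "cp (Zero C Z0 B) (Ident C B)"])
      (auto simp: Hom_def dg_def)
qed

text \<open>The splitting identifies the sequence with the standard one. Later conflations given by
  explicit matrices are certified by naming the section \<open>s\<close> and the retraction
  \<open>r\<close>.\<close>

lemma Ses_split:
  assumes "i \<in> Ar C" "p \<in> Ar C" "s \<in> Ar C" "r \<in> Ar C" "Src C p = Trg C i"
    "Src C s = Trg C p" "Trg C s = Trg C i" "Src C r = Trg C i" "Trg C r = Src C i"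
    "r \<odot> i = Ident C (Src C i)" "p \<odot> s = Ident C (Trg C p)" "p \<odot> i = Zero C (Src C i) (Trg C p)"
    "r \<odot> s = Zero C (Trg C p) (Src C i)" "i \<odot> r \<boxplus> s \<odot> p = Ident C (Trg C i)"
  shows "(i, p) \<in> Ses C"
proof -
  have "isomorphism C (cp i s)"
    by (rule isomorphismI[of _ "pr r p"]) (use assms in \<open>auto simp: Ident_dsum\<close>)
  then show ?thesis
    by (intro Ses_closed_iso[OF Ses_in1_pr2[of "Src C i" "Trg C p"],
          of "Ident C (Src C i)" "cp i s" "Ident C (Trg C p)"])
      (use assms in \<open>auto simp: Hom_def\<close>)
qed

end

section \<open>Acyclic complexes\<close>

lemma all_natI: "P 0 \<Longrightarrow> (\<And>n. P (Suc n)) \<Longrightarrow> \<forall>n. P n"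
  by (metis not0_implies_Suc)

context exact_category
begin

lemma Ses_iso_left:
  assumes "(i, p) \<in> Ses C" "zero_object C (Trg C p)"
  shows "isomorphism C i"
proof -
  note t = SesD[OF assms(1)]
  have "p = Zero C (Trg C i) (Trg C p)" using to_zero_eq[OF assms(2), of p] t by simp
  then have "p \<odot> Ident C (Trg C i) = Zero C (Trg C i) (Trg C p)" using t by simp
  then have "p \<odot> Ident C (Trg C i) = Zero C (Src C (Ident C (Trg C i))) (Trg C p)" using t by simp
  then obtain g where g: "g \<in> Ar C" "Src C g = Trg C i" "Trg C g = Src C i" "i \<odot> g = Ident C (Trg C i)"
    using Ses_kernel_factor[OF assms(1), of "Ident C (Trg C i)"] t(1) by (metis Ident_Ar Trg_Ob)
  have "i \<odot> (g \<odot> i) = Ident C (Trg C i) \<odot> i" by (rule Comp_red) (use g t in auto)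
  then have "i \<odot> (g \<odot> i) = i \<odot> Ident C (Src C i)" using t by simp
  then have "g \<odot> i = Ident C (Src C i)"
    by (rule Ses_mono[OF assms(1)]) (use g t in auto)
  then show ?thesis by (intro isomorphismI[of i g]) (use g t in auto)
qed

lemma zero_object_mono:
  assumes "(i, p) \<in> Ses C" "zero_object C (Trg C i)"
  shows "zero_object C (Src C i)"
proof -
  note t = SesD[OF assms(1)]
  have "i \<odot> Ident C (Src C i) = i \<odot> Zero C (Src C i) (Src C i)"
    using t to_zero_eq[OF assms(2), of i] by simp
  then have "Ident C (Src C i) = Zero C (Src C i) (Src C i)"
    by (rule Ses_mono[OF assms(1)]) (use t in auto)
  then show ?thesis using zero_object_iff t by simp
qed

lemma zero_object_epi:
  assumes "(i, p) \<in> Ses C" "zero_object C (Trg C i)"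
  shows "zero_object C (Trg C p)"
proof -
  note t = SesD[OF assms(1)]
  have "Ident C (Trg C p) \<odot> p = Zero C (Trg C p) (Trg C p) \<odot> p"
    using t from_zero_eq[OF assms(2), of p] by simp
  then have "Ident C (Trg C p) = Zero C (Trg C p) (Trg C p)"
    by (rule Ses_epi[OF assms(1)]) (use t in auto)
  then show ?thesis using zero_object_iff t by simp
qed

lemma Ses_zero_zero:
  assumes "zero_object C A"
  shows "(Zero C Z0 A, Zero C A Z0) \<in> Ses C"
proof -
  have A: "A \<in> Ob C" "Ident C A = Zero C A A" using assms zero_object_iff by auto
  have "isomorphism C (Zero C A Z0)"
    by (rule isomorphismI[of _ "Zero C Z0 A"]) (use A in auto)
  then show ?thesis using Ses_iso_epi[of "Zero C A Z0"] A by simp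
qed

lemma chain_complexD:
  assumes "chain_complex C P d"
  shows "P n \<in> Ob C" "d n \<in> Ar C" "Src C (d n) = P (Suc n)" "Trg C (d n) = P n"
    "d n \<odot> d (Suc n) = Zero C (P (Suc (Suc n))) (P n)" "\<exists>b. \<forall>n>b. zero_object C (P n)"
  using assms unfolding chain_complex_def Hom_def by auto

lemma acyclicD: "acyclic_complex C P d \<Longrightarrow> chain_complex C P d"
  unfolding acyclic_complex_def by simp

lemma acyclicI:
  assumes "\<exists>b. \<forall>n>b. zero_object C (P n)" "zero_object C (J 0)"
    "\<And>n. i n \<in> Hom C (J (Suc n)) (P n)" "\<And>n. p n \<in> Hom C (P n) (J n)" "\<And>n. (i n, p n) \<in> Ses C"
    "\<And>n. d n = i n \<odot> p (Suc n)"
  shows "acyclic_complex C P d"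
proof -
  have t: "i n \<in> Ar C" "Src C (i n) = J (Suc n)" "Trg C (i n) = P n"
    "p n \<in> Ar C" "Src C (p n) = P n" "Trg C (p n) = J n" "p n \<odot> i n = Zero C (J (Suc n)) (J n)" for n
    using assms(3,4)[of n] SesD[OF assms(5)[of n]] by (auto simp: Hom_def)
  have O: "P n \<in> Ob C" "J n \<in> Ob C" for n
    using t(4,5,6)[of n] Src_Ob Trg_Ob by metis+
  have "chain_complex C P d"
    unfolding chain_complex_def
  proof (intro conjI allI)
    fix n
    have "i n \<odot> (p (Suc n) \<odot> (i (Suc n) \<odot> p (Suc (Suc n)))) = Zero C (P (Suc (Suc n))) (P n)"
      using Comp_red[of "p (Suc (Suc n))" "i (Suc n)" "p (Suc n)" "Zero C (J (Suc (Suc n))) (J (Suc n))"] t O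
      by simp
    then show "d n \<odot> d (Suc n) = Zero C (P (Suc (Suc n))) (P n)" using t by (simp add: assms(6))
  qed (use assms(1) O t in \<open>auto simp: assms(6) Hom_def\<close>)
  then show ?thesis unfolding acyclic_complex_def using assms by blast
qed

lemma acyclic_zero:
  assumes "\<And>n. zero_object C (P n)" "\<And>n. d n \<in> Hom C (P (Suc n)) (P n)"
  shows "acyclic_complex C P d"
proof (rule acyclicI[of _ "\<lambda>_. Z0" "\<lambda>n. Zero C Z0 (P n)" "\<lambda>n. Zero C (P n) Z0"])
  fix n
  show "d n = Zero C Z0 (P n) \<odot> Zero C (P (Suc n)) Z0"
    using to_zero_eq[OF assms(1)[of n], of "d n"] assms(2)[of n] zero_objectD[OF assms(1)]
    by (simp add: Hom_def)
qed (use assms zero_objectD[OF assms(1)] Ses_zero_zero in \<open>auto simp: Hom_def\<close>)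

text \<open>Kept apart from \<open>cut\<close> because \<open>acyclic_extension_aux\<close> has to
  cut a complex that is not yet known to be acyclic.\<close>

definition precut :: "(nat \<Rightarrow> 'o) \<Rightarrow> (nat \<Rightarrow> 'a) \<Rightarrow> 'o \<Rightarrow> 'a \<Rightarrow> 'a \<Rightarrow> bool" where
  "precut P d J \<iota> \<pi> \<longleftrightarrow> (\<iota>, d 0) \<in> Ses C \<and> d 0 \<in> Hom C (P (Suc 0)) (P 0) \<and> Src C \<iota> = J \<and>
     \<pi> \<in> Hom C (P (Suc (Suc 0))) J \<and>
     d (Suc 0) = \<iota> \<odot> \<pi>"

definition tail_obj :: "'o \<Rightarrow> (nat \<Rightarrow> 'o) \<Rightarrow> nat \<Rightarrow> 'o" where
  "tail_obj J P = case_nat J (\<lambda>n. P (Suc (Suc n)))"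

definition tail_ar :: "'a \<Rightarrow> (nat \<Rightarrow> 'a) \<Rightarrow> nat \<Rightarrow> 'a" where
  "tail_ar x d = case_nat x (\<lambda>n. d (Suc (Suc n)))"

lemma tail_simps[simp]:
  "tail_obj J P 0 = J" "tail_obj J P (Suc n) = P (Suc (Suc n))"
  "tail_ar x d 0 = x" "tail_ar x d (Suc n) = d (Suc (Suc n))"
  by (simp_all add: tail_obj_def tail_ar_def)

text \<open>The acyclic complex \<open>P\<close> is spliced from \<open>J \<rightarrow> P 1 \<rightarrow> P 0\<close> and
  \<open>\<dots> \<rightarrow> P 3 \<rightarrow> P 2 \<rightarrow> J\<close>.\<close>

definition cut :: "(nat \<Rightarrow> 'o) \<Rightarrow> (nat \<Rightarrow> 'a) \<Rightarrow> 'o \<Rightarrow> 'a \<Rightarrow> 'a \<Rightarrow> bool" where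
  "cut P d J \<iota> \<pi> \<longleftrightarrow> precut P d J \<iota> \<pi> \<and> acyclic_complex C (tail_obj J P) (tail_ar \<pi> d)"

lemma acyclic_cut:
  assumes "acyclic_complex C P d"
  shows "\<exists>J \<iota> \<pi>. cut P d J \<iota> \<pi>"
proof -
  obtain J i p where z: "zero_object C (J 0)"
    and h: "\<And>n. i n \<in> Hom C (J (Suc n)) (P n)" "\<And>n. p n \<in> Hom C (P n) (J n)"
    and s: "\<And>n. (i n, p n) \<in> Ses C" and d: "\<And>n. d n = i n \<odot> p (Suc n)"
    using assms unfolding acyclic_complex_def by blast
  note ch = chain_complexD[OF acyclicD[OF assms]]
  have t: "i n \<in> Ar C" "Src C (i n) = J (Suc n)" "Trg C (i n) = P n"
    "p n \<in> Ar C" "Src C (p n) = P n" "Trg C (p n) = J n" for n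
    using h[of n] by (auto simp: Hom_def)
  have O: "J n \<in> Ob C" for n using t(4,6)[of n] Trg_Ob by metis
  \<comment> \<open>As \<open>J 0\<close> is zero, \<open>d 0\<close> is itself an admissible epi up
    to this isomorphism. Because of the index shift in \<open>acyclic_complex\<close> its kernel is
    \<open>J (Suc (Suc 0))\<close>.\<close>
  have "isomorphism C (i 0)"
    by (rule Ses_iso_left[OF s]) (use z t in simp)
  then have "(i (Suc 0), d 0) \<in> Ses C"
    by (intro Ses_closed_iso[OF s[of "Suc 0"], of "Ident C (J (Suc (Suc 0)))" "Ident C (P (Suc 0))" "i 0"])
      (use t O ch in \<open>auto simp: Hom_def d\<close>)
  then have "precut P d (J (Suc (Suc 0))) (i (Suc 0)) (p (Suc (Suc 0)))"
    unfolding precut_def using t d h ch by (simp add: Hom_def)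
  moreover have "acyclic_complex C (tail_obj (J (Suc (Suc 0))) P) (tail_ar (p (Suc (Suc 0))) d)"
  proof (rule acyclicI[of _ "tail_obj Z0 J" "tail_ar (Ident C (J (Suc (Suc 0)))) i" "tail_ar (Zero C (J (Suc (Suc 0))) Z0) p"])
    obtain b where b: "\<forall>n>b. zero_object C (P n)" using ch(6) by blast
    have "zero_object C (tail_obj (J (Suc (Suc 0))) P n)" if "n > Suc b" for n
      using that b by (cases n) auto
    then show "\<exists>b. \<forall>n>b. zero_object C (tail_obj (J (Suc (Suc 0))) P n)" by blast
  next
    fix n
    show "tail_ar (Ident C (J (Suc (Suc 0)))) i n \<in> Hom C (tail_obj Z0 J (Suc n)) (tail_obj (J (Suc (Suc 0))) P n)"
      "tail_ar (Zero C (J (Suc (Suc 0))) Z0) p n \<in> Hom C (tail_obj (J (Suc (Suc 0))) P n) (tail_obj Z0 J n)"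
      "(tail_ar (Ident C (J (Suc (Suc 0)))) i n, tail_ar (Zero C (J (Suc (Suc 0))) Z0) p n) \<in> Ses C"
      "tail_ar (p (Suc (Suc 0))) d n = tail_ar (Ident C (J (Suc (Suc 0)))) i n \<odot> tail_ar (Zero C (J (Suc (Suc 0))) Z0) p (Suc n)"
      using O t s d Ses_iso_mono[of "Ident C (J (Suc (Suc 0)))"]
      by (cases n; auto simp: Hom_def)+
  qed simp
  ultimately show ?thesis unfolding cut_def by blast
qed

text \<open>The factorisation of the tail is spliced onto the conflation over \<open>P 0\<close>:
  the tail ends in \<open>J\<close>, so \<pi> is an admissible epi and its kernel continues the
  factorisation.\<close>

lemma acyclic_uncut:
  assumes c: "cut P d J \<iota> \<pi>" and b: "\<exists>b. \<forall>n>b. zero_object C (P n)"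
  shows "acyclic_complex C P d"
proof -
  have s1: "(\<iota>, d 0) \<in> Ses C" "Src C \<iota> = J" "\<pi> \<in> Ar C" "Src C \<pi> = P (Suc (Suc 0))" "Trg C \<pi> = J"
    and d1: "d (Suc 0) = \<iota> \<odot> \<pi>"
    and tP: "P 0 = Trg C (d 0)" "P (Suc 0) = Src C (d 0)"
    and e: "acyclic_complex C (tail_obj J P) (tail_ar \<pi> d)"
    using c unfolding cut_def precut_def Hom_def by auto
  note t1 = SesD[OF s1(1)]
  obtain K i p where z: "zero_object C (K 0)"
    and h: "\<And>n. i n \<in> Hom C (K (Suc n)) (tail_obj J P n)" "\<And>n. p n \<in> Hom C (tail_obj J P n) (K n)"
    and s: "\<And>n. (i n, p n) \<in> Ses C" and d: "\<And>n. tail_ar \<pi> d n = i n \<odot> p (Suc n)"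
    using e unfolding acyclic_complex_def by blast
  have t: "i n \<in> Ar C" "Src C (i n) = K (Suc n)" "Trg C (i n) = tail_obj J P n"
    "p n \<in> Ar C" "Src C (p n) = tail_obj J P n" "Trg C (p n) = K n" for n
    using h[of n] by (auto simp: Hom_def)
  have O: "K n \<in> Ob C" "tail_obj J P n \<in> Ob C" for n
    using t(4,5,6)[of n] Trg_Ob Src_Ob by metis+
  have i0: "isomorphism C (i 0)"
    by (rule Ses_iso_left[OF s]) (use z t in simp)
  have pi: "\<pi> = i 0 \<odot> p (Suc 0)" using d[of 0] by simp
  have s2: "(i (Suc 0), \<pi>) \<in> Ses C"
    by (rule Ses_closed_iso[OF s[of "Suc 0"], of "Ident C (K (Suc (Suc 0)))" "Ident C (P (Suc (Suc 0)))" "i 0"])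
      (use t[of 0] t[of "Suc 0"] i0 O O(2)[of "Suc 0"] pi s1 in \<open>auto simp: Hom_def\<close>)
  let ?J = "case_nat Z0 (case_nat (P 0) (case_nat J (\<lambda>n. K (Suc (Suc n)))))"
  let ?i = "case_nat (Ident C (P 0)) (case_nat \<iota> (\<lambda>n. i (Suc n)))"
  let ?p = "case_nat (Zero C (P 0) Z0) (case_nat (d 0) (case_nat \<pi> (\<lambda>n. p (Suc (Suc n)))))"
  have P0: "P 0 \<in> Ob C" using tP t1 by simp
  show ?thesis
  proof (rule acyclicI[OF b, of ?J ?i ?p])
    fix n
    show "?i n \<in> Hom C (?J (Suc n)) (P n)"
      using t t1 s1 P0 tP by (auto split: nat.splits simp: Hom_def)
    show "?p n \<in> Hom C (P n) (?J n)"
      using t t1 s1 P0 tP by (auto split: nat.splits simp: Hom_def)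
    show "(?i n, ?p n) \<in> Ses C"
      using s s1 s2 Ses_iso_mono[of "Ident C (P 0)"] P0 by (auto split: nat.splits)
    show "d n = ?i n \<odot> ?p (Suc n)"
      using d1 t1 tP d[of "Suc m" for m] by (auto split: nat.splits)
  qed simp
qed

section \<open>Short exact sequences of complexes and of their cuts\<close>

definition ses_cx :: "(nat \<Rightarrow> 'o) \<Rightarrow> (nat \<Rightarrow> 'a) \<Rightarrow> (nat \<Rightarrow> 'o) \<Rightarrow> (nat \<Rightarrow> 'a) \<Rightarrow>
    (nat \<Rightarrow> 'o) \<Rightarrow> (nat \<Rightarrow> 'a) \<Rightarrow> (nat \<Rightarrow> 'a) \<Rightarrow> (nat \<Rightarrow> 'a) \<Rightarrow> bool" where
  "ses_cx A dA B dB D dD f g \<longleftrightarrow> (\<forall>n. (f n, g n) \<in> Ses C \<and>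
     Src C (f n) = A n \<and> Trg C (f n) = B n \<and> Trg C (g n) = D n \<and>
     f n \<odot> dA n = dB n \<odot> f (Suc n) \<and> g n \<odot> dB n = dD n \<odot> g (Suc n))"

lemma ses_cxD:
  assumes "ses_cx A dA B dB D dD f g"
  shows "(f n, g n) \<in> Ses C" "f n \<in> Ar C" "g n \<in> Ar C" "Src C (f n) = A n" "Trg C (f n) = B n"
    "Src C (g n) = B n" "Trg C (g n) = D n"
    "f n \<odot> dA n = dB n \<odot> f (Suc n)" "g n \<odot> dB n = dD n \<odot> g (Suc n)"
  using assms SesD[of "f n" "g n"] unfolding ses_cx_def by auto

lemma ses_cx_kernels:
  assumes s: "ses_cx A dA B dB D dD f g"
    and B: "dB 0 \<in> Hom C (B (Suc 0)) (B 0)"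
    and A: "precut A dA JA \<iota>A \<pi>A" and D: "precut D dD JD \<iota>D \<pi>D"
  shows "admissible_epi C (dB 0)"
    and "(\<iota>B, dB 0) \<in> Ses C \<Longrightarrow> \<exists>x y. (x, y) \<in> Ses C \<and> Src C x = JA \<and> Trg C x = Src C \<iota>B \<and>
      Trg C y = JD \<and> \<iota>B \<odot> x = f (Suc 0) \<odot> \<iota>A \<and> \<iota>D \<odot> y = g (Suc 0) \<odot> \<iota>B"
proof -
  note t = ses_cxD[OF s]
  have kA: "(\<iota>A, dA 0) \<in> Ses C" "Src C \<iota>A = JA" and kD: "(\<iota>D, dD 0) \<in> Ses C" "Src C \<iota>D = JD"
    and ty: "Src C (dA 0) = A (Suc 0)" "Trg C (dA 0) = A 0" "Src C (dD 0) = D (Suc 0)" "Trg C (dD 0) = D 0"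
    using A D unfolding precut_def Hom_def by auto
  show "admissible_epi C (dB 0)"
    by (rule kernels_short_exact(1)[OF t(1)[of "Suc 0"] t(1)[of 0] _ _ _ _ _ _ _ _ _ kA(1) kD(1)])
      (use t(2-9) ty B in \<open>simp_all add: Hom_def\<close>)
  assume "(\<iota>B, dB 0) \<in> Ses C"
  then show "\<exists>x y. (x, y) \<in> Ses C \<and> Src C x = JA \<and> Trg C x = Src C \<iota>B \<and>
      Trg C y = JD \<and> \<iota>B \<odot> x = f (Suc 0) \<odot> \<iota>A \<and> \<iota>D \<odot> y = g (Suc 0) \<odot> \<iota>B"
    using kernels_short_exact(2)[OF t(1)[of "Suc 0"] t(1)[of 0] _ _ _ _ _ _ _ _ _ kA(1) kD(1), of "dB 0" \<iota>B]
     t(2-9) ty B kA kD by (simp add: Hom_def)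
qed

text \<open>Cutting is exact: \<open>ses_cx_kernels\<close> gives the conflation in degree 0, and
  the induced arrows commute with the maps \<pi> because the kernels \<iota> can be
  cancelled.\<close>

lemma ses_cx_tail:
  assumes s: "ses_cx A dA B dB D dD f g"
    and A: "precut A dA JA \<iota>A \<pi>A" and B: "precut B dB JB \<iota>B \<pi>B" and D: "precut D dD JD \<iota>D \<pi>D"
  shows "\<exists>x y. ses_cx (tail_obj JA A) (tail_ar \<pi>A dA) (tail_obj JB B) (tail_ar \<pi>B dB)
      (tail_obj JD D) (tail_ar \<pi>D dD) (tail_ar x f) (tail_ar y g) \<and>
      \<iota>B \<odot> x = f (Suc 0) \<odot> \<iota>A \<and> \<iota>D \<odot> y = g (Suc 0) \<odot> \<iota>B"
proof -
  note t = ses_cxD[OF s]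
  have kA: "(\<iota>A, dA 0) \<in> Ses C" "Src C \<iota>A = JA" "Trg C \<iota>A = A (Suc 0)"
     "\<pi>A \<in> Ar C" "Src C \<pi>A = A (Suc (Suc 0))" "Trg C \<pi>A = JA" "dA (Suc 0) = \<iota>A \<odot> \<pi>A"
    and kB: "(\<iota>B, dB 0) \<in> Ses C" "Src C \<iota>B = JB" "Trg C \<iota>B = B (Suc 0)"
     "\<pi>B \<in> Ar C" "Src C \<pi>B = B (Suc (Suc 0))" "Trg C \<pi>B = JB" "dB (Suc 0) = \<iota>B \<odot> \<pi>B"
    and kD: "(\<iota>D, dD 0) \<in> Ses C" "Src C \<iota>D = JD" "Trg C \<iota>D = D (Suc 0)"
     "\<pi>D \<in> Ar C" "Src C \<pi>D = D (Suc (Suc 0))" "Trg C \<pi>D = JD" "dD (Suc 0) = \<iota>D \<odot> \<pi>D"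
    using A B D SesD(3)[of \<iota>A "dA 0"] SesD(3)[of \<iota>B "dB 0"] SesD(3)[of \<iota>D "dD 0"]
    unfolding precut_def Hom_def by auto
  have ar: "\<iota>A \<in> Ar C" "\<iota>B \<in> Ar C" "\<iota>D \<in> Ar C" using SesD(1) kA(1) kB(1) kD(1) by auto
  obtain x y where xy: "(x, y) \<in> Ses C" "Src C x = JA" "Trg C x = JB"
    "Trg C y = JD" "\<iota>B \<odot> x = f (Suc 0) \<odot> \<iota>A" "\<iota>D \<odot> y = g (Suc 0) \<odot> \<iota>B"
    using ses_cx_kernels(2)[OF s _ A D kB(1)] kB(2) B unfolding precut_def by blast
  note txy = SesD[OF xy(1)]
  have c1: "x \<odot> \<pi>A = \<pi>B \<odot> f (Suc (Suc 0))"
  proof (rule Ses_mono[OF kB(1)])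
    have "\<iota>B \<odot> (x \<odot> \<pi>A) = (f (Suc 0) \<odot> \<iota>A) \<odot> \<pi>A"
      by (rule Comp_red) (use xy kA kB ar txy in auto)
    also have "\<dots> = f (Suc 0) \<odot> dA (Suc 0)" using kA ar t by simp
    also have "\<dots> = dB (Suc 0) \<odot> f (Suc (Suc 0))" by (rule t)
    also have "\<dots> = \<iota>B \<odot> (\<pi>B \<odot> f (Suc (Suc 0)))" using kB ar t by simp
    finally show "\<iota>B \<odot> (x \<odot> \<pi>A) = \<iota>B \<odot> (\<pi>B \<odot> f (Suc (Suc 0)))" .
  qed (use xy(1-4) kA(1-6) kB(1-6) ar txy t(2-7) in auto)
  have c2: "y \<odot> \<pi>B = \<pi>D \<odot> g (Suc (Suc 0))"
  proof (rule Ses_mono[OF kD(1)])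
    have "\<iota>D \<odot> (y \<odot> \<pi>B) = (g (Suc 0) \<odot> \<iota>B) \<odot> \<pi>B"
      by (rule Comp_red) (use xy kB kD ar txy in auto)
    also have "\<dots> = g (Suc 0) \<odot> dB (Suc 0)" using kB ar t by simp
    also have "\<dots> = dD (Suc 0) \<odot> g (Suc (Suc 0))" by (rule t)
    also have "\<dots> = \<iota>D \<odot> (\<pi>D \<odot> g (Suc (Suc 0)))" using kD ar t by simp
    finally show "\<iota>D \<odot> (y \<odot> \<pi>B) = \<iota>D \<odot> (\<pi>D \<odot> g (Suc (Suc 0)))" .
  qed (use xy(1-4) kD(1-6) kB(1-6) ar txy t(2-7) in auto)
  have "ses_cx (tail_obj JA A) (tail_ar \<pi>A dA) (tail_obj JB B) (tail_ar \<pi>B dB)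
      (tail_obj JD D) (tail_ar \<pi>D dD) (tail_ar x f) (tail_ar y g)"
    unfolding ses_cx_def
    by (rule all_natI) (use xy(1-4) c1 c2 t in simp_all)
  then show ?thesis using xy by blast
qed

text \<open>Induction on the degree from which \<open>B\<close> vanishes. \<open>dB 0\<close> is an
  admissible epi since both outer ones are, so \<open>B\<close> can be cut; its tail is again an
  extension of acyclic complexes and vanishes one degree earlier.\<close>

lemma acyclic_extension_aux:
  "ses_cx A dA B dB D dD f g \<Longrightarrow> acyclic_complex C A dA \<Longrightarrow> acyclic_complex C D dD \<Longrightarrow>
   chain_complex C B dB \<Longrightarrow> (\<forall>n\<ge>b. zero_object C (B n)) \<Longrightarrow> acyclic_complex C B dB"
proof (induction b arbitrary: A dA B dB D dD f g)
  case 0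
  then show ?case by (intro acyclic_zero) (auto dest: chain_complexD simp: Hom_def)
next
  case (Suc b)
  note ch = chain_complexD[OF Suc.prems(4)]
  obtain JA \<iota>A \<pi>A where A: "cut A dA JA \<iota>A \<pi>A" using acyclic_cut[OF Suc.prems(2)] by blast
  obtain JD \<iota>D \<pi>D where D: "cut D dD JD \<iota>D \<pi>D" using acyclic_cut[OF Suc.prems(3)] by blast
  have A': "precut A dA JA \<iota>A \<pi>A" and D': "precut D dD JD \<iota>D \<pi>D" using A D unfolding cut_def by auto
  have B0: "dB 0 \<in> Hom C (B (Suc 0)) (B 0)" using ch(2-4)[of 0] by (simp add: Hom_def)
  have "admissible_epi C (dB 0)" by (rule ses_cx_kernels(1)[OF Suc.prems(1) B0 A' D'])
  then obtain \<iota>B where iB: "(\<iota>B, dB 0) \<in> Ses C" unfolding admissible_epi_def by blast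
  note ti = SesD[OF iB]
  obtain \<pi>B where pB: "\<pi>B \<in> Ar C" "Src C \<pi>B = B (Suc (Suc 0))" "Trg C \<pi>B = Src C \<iota>B" "\<iota>B \<odot> \<pi>B = dB (Suc 0)"
    by (rule Ses_kernel_factor[OF iB, of "dB (Suc 0)"]) (use ch ti in auto)
  have B': "precut B dB (Src C \<iota>B) \<iota>B \<pi>B"
    unfolding precut_def using iB B0 pB by (simp add: Hom_def)
  obtain x y where xy: "ses_cx (tail_obj JA A) (tail_ar \<pi>A dA) (tail_obj (Src C \<iota>B) B) (tail_ar \<pi>B dB)
      (tail_obj JD D) (tail_ar \<pi>D dD) (tail_ar x f) (tail_ar y g)"
    using ses_cx_tail[OF Suc.prems(1) A' B' D'] by blast
  \<comment> \<open>In degree 0, which forces \<open>b = 0\<close>, the tail is a kernel inside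
    \<open>B (Suc 0)\<close>, and that object is then zero.\<close>
  have z: "zero_object C (tail_obj (Src C \<iota>B) B n)" if "n \<ge> b" for n
  proof (cases n)
    case 0
    then have "zero_object C (Trg C \<iota>B)" using Suc.prems(5) that ti ch by auto
    then show ?thesis using 0 zero_object_mono[OF iB] by simp
  qed (use that Suc.prems(5) in auto)
  have p2: "\<pi>B \<odot> dB (Suc (Suc 0)) = Zero C (B (Suc (Suc (Suc 0)))) (Src C \<iota>B)"
  proof (rule Ses_mono[OF iB])
    have "\<iota>B \<odot> (\<pi>B \<odot> dB (Suc (Suc 0))) = dB (Suc 0) \<odot> dB (Suc (Suc 0))"
      by (rule Comp_red) (use pB ti ch in auto)
    then show "\<iota>B \<odot> (\<pi>B \<odot> dB (Suc (Suc 0))) = \<iota>B \<odot> Zero C (B (Suc (Suc (Suc 0)))) (Src C \<iota>B)"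
      using ch ti by simp
  qed (use pB ch ti in auto)
  have "chain_complex C (tail_obj (Src C \<iota>B) B) (tail_ar \<pi>B dB)"
    unfolding chain_complex_def
  proof (intro conjI)
    show "\<exists>c. \<forall>n>c. zero_object C (tail_obj (Src C \<iota>B) B n)" using z by (intro exI[of _ b]) auto
    show "\<forall>n. tail_obj (Src C \<iota>B) B n \<in> Ob C" by (rule all_natI) (use ti ch in simp_all)
    show "\<forall>n. tail_ar \<pi>B dB n \<in> Hom C (tail_obj (Src C \<iota>B) B (Suc n)) (tail_obj (Src C \<iota>B) B n)"
      by (rule all_natI) (use pB ch in \<open>simp_all add: Hom_def\<close>)
    show "\<forall>n. tail_ar \<pi>B dB n \<odot> tail_ar \<pi>B dB (Suc n) =
        Zero C (tail_obj (Src C \<iota>B) B (Suc (Suc n))) (tail_obj (Src C \<iota>B) B n)"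
      by (rule all_natI) (use p2 ch in simp_all)
  qed
  then have "acyclic_complex C (tail_obj (Src C \<iota>B) B) (tail_ar \<pi>B dB)"
    using Suc.IH[OF xy] A D z unfolding cut_def by blast
  then have "cut B dB (Src C \<iota>B) \<iota>B \<pi>B" unfolding cut_def using B' by simp
  then show ?case using acyclic_uncut ch(6) by blast
qed

lemma acyclic_extension:
  assumes "ses_cx A dA B dB D dD f g" "acyclic_complex C A dA" "acyclic_complex C D dD"
    "chain_complex C B dB"
  shows "acyclic_complex C B dB"
proof -
  obtain b where "\<forall>n>b. zero_object C (B n)" using chain_complexD(6)[OF assms(4)] by blast
  then show ?thesis using acyclic_extension_aux[OF assms, of "Suc b"] by auto
qed

end

section \<open>Presented abelian groups\<close>

text \<open>The subgroup generated by \<open>R\<close>, without reference to a carrier, so that the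
  relators on all complexes can also be tested on combinations of complexes of length two.
  \<open>generate_free_Abelian_group\<close> links it to \<open>generate\<close>.\<close>

inductive_set zspan :: "'x::ab_group_add set \<Rightarrow> 'x set" for R where
  zspan_zero[intro, simp]: "0 \<in> zspan R"
| zspan_base: "x \<in> R \<Longrightarrow> x \<in> zspan R"
| zspan_diff: "x \<in> zspan R \<Longrightarrow> y \<in> zspan R \<Longrightarrow> x - y \<in> zspan R"

lemma zspan_minus: "x \<in> zspan R \<Longrightarrow> - x \<in> zspan R"
  using zspan_diff[of 0 R x] by simp

lemma zspan_minus_iff[simp]: "- x \<in> zspan R \<longleftrightarrow> x \<in> zspan R"
  using zspan_minus[of x R] zspan_minus[of "- x" R] by auto

lemma zspan_add: "x \<in> zspan R \<Longrightarrow> y \<in> zspan R \<Longrightarrow> x + y \<in> zspan R"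
  using zspan_diff[of x R "- y"] by simp

lemma zspan_sum: "(\<And>i. i \<in> I \<Longrightarrow> f i \<in> zspan R) \<Longrightarrow> sum f I \<in> zspan R"
  by (induction I rule: infinite_finite_induct) (auto intro: zspan_add)

lemma zspan_subset:
  assumes "R \<subseteq> zspan S" "x \<in> zspan R"
  shows "x \<in> zspan S"
  using assms(2) by induction (use assms(1) in \<open>auto intro: zspan_diff\<close>)

lemma zspan_mono: "R \<subseteq> S \<Longrightarrow> x \<in> zspan R \<Longrightarrow> x \<in> zspan S"
  by (rule zspan_subset) (auto intro: zspan_base)

lemma zspan_Un:
  assumes "x \<in> zspan (R \<union> S)"
  shows "\<exists>y\<in>zspan R. \<exists>z\<in>zspan S. x = y + z"
  using assms
proof induction
  case zspan_zero
  show ?case by (rule bexI[of _ 0], rule bexI[of _ 0]) auto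
next
  case (zspan_base x)
  then consider "x \<in> R" | "x \<in> S" by blast
  then show ?case
  proof cases
    case 1 then show ?thesis by (intro bexI[of _ x] bexI[of _ 0]) (auto intro: zspan.zspan_base)
  next
    case 2 then show ?thesis by (intro bexI[of _ 0] bexI[of _ x]) (auto intro: zspan.zspan_base)
  qed
next
  case (zspan_diff x y)
  then obtain a b c d where "a \<in> zspan R" "b \<in> zspan S" "x = a + b" "c \<in> zspan R" "d \<in> zspan S" "y = c + d"
    by blast
  then show ?case
    by (intro bexI[of _ "a - c"] bexI[of _ "b - d"]) (auto intro: zspan.zspan_diff)
qed

lemma frag_extend_zspan:
  assumes "\<And>r. r \<in> R \<Longrightarrow> frag_extend f r \<in> zspan S" "x \<in> zspan R"
  shows "frag_extend f x \<in> zspan S"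
  using assms(2) by induction (use assms(1) in \<open>auto simp: frag_extend_diff intro: zspan_diff\<close>)

lemma free_carrier_diff:
  "x \<in> carrier (free_Abelian_group S) \<Longrightarrow> y \<in> carrier (free_Abelian_group S) \<Longrightarrow>
    x - y \<in> carrier (free_Abelian_group S)"
  using keys_diff[of x y] by auto

lemma zspan_carrier:
  assumes "R \<subseteq> carrier (free_Abelian_group S)" "x \<in> zspan R"
  shows "x \<in> carrier (free_Abelian_group S)"
  using assms(2) by induction (use assms(1) free_carrier_diff in \<open>blast | simp\<close>)+

lemma generate_free_Abelian_group:
  assumes "R \<subseteq> carrier (free_Abelian_group S)"
  shows "generate (free_Abelian_group S) R = zspan R"
proof
  have c: "x \<in> carrier (free_Abelian_group S)" if "x \<in> generate (free_Abelian_group S) R" for x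
    using group.generate_in_carrier[OF group_free_Abelian_group assms that] .
  show "generate (free_Abelian_group S) R \<subseteq> zspan R"
  proof
    fix x assume "x \<in> generate (free_Abelian_group S) R"
    then show "x \<in> zspan R"
    proof induction
      case (inv h)
      then have "h \<in> carrier (free_Abelian_group S)" using assms by blast
      then have "inv\<^bsub>free_Abelian_group S\<^esub> h = - h" by (intro inv_free_Abelian_group) simp
      then show ?case using inv by (simp add: zspan_base)
    qed (auto intro: zspan_base zspan_add)
  qed
  show "zspan R \<subseteq> generate (free_Abelian_group S) R"
  proof
    fix x assume "x \<in> zspan R"
    then show "x \<in> generate (free_Abelian_group S) R"
    proof induction
      case zspan_zero
      show ?case using generate.one[of "free_Abelian_group S" R] by simp
    next
      case (zspan_diff x y)
      have "inv\<^bsub>free_Abelian_group S\<^esub> y \<in> generate (free_Abelian_group S) R"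
        using zspan_diff assms by (intro group.generate_m_inv_closed) auto
      then have "- y \<in> generate (free_Abelian_group S) R"
        using c[OF zspan_diff.IH(2)] by simp
      then have "x \<otimes>\<^bsub>free_Abelian_group S\<^esub> (- y) \<in> generate (free_Abelian_group S) R"
        using zspan_diff.IH(1) by (intro generate.eng)
      then show ?case by simp
    qed (rule generate.incl)
  qed
qed

lemma (in group) r_coset_eq_iff:
  assumes "subgroup H G" "x \<in> carrier G" "y \<in> carrier G"
  shows "H #> x = H #> y \<longleftrightarrow> x \<otimes> inv y \<in> H"
proof
  assume "H #> x = H #> y"
  then have "x \<in> H #> y" using rcos_self[OF assms(2,1)] by simp
  then show "x \<otimes> inv y \<in> H" using subgroup.rcos_module_imp[OF assms(1) is_group assms(3)] by simp
next
  assume "x \<otimes> inv y \<in> H"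
  then have "x \<in> H #> y" using subgroup.rcos_module_rev[OF assms(1) is_group assms(3,2)] by simp
  then show "H #> x = H #> y" using repr_independence[OF _ assms(3,1)] by simp
qed

context
  fixes S :: "'g set" and R :: "('g \<Rightarrow>\<^sub>0 int) set"
  assumes R: "R \<subseteq> carrier (free_Abelian_group S)"
begin

lemma subgroup_generate_free: "subgroup (generate (free_Abelian_group S) R) (free_Abelian_group S)"
  using R by (intro group.generate_is_subgroup) auto

lemma normal_generate_free: "generate (free_Abelian_group S) R \<lhd> free_Abelian_group S"
  using subgroup_generate_free abelian_free_Abelian_group comm_group.normal_iff_subgroup by blast

definition quot :: "('g \<Rightarrow>\<^sub>0 int) \<Rightarrow> ('g \<Rightarrow>\<^sub>0 int) set" where
  "quot x = generate (free_Abelian_group S) R #>\<^bsub>free_Abelian_group S\<^esub> x"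

lemma quot_frag_of: "quot (frag_of P) = presented_class S R P"
  unfolding quot_def presented_class_def ..

lemma comm_group_presented: "comm_group (presented_group S R)"
  unfolding presented_group_def
  using comm_group.abelian_FactGroup[OF abelian_free_Abelian_group subgroup_generate_free] .

lemma quot_hom: "quot \<in> hom (free_Abelian_group S) (presented_group S R)"
  unfolding presented_group_def quot_def using normal.r_coset_hom_Mod[OF normal_generate_free] by simp

lemma carrier_presented: "carrier (presented_group S R) = quot ` carrier (free_Abelian_group S)"
  unfolding presented_group_def quot_def by (rule carrier_FactGroup)

lemma quot_eq_iff:
  assumes "x \<in> carrier (free_Abelian_group S)" "y \<in> carrier (free_Abelian_group S)"
  shows "quot x = quot y \<longleftrightarrow> x - y \<in> zspan R"
proof -
  interpret group "free_Abelian_group S" by simp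
  show ?thesis
    using r_coset_eq_iff[OF subgroup_generate_free assms] assms generate_free_Abelian_group[OF R]
    by (simp add: quot_def)
qed

end

lemma hom_free_diff:
  assumes "group H" "h \<in> hom (free_Abelian_group S) H"
    "x \<in> carrier (free_Abelian_group S)" "y \<in> carrier (free_Abelian_group S)"
  shows "h (x - y) = h x \<otimes>\<^bsub>H\<^esub> inv\<^bsub>H\<^esub> (h y)"
proof -
  interpret group_hom "free_Abelian_group S" H h
    using assms by (simp add: group_hom_def group_hom_axioms_def)
  show ?thesis using hom_mult[of x "inv\<^bsub>free_Abelian_group S\<^esub> y"] hom_inv[of y] assms by simp
qed

lemma hom_free_eq:
  assumes "group H" "h \<in> hom (free_Abelian_group S) H" "k \<in> hom (free_Abelian_group S) H"
    "\<And>a. a \<in> S \<Longrightarrow> h (frag_of a) = k (frag_of a)" "x \<in> carrier (free_Abelian_group S)"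
  shows "h x = k x"
proof -
  have x: "Poly_Mapping.keys x \<subseteq> S" using assms(5) by simp
  have g: "group_hom (free_Abelian_group S) H h" "group_hom (free_Abelian_group S) H k"
    using assms by (auto simp: group_hom_def group_hom_axioms_def)
  show ?thesis
    using x
  proof (induction rule: free_Abelian_group_induct[consumes 1, case_names 1 2 3])
    case 1
    show ?case using group_hom.hom_one[OF g(1)] group_hom.hom_one[OF g(2)] by simp
  next
    case (2 x y)
    then show ?case
      using hom_free_diff[OF assms(1,2), of x y] hom_free_diff[OF assms(1,3), of x y] by simp
  qed (use assms(4) in auto)
qed

text \<open>Collapses the two successive quotients in \<open>K0_Omega\<close> into one presentation;
  \<open>K0_Omega_quot_eq_iff\<close> justifies this.\<close>

definition K0_Omega_relators :: "('o, 'a, 'm) excat_scheme \<Rightarrow> (('o, 'a) bcx \<Rightarrow>\<^sub>0 int) set" where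
  "K0_Omega_relators N = K0_relators (Bq N) \<union> {frag_of P | P. P \<in> Ob (Bq N) \<and> diagonal P}"

section \<open>Both groups as quotients of free abelian groups\<close>

context exact_category
begin

abbreviation "FG \<equiv> free_Abelian_group (Ob (Bq C))"
abbreviation "FA \<equiv> free_Abelian_group (K1N_generators C)"

lemma K0_relators_carrier: "K0_relators (Bq C) \<subseteq> carrier FG"
proof
  fix x assume "x \<in> K0_relators (Bq C)"
  then obtain i p where x: "x = frag_of (Src (Bq C) p) - frag_of (Src (Bq C) i) - frag_of (Trg (Bq C) p)"
    and ip: "(i, p) \<in> Ses (Bq C)" unfolding K0_relators_def by blast
  have "{Src (Bq C) p, Src (Bq C) i, Trg (Bq C) p} \<subseteq> Ob (Bq C)"
    using ip unfolding Bq_def by (auto simp: binary_chain_map_def Let_def)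
  then show "x \<in> carrier FG" unfolding x
    by (intro free_carrier_diff) (simp_all only: frag_of_in_free_Abelian_group insert_subset)
qed

definition K0_Omega_quot :: "(('o, 'a) bcx \<Rightarrow>\<^sub>0 int) \<Rightarrow> (('o, 'a) bcx \<Rightarrow>\<^sub>0 int) set set" where
  "K0_Omega_quot x = diagonal_subgroup C #>\<^bsub>K0 (Bq C)\<^esub> quot (Ob (Bq C)) (K0_relators (Bq C)) x"

lemma diagonal_subgroup_eq:
  "diagonal_subgroup C = quot (Ob (Bq C)) (K0_relators (Bq C)) ` zspan {frag_of P | P. P \<in> Ob (Bq C) \<and> diagonal P}"
proof -
  let ?q = "quot (Ob (Bq C)) (K0_relators (Bq C))"
  let ?T = "{frag_of P | P. P \<in> Ob (Bq C) \<and> diagonal P}"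
  interpret group_hom FG "K0 (Bq C)" ?q
    unfolding K0_def
    using quot_hom[OF K0_relators_carrier] comm_group_presented[OF K0_relators_carrier]
    by (simp add: group_hom_def group_hom_axioms_def comm_group.axioms(2))
  have "?T \<subseteq> carrier FG" by auto
  moreover have "?q ` ?T = {K0_class (Bq C) P | P. P \<in> Ob (Bq C) \<and> diagonal P}"
    unfolding K0_class_def quot_frag_of[OF K0_relators_carrier, symmetric] by blast
  ultimately show ?thesis
    unfolding diagonal_subgroup_def
    using generate_img[of ?T] generate_free_Abelian_group[of ?T "Ob (Bq C)"] by simp
qed

lemma comm_group_K0: "comm_group (K0 (Bq C))"
  unfolding K0_def using comm_group_presented[OF K0_relators_carrier] .

lemma subgroup_diagonal: "subgroup (diagonal_subgroup C) (K0 (Bq C))"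
proof -
  interpret comm_group "K0 (Bq C)" by (rule comm_group_K0)
  have "{K0_class (Bq C) P | P. P \<in> Ob (Bq C) \<and> diagonal P} \<subseteq> carrier (K0 (Bq C))"
    unfolding K0_def carrier_presented[OF K0_relators_carrier] K0_class_def
      quot_frag_of[OF K0_relators_carrier, symmetric] by force
  then show ?thesis unfolding diagonal_subgroup_def by (rule generate_is_subgroup)
qed

lemma comm_group_K0_Omega: "comm_group (K0_Omega C)"
  unfolding K0_Omega_def
  by (rule comm_group.abelian_FactGroup[OF comm_group_K0 subgroup_diagonal])

lemma K0_Omega_quot_hom: "K0_Omega_quot \<in> hom FG (K0_Omega C)"
proof -
  have "diagonal_subgroup C \<lhd> K0 (Bq C)"
    using comm_group.normal_iff_subgroup[OF comm_group_K0] subgroup_diagonal by blast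
  from normal.r_coset_hom_Mod[OF this] quot_hom[OF K0_relators_carrier]
  have "(\<lambda>a. diagonal_subgroup C #>\<^bsub>K0 (Bq C)\<^esub> a) \<circ> quot (Ob (Bq C)) (K0_relators (Bq C)) \<in> hom FG (K0_Omega C)"
    unfolding K0_Omega_def K0_def by (auto intro: hom_compose)
  then show ?thesis unfolding comp_def K0_Omega_quot_def .
qed

lemma K0_Omega_quot_frag_of: "K0_Omega_quot (frag_of P) = K0_Omega_class C P"
  unfolding K0_Omega_quot_def K0_Omega_class_def K0_class_def quot_frag_of[OF K0_relators_carrier] ..

lemma carrier_K0_Omega: "carrier (K0_Omega C) = K0_Omega_quot ` carrier FG"
  unfolding K0_Omega_def carrier_FactGroup
  unfolding K0_def carrier_presented[OF K0_relators_carrier]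
  by (simp only: image_image K0_Omega_quot_def[abs_def] K0_def)

text \<open>Third isomorphism theorem: vanishing in the iterated quotient means being a sum of a
  combination of \<open>K0\<close> relators and one of diagonal complexes, and
  \<open>zspan_Un\<close> splits combinations accordingly.\<close>

lemma K0_Omega_quot_eq_iff:
  assumes x: "x \<in> carrier FG" "y \<in> carrier FG"
  shows "K0_Omega_quot x = K0_Omega_quot y \<longleftrightarrow> x - y \<in> zspan (K0_Omega_relators C)"
proof -
  let ?q = "quot (Ob (Bq C)) (K0_relators (Bq C))"
  let ?T = "{frag_of P | P. P \<in> Ob (Bq C) \<and> diagonal P}"
  interpret comm_group "K0 (Bq C)" by (rule comm_group_K0)
  have h: "?q \<in> hom FG (K0 (Bq C))" unfolding K0_def by (rule quot_hom[OF K0_relators_carrier])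
  have q: "?q x \<in> carrier (K0 (Bq C))" "?q y \<in> carrier (K0 (Bq C))"
    using hom_in_carrier[OF h] x by auto
  have T: "z \<in> carrier FG" if "z \<in> zspan ?T" for z
    by (rule zspan_carrier[OF _ that]) auto
  have "K0_Omega_quot x = K0_Omega_quot y \<longleftrightarrow> ?q (x - y) \<in> diagonal_subgroup C"
    unfolding K0_Omega_quot_def
    using r_coset_eq_iff[OF subgroup_diagonal q] hom_free_diff[OF is_group h x] by simp
  also have "\<dots> \<longleftrightarrow> (\<exists>t\<in>zspan ?T. (x - y) - t \<in> zspan (K0_relators (Bq C)))"
  proof -
    have "x - y \<in> carrier FG" using x by (rule free_carrier_diff)
    then show ?thesis
      unfolding diagonal_subgroup_eq image_iff
      using quot_eq_iff[OF K0_relators_carrier] T by blast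
  qed
  also have "\<dots> \<longleftrightarrow> x - y \<in> zspan (K0_Omega_relators C)"
  proof
    assume "\<exists>t\<in>zspan ?T. (x - y) - t \<in> zspan (K0_relators (Bq C))"
    then obtain t where t: "t \<in> zspan ?T" "(x - y) - t \<in> zspan (K0_relators (Bq C))" by blast
    then have "((x - y) - t) + t \<in> zspan (K0_Omega_relators C)"
      unfolding K0_Omega_relators_def by (intro zspan_add) (auto intro: zspan_mono[rotated])
    then show "x - y \<in> zspan (K0_Omega_relators C)" by simp
  next
    assume "x - y \<in> zspan (K0_Omega_relators C)"
    then obtain a b where "a \<in> zspan (K0_relators (Bq C))" "b \<in> zspan ?T" "x - y = a + b"
      unfolding K0_Omega_relators_def using zspan_Un by blast
    then show "\<exists>t\<in>zspan ?T. (x - y) - t \<in> zspan (K0_relators (Bq C))"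
      by (intro bexI[of _ b]) auto
  qed
  finally show ?thesis .
qed

lemma generators_subset: "K1N_generators C \<subseteq> Ob (Bq C)"
  unfolding K1N_generators_def Bq_def by auto

lemma FA_FG: "x \<in> carrier FA \<Longrightarrow> x \<in> carrier FG"
  using generators_subset by auto

lemma K0_Omega_quot_hom_FA: "K0_Omega_quot \<in> hom FA (K0_Omega C)"
proof (rule homI)
  fix x y assume "x \<in> carrier FA" "y \<in> carrier FA"
  then show "K0_Omega_quot (x \<otimes>\<^bsub>FA\<^esub> y) = K0_Omega_quot x \<otimes>\<^bsub>K0_Omega C\<^esub> K0_Omega_quot y"
    using hom_mult[OF K0_Omega_quot_hom, of x y] FA_FG by simp
qed (use FA_FG hom_in_carrier[OF K0_Omega_quot_hom] in blast)

text \<open>Reduces the theorem to integer combinations of complexes. All natural homomorphisms are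
  handled at once, since \<open>phq\<close> computes each of them from its values on
  generators.\<close>

proposition natural_hom_isomorphism:
  assumes R: "K1N_relators C \<subseteq> carrier FA"
    and well: "K1N_relators C \<subseteq> zspan (K0_Omega_relators C)"
    and inj: "\<And>x. x \<in> carrier FA \<Longrightarrow> x \<in> zspan (K0_Omega_relators C) \<Longrightarrow> x \<in> zspan (K1N_relators C)"
    and surj: "\<And>P. binary_acyclic C P \<Longrightarrow> \<exists>x\<in>carrier FA. frag_of P - x \<in> zspan (K0_Omega_relators C)"
  shows "(\<exists>\<Phi>. natural_hom C \<Phi>) \<and> (\<forall>\<Phi>. natural_hom C \<Phi> \<longrightarrow> \<Phi> \<in> iso (K1N C) (K0_Omega C))"
proof (intro conjI allI impI)
  let ?q = "quot (K1N_generators C) (K1N_relators C)"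
  interpret G: comm_group "K0_Omega C" by (rule comm_group_K0_Omega)
  have cl: "?q (frag_of P) = K1N_class C P" for P
    unfolding K1N_class_def quot_frag_of[OF R] ..
  have carr: "carrier (K1N C) = ?q ` carrier FA" unfolding K1N_def by (rule carrier_presented[OF R])
  have qh: "?q \<in> hom FA (K1N C)" unfolding K1N_def by (rule quot_hom[OF R])
  obtain g where g: "g \<in> hom (K1N C) (K0_Omega C)" "\<And>x. x \<in> carrier FA \<Longrightarrow> g (?q x) = K0_Omega_quot x"
  proof (rule FactGroup_universal[OF K0_Omega_quot_hom_FA normal_generate_free[OF R]])
    fix x y assume xy: "x \<in> carrier FA" "y \<in> carrier FA"
      "generate FA (K1N_relators C) #>\<^bsub>FA\<^esub> x = generate FA (K1N_relators C) #>\<^bsub>FA\<^esub> y"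
    then have "x - y \<in> zspan (K1N_relators C)" using quot_eq_iff[OF R xy(1,2)] by (simp add: quot_def[OF R])
    then have "x - y \<in> zspan (K0_Omega_relators C)" using zspan_subset[OF well] by blast
    then show "K0_Omega_quot x = K0_Omega_quot y" using K0_Omega_quot_eq_iff[OF FA_FG FA_FG] xy by blast
  qed (use that in \<open>simp add: K1N_def presented_group_def quot_def[OF R]\<close>)
  have "natural_hom C g"
    unfolding natural_hom_def
  proof (intro conjI ballI)
    fix P assume P: "P \<in> K1N_generators C"
    have "frag_of P \<in> carrier FA" using P by simp
    then show "g (K1N_class C P) = K0_Omega_class C P"
      using g(2)[of "frag_of P"] K0_Omega_quot_frag_of[of P] by (simp add: cl)
  qed (rule g(1))
  then show "\<exists>\<Phi>. natural_hom C \<Phi>" by blast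
  fix \<Phi> assume \<Phi>: "natural_hom C \<Phi>"
  have ph: "\<Phi> \<in> hom (K1N C) (K0_Omega C)" using \<Phi> unfolding natural_hom_def by simp
  have phq: "\<Phi> (?q x) = K0_Omega_quot x" if "x \<in> carrier FA" for x
  proof -
    have "(\<Phi> \<circ> ?q) x = K0_Omega_quot x"
    proof (rule hom_free_eq[OF G.is_group hom_compose[OF qh ph] K0_Omega_quot_hom_FA _ that])
      fix P assume "P \<in> K1N_generators C"
      then show "(\<Phi> \<circ> ?q) (frag_of P) = K0_Omega_quot (frag_of P)"
        using \<Phi> unfolding natural_hom_def by (simp add: cl K0_Omega_quot_frag_of)
    qed
    then show ?thesis by simp
  qed
  have "inj_on \<Phi> (carrier (K1N C))"
  proof (rule inj_onI)
    fix u v assume "u \<in> carrier (K1N C)" "v \<in> carrier (K1N C)" and e: "\<Phi> u = \<Phi> v"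
    then obtain x y where xy: "x \<in> carrier FA" "y \<in> carrier FA" "u = ?q x" "v = ?q y"
      unfolding carr by blast
    then have "K0_Omega_quot x = K0_Omega_quot y" using e phq by simp
    then have "x - y \<in> zspan (K0_Omega_relators C)"
      using K0_Omega_quot_eq_iff[OF FA_FG FA_FG] xy by blast
    moreover have "x - y \<in> carrier FA" using xy by (intro free_carrier_diff)
    ultimately have "x - y \<in> zspan (K1N_relators C)" by (rule inj[rotated])
    then show "u = v" using quot_eq_iff[OF R xy(1,2)] xy by simp
  qed
  moreover have "\<Phi> ` carrier (K1N C) = carrier (K0_Omega C)"
  proof
    show "\<Phi> ` carrier (K1N C) \<subseteq> carrier (K0_Omega C)" using hom_carrier[OF ph] .
    show "carrier (K0_Omega C) \<subseteq> \<Phi> ` carrier (K1N C)"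
    proof
      fix z assume "z \<in> carrier (K0_Omega C)"
      then obtain x where x: "x \<in> carrier FG" "z = K0_Omega_quot x" unfolding carrier_K0_Omega by blast
      have "Poly_Mapping.keys x \<subseteq> Ob (Bq C)" using x by simp
      then have "\<exists>y\<in>carrier FA. x - y \<in> zspan (K0_Omega_relators C)"
      proof (induction rule: free_Abelian_group_induct[consumes 1, case_names 1 2 3])
        case 1 show ?case by (intro bexI[of _ 0]) auto
      next
        case (2 a b)
        then obtain c d where cd: "c \<in> carrier FA" "d \<in> carrier FA"
          "a - c \<in> zspan (K0_Omega_relators C)" "b - d \<in> zspan (K0_Omega_relators C)" by blast
        have "(a - c) - (b - d) \<in> zspan (K0_Omega_relators C)" using zspan_diff cd by blast
        moreover have "c - d \<in> carrier FA" using cd by (intro free_carrier_diff)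
        ultimately show ?case by (intro bexI[of _ "c - d"]) (simp_all add: algebra_simps)
      next
        case (3 P)
        then show ?case using surj by (simp add: Bq_def)
      qed
      then obtain y where y: "y \<in> carrier FA" "x - y \<in> zspan (K0_Omega_relators C)" by blast
      then have "z = K0_Omega_quot y" using x K0_Omega_quot_eq_iff[OF x(1) FA_FG] by blast
      then have "z = \<Phi> (?q y)" using phq y by simp
      then show "z \<in> \<Phi> ` carrier (K1N C)" unfolding carr using y by blast
    qed
  qed
  ultimately show "\<Phi> \<in> iso (K1N C) (K0_Omega C)"
    using ph unfolding iso_def bij_betw_def by simp
qed

end

section \<open>Binary acyclic complexes and Nenashev relations\<close>

definition pick3 :: "'x \<Rightarrow> 'x \<Rightarrow> 'x \<Rightarrow> 'x \<Rightarrow> nat \<Rightarrow> 'x" where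
  "pick3 a b c d = case_nat a (case_nat b (case_nat c (\<lambda>_. d)))"

lemma pick3_simps[simp]:
  "pick3 a b c d 0 = a" "pick3 a b c d (Suc 0) = b" "pick3 a b c d (Suc (Suc 0)) = c"
  "pick3 a b c d (Suc (Suc (Suc n))) = d"
  by (simp_all add: pick3_def)

lemma all_nat3I: "P 0 \<Longrightarrow> P (Suc 0) \<Longrightarrow> P (Suc (Suc 0)) \<Longrightarrow> (\<And>n. P (Suc (Suc (Suc n)))) \<Longrightarrow> P n"
  by (metis not0_implies_Suc)

lemma sum_atMost_2: "(\<Sum>k\<le>(2::nat). f k) = f 0 + f (Suc 0) + (f (Suc (Suc 0)) :: 'x::comm_monoid_add)"
  by (simp add: numeral_2_eq_2 add.assoc)

context exact_category
begin

definition len :: "nat \<Rightarrow> ('o, 'a) bcx \<Rightarrow> bool" where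
  "len b P \<longleftrightarrow> (\<forall>n>b. zero_object C (obj P n))"

lemma len_mono: "len b P \<Longrightarrow> b \<le> c \<Longrightarrow> len c P"
  unfolding len_def by auto

lemma length_two_len: "length_two C P \<longleftrightarrow> len 2 P"
  unfolding length_two_def len_def ..

lemma binary_acyclicD:
  assumes "binary_acyclic C P"
  shows "acyclic_complex C (obj P) (top_diff P)" "acyclic_complex C (obj P) (bot_diff P)"
    "chain_complex C (obj P) (top_diff P)" "chain_complex C (obj P) (bot_diff P)"
  using assms acyclicD unfolding binary_acyclic_def by auto

lemma binary_acyclic_len: "binary_acyclic C P \<Longrightarrow> \<exists>b. len b P"
  using chain_complexD(6)[OF binary_acyclicD(3)] unfolding len_def .

text \<open>Above degree 2 the objects are literally the chosen zero object. An arbitrary complex of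
  length two is therefore only isomorphic to its \<open>cx3\<close>, for which
  \<open>nenashev_cx3\<close> compensates.\<close>

definition cx3 :: "'o \<Rightarrow> 'o \<Rightarrow> 'o \<Rightarrow> 'a \<Rightarrow> 'a \<Rightarrow> 'a \<Rightarrow> 'a \<Rightarrow> ('o, 'a) bcx" where
  "cx3 X0 X1 X2 f0 f1 g0 g1 = \<lparr>obj = pick3 X0 X1 X2 Z0,
     top_diff = pick3 f0 f1 (Zero C Z0 X2) (Zero C Z0 Z0),
     bot_diff = pick3 g0 g1 (Zero C Z0 X2) (Zero C Z0 Z0)\<rparr>"

lemma cx3_simps[simp]:
  "obj (cx3 X0 X1 X2 f0 f1 g0 g1) = pick3 X0 X1 X2 Z0"
  "top_diff (cx3 X0 X1 X2 f0 f1 g0 g1) = pick3 f0 f1 (Zero C Z0 X2) (Zero C Z0 Z0)"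
  "bot_diff (cx3 X0 X1 X2 f0 f1 g0 g1) = pick3 g0 g1 (Zero C Z0 X2) (Zero C Z0 Z0)"
  by (simp_all add: cx3_def)

lemma len_cx3[simp]: "2 \<le> b \<Longrightarrow> len b (cx3 X0 X1 X2 f0 f1 g0 g1)"
  unfolding len_def
proof (intro allI impI)
  fix n assume "2 \<le> b" "b < n"
  then obtain m where "n = Suc (Suc (Suc m))" by (metis less_iff_Suc_add add_2_eq_Suc add_Suc le_Suc_ex)
  then show "zero_object C (obj (cx3 X0 X1 X2 f0 f1 g0 g1) n)" by simp
qed

text \<open>Two cuts suffice: the first leaves the identity of \<open>X2\<close>, the second leaves
  only zero objects.\<close>

lemma acyclic_pick3:
  assumes s: "(f1, f0) \<in> Ses C" and t: "Src C f1 = X2" "Trg C f1 = X1" "Trg C f0 = X0"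
  shows "acyclic_complex C (pick3 X0 X1 X2 Z0) (pick3 f0 f1 (Zero C Z0 X2) (Zero C Z0 Z0))"
    (is "acyclic_complex C ?P ?d")
proof -
  note ts = SesD[OF s]
  have X: "X2 \<in> Ob C" using t ts by auto
  have bnd: "\<exists>b. \<forall>n>b. zero_object C (?P n)"
  proof (intro exI[of _ 2] allI impI)
    fix n :: nat assume "2 < n"
    then obtain m where "n = Suc (Suc (Suc m))" by (metis less_iff_Suc_add add_2_eq_Suc add_Suc)
    then show "zero_object C (?P n)" by simp
  qed
  have "cut (tail_obj X2 ?P) (tail_ar (Ident C X2) ?d) Z0 (Zero C Z0 X2) (Zero C Z0 Z0)"
    unfolding cut_def precut_def
  proof (intro conjI)
    show "acyclic_complex C (tail_obj Z0 (tail_obj X2 ?P)) (tail_ar (Zero C Z0 Z0) (tail_ar (Ident C X2) ?d))"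
    proof (rule acyclic_zero)
      fix n show "zero_object C (tail_obj Z0 (tail_obj X2 ?P) n)" by (cases n) auto
      show "tail_ar (Zero C Z0 Z0) (tail_ar (Ident C X2) ?d) n
          \<in> Hom C (tail_obj Z0 (tail_obj X2 ?P) (Suc n)) (tail_obj Z0 (tail_obj X2 ?P) n)"
        by (cases n) (auto simp: Hom_def)
    qed
  qed (use X Ses_iso_epi[of "Ident C X2"] in \<open>simp_all add: Hom_def\<close>)
  then have "acyclic_complex C (tail_obj X2 ?P) (tail_ar (Ident C X2) ?d)"
  proof (rule acyclic_uncut)
    obtain b where "\<forall>n>b. zero_object C (?P n)" using bnd by blast
    then have "zero_object C (tail_obj X2 ?P n)" if "n > Suc b" for n using that by (cases n) auto
    then show "\<exists>b. \<forall>n>b. zero_object C (tail_obj X2 ?P n)" by blast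
  qed
  then have "cut ?P ?d X2 f1 (Ident C X2)"
    unfolding cut_def precut_def using s t ts X by (simp add: Hom_def)
  then show ?thesis using acyclic_uncut bnd by blast
qed

lemma binary_acyclic_cx3:
  assumes "(f1, f0) \<in> Ses C" "Src C f1 = X2" "Trg C f1 = X1" "Trg C f0 = X0"
    "(g1, g0) \<in> Ses C" "Src C g1 = X2" "Trg C g1 = X1" "Trg C g0 = X0"
  shows "binary_acyclic C (cx3 X0 X1 X2 f0 f1 g0 g1)"
  unfolding binary_acyclic_def cx3_simps using acyclic_pick3 assms by blast

definition ZC :: "('o, 'a) bcx" where
  "ZC = \<lparr>obj = \<lambda>_. Z0, top_diff = \<lambda>_. Zero C Z0 Z0, bot_diff = \<lambda>_. Zero C Z0 Z0\<rparr>"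

lemma ZC_simps[simp]: "obj ZC n = Z0" "top_diff ZC n = Zero C Z0 Z0" "bot_diff ZC n = Zero C Z0 Z0"
  by (simp_all add: ZC_def)

lemma binary_acyclic_zero:
  assumes "\<And>n. zero_object C (obj P n)" "\<And>n. top_diff P n \<in> Hom C (obj P (Suc n)) (obj P n)"
    "\<And>n. bot_diff P n \<in> Hom C (obj P (Suc n)) (obj P n)"
  shows "binary_acyclic C P"
  unfolding binary_acyclic_def using acyclic_zero assms by auto

lemma ZC[simp]: "binary_acyclic C ZC" "diagonal ZC" "len b ZC"
  by (auto intro!: binary_acyclic_zero simp: Hom_def diagonal_def len_def ZC_def)

text \<open>A binary double complex with the rows \<open>D\<close>, \<open>B\<close>,
  \<open>A\<close> in vertical degrees 0, 1, 2. The vertical arrows for top and bottom may differ;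
  if they coincide (\<open>bses\<close>), it is a conflation in \<open>Bq C\<close>.\<close>

definition dses :: "('o, 'a) bcx \<Rightarrow> ('o, 'a) bcx \<Rightarrow> ('o, 'a) bcx \<Rightarrow>
    (nat \<Rightarrow> 'a) \<Rightarrow> (nat \<Rightarrow> 'a) \<Rightarrow> (nat \<Rightarrow> 'a) \<Rightarrow> (nat \<Rightarrow> 'a) \<Rightarrow> bool" where
  "dses A B D f g f' g' \<longleftrightarrow> binary_acyclic C A \<and> binary_acyclic C B \<and> binary_acyclic C D \<and>
     ses_cx (obj A) (top_diff A) (obj B) (top_diff B) (obj D) (top_diff D) f g \<and>
     ses_cx (obj A) (bot_diff A) (obj B) (bot_diff B) (obj D) (bot_diff D) f' g'"

abbreviation "bses A B D f g \<equiv> dses A B D f g f g"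

definition dcol :: "('o, 'a) bcx \<Rightarrow> ('o, 'a) bcx \<Rightarrow> ('o, 'a) bcx \<Rightarrow>
    (nat \<Rightarrow> 'a) \<Rightarrow> (nat \<Rightarrow> 'a) \<Rightarrow> (nat \<Rightarrow> 'a) \<Rightarrow> (nat \<Rightarrow> 'a) \<Rightarrow> nat \<Rightarrow> ('o, 'a) bcx" where
  "dcol A B D f g f' g' k = cx3 (obj D k) (obj B k) (obj A k) (g k) (f k) (g' k) (f' k)"

lemma binary_acyclic_dcol:
  assumes "dses A B D f g f' g'"
  shows "binary_acyclic C (dcol A B D f g f' g' k)"
  unfolding dcol_def using assms unfolding dses_def ses_cx_def
  by (intro binary_acyclic_cx3) auto

definition dbl :: "('o, 'a) bcx \<Rightarrow> ('o, 'a) bcx \<Rightarrow> ('o, 'a) bcx \<Rightarrow>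
    (nat \<Rightarrow> 'a) \<Rightarrow> (nat \<Rightarrow> 'a) \<Rightarrow> (nat \<Rightarrow> 'a) \<Rightarrow> (nat \<Rightarrow> 'a) \<Rightarrow> ('o, 'a) bdcx" where
  "dbl A B D f g f' g' = \<lparr>dobj = \<lambda>k. pick3 (obj D k) (obj B k) (obj A k) Z0,
     horiz = \<lambda>k. pick3 (top_diff D k) (top_diff B k) (top_diff A k) (Zero C Z0 Z0),
     horiz' = \<lambda>k. pick3 (bot_diff D k) (bot_diff B k) (bot_diff A k) (Zero C Z0 Z0),
     vert = \<lambda>k. pick3 (g k) (f k) (Zero C Z0 (obj A k)) (Zero C Z0 Z0),
     vert' = \<lambda>k. pick3 (g' k) (f' k) (Zero C Z0 (obj A k)) (Zero C Z0 Z0)\<rparr>"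

lemma row_dbl:
  "row (dbl A B D f g f' g') 0 = D" "row (dbl A B D f g f' g') (Suc 0) = B"
  "row (dbl A B D f g f' g') (Suc (Suc 0)) = A" "row (dbl A B D f g f' g') (Suc (Suc (Suc l))) = ZC"
  by (simp_all add: row_def dbl_def ZC_def)

lemma col_dbl: "col (dbl A B D f g f' g') k = dcol A B D f g f' g' k"
  by (simp add: col_def dbl_def dcol_def cx3_def)

lemma binary_acyclic_double_dbl:
  assumes d: "dses A B D f g f' g'"
  shows "binary_acyclic_double C (dbl A B D f g f' g')"
proof -
  have ba: "binary_acyclic C A" "binary_acyclic C B" "binary_acyclic C D"
    and s: "ses_cx (obj A) (top_diff A) (obj B) (top_diff B) (obj D) (top_diff D) f g"
    and s': "ses_cx (obj A) (bot_diff A) (obj B) (bot_diff B) (obj D) (bot_diff D) f' g'"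
    using d unfolding dses_def by auto
  obtain a b c where l: "len a A" "len b B" "len c D" using ba binary_acyclic_len by meson
  define m where "m = a + b + c + 2"
  have z: "zero_object C (dobj (dbl A B D f g f' g') k l)" if kl: "k > m \<or> l > m" for k l
  proof (cases "l > 2")
    case True
    then obtain j where "l = Suc (Suc (Suc j))" by (metis less_iff_Suc_add add_2_eq_Suc add_Suc)
    then show ?thesis by (simp add: dbl_def)
  next
    case False
    then have "k > m" using kl by (auto simp: m_def)
    then have "zero_object C (obj A k)" "zero_object C (obj B k)" "zero_object C (obj D k)"
      using l unfolding len_def m_def by auto
    then show ?thesis by (simp add: dbl_def pick3_def split: nat.split)
  qed
  note cA = chain_complexD[OF binary_acyclicD(3)[OF ba(1)]] chain_complexD[OF binary_acyclicD(4)[OF ba(1)]]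
  have c: "horiz (dbl A B D f g f' g') k l \<odot> vert (dbl A B D f g f' g') (Suc k) l =
      vert (dbl A B D f g f' g') k l \<odot> horiz (dbl A B D f g f' g') k (Suc l)" for k l
    by (rule all_nat3I[of _ l]) (use ses_cxD[OF s] cA in \<open>simp_all add: dbl_def\<close>)
  have c': "horiz' (dbl A B D f g f' g') k l \<odot> vert' (dbl A B D f g f' g') (Suc k) l =
      vert' (dbl A B D f g f' g') k l \<odot> horiz' (dbl A B D f g f' g') k (Suc l)" for k l
    by (rule all_nat3I[of _ l]) (use ses_cxD[OF s'] cA in \<open>simp_all add: dbl_def\<close>)
  have r: "binary_acyclic C (row (dbl A B D f g f' g') l)" for l
    by (rule all_nat3I[of _ l]) (use ba in \<open>simp_all add: row_dbl\<close>)
  show ?thesis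
    unfolding binary_acyclic_double_def
    using z c c' r binary_acyclic_dcol[OF d] by (auto simp: col_dbl)
qed

definition dcols :: "nat \<Rightarrow> ('o, 'a) bcx \<Rightarrow> ('o, 'a) bcx \<Rightarrow> ('o, 'a) bcx \<Rightarrow>
    (nat \<Rightarrow> 'a) \<Rightarrow> (nat \<Rightarrow> 'a) \<Rightarrow> (nat \<Rightarrow> 'a) \<Rightarrow> (nat \<Rightarrow> 'a) \<Rightarrow> (('o, 'a) bcx \<Rightarrow>\<^sub>0 int)" where
  "dcols b A B D f g f' g' = (\<Sum>k\<le>b. frag_cmul ((-1) ^ k) (frag_of (dcol A B D f g f' g' k)))"

text \<open>Nenashev's two relations modulo \<open>R\<close>, for three rows and columns
  \<open>0\<close> to \<open>b\<close>. This holds for \<open>K1N_relators\<close> with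
  \<open>b = 2\<close> and for \<open>K0_Omega_relators\<close> with every \<open>b\<close> from 2
  on; the lower bound admits the columns, which have length two, among the complexes
  considered.\<close>

definition nenashev :: "(('o, 'a) bcx \<Rightarrow>\<^sub>0 int) set \<Rightarrow> nat \<Rightarrow> bool" where
  "nenashev R b \<longleftrightarrow> 2 \<le> b \<and> (\<forall>P. binary_acyclic C P \<longrightarrow> len b P \<longrightarrow> diagonal P \<longrightarrow> frag_of P \<in> zspan R) \<and>
     (\<forall>A B D f g f' g'. dses A B D f g f' g' \<longrightarrow> len b A \<longrightarrow> len b B \<longrightarrow> len b D \<longrightarrow>
        frag_of D - frag_of B + frag_of A - dcols b A B D f g f' g' \<in> zspan R)"

lemma nenashev_diag:
  "nenashev R b \<Longrightarrow> binary_acyclic C P \<Longrightarrow> len b P \<Longrightarrow> diagonal P \<Longrightarrow> frag_of P \<in> zspan R"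
  unfolding nenashev_def by blast

lemma nenashev_dses:
  "nenashev R b \<Longrightarrow> dses A B D f g f' g' \<Longrightarrow> len b A \<Longrightarrow> len b B \<Longrightarrow> len b D \<Longrightarrow>
    frag_of D - frag_of B + frag_of A - dcols b A B D f g f' g' \<in> zspan R"
  unfolding nenashev_def by blast

lemma nenashev_K1N: "nenashev (K1N_relators C) 2"
  unfolding nenashev_def
proof (intro conjI allI impI)
  fix P assume "binary_acyclic C P" "len 2 P" "diagonal P"
  then show "frag_of P \<in> zspan (K1N_relators C)"
    by (intro zspan_base) (auto simp: K1N_relators_def K1N_generators_def length_two_len)
next
  fix A B D f g f' g'
  assume d: "dses A B D f g f' g'" and l: "len 2 A" "len 2 B" "len 2 D"
  let ?D = "dbl A B D f g f' g'"
  have "double_length_two C ?D"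
    unfolding double_length_two_def
  proof (intro allI impI)
    fix k l :: nat assume kl: "k > 2 \<or> l > 2"
    show "zero_object C (dobj ?D k l)"
    proof (cases "l > 2")
      case True
      then obtain j where "l = Suc (Suc (Suc j))" by (metis less_iff_Suc_add add_2_eq_Suc add_Suc)
      then show ?thesis by (simp add: dbl_def)
    next
      case False
      then have "zero_object C (obj A k)" "zero_object C (obj B k)" "zero_object C (obj D k)"
        using kl l unfolding len_def by auto
      then show ?thesis by (simp add: dbl_def pick3_def split: nat.split)
    qed
  qed
  then have "(\<Sum>l\<le>2. frag_cmul ((-1) ^ l) (frag_of (row ?D l))) -
      (\<Sum>k\<le>2. frag_cmul ((-1) ^ k) (frag_of (col ?D k))) \<in> K1N_relators C"
    unfolding K1N_relators_def using binary_acyclic_double_dbl[OF d] by blast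
  moreover have "(\<Sum>l\<le>2. frag_cmul ((-1) ^ l) (frag_of (row ?D l))) = frag_of D - frag_of B + frag_of A"
    by (simp add: sum_atMost_2 row_dbl)
  ultimately show "frag_of D - frag_of B + frag_of A - dcols 2 A B D f g f' g' \<in> zspan (K1N_relators C)"
    by (intro zspan_base) (simp add: dcols_def col_dbl)
qed simp

lemma diagonal_dcol: "diagonal (dcol A B D f g f g k)"
  unfolding dcol_def diagonal_def by simp

lemma frag_cmul_zspan: "x \<in> zspan R \<Longrightarrow> frag_cmul c x \<in> zspan R"
proof (induction c rule: int_induct[of _ 0])
  case (step1 i) then show ?case by (simp add: frag_cmul_distrib zspan_add)
next
  case (step2 i) then show ?case by (simp add: frag_cmul_diff_distrib zspan_diff)
qed simp

text \<open>If the vertical arrows agree, all columns are diagonal and vanish; what remains of the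
  relation is additivity.\<close>

lemma nenashev_bses:
  assumes R: "nenashev R b" and s: "bses A B D f g" and l: "len b A" "len b B" "len b D"
  shows "frag_of B - frag_of A - frag_of D \<in> zspan R"
proof -
  have "2 \<le> b" using R unfolding nenashev_def by simp
  then have "dcols b A B D f g f g \<in> zspan R"
    unfolding dcols_def
    by (intro zspan_sum frag_cmul_zspan nenashev_diag[OF R] binary_acyclic_dcol[OF s] diagonal_dcol)
      (simp add: dcol_def)
  then have "- ((frag_of D - frag_of B + frag_of A - dcols b A B D f g f g) + dcols b A B D f g f g) \<in> zspan R"
    using nenashev_dses[OF R s l] by (simp only: zspan_minus_iff zspan_add)
  then show ?thesis by (simp add: algebra_simps)
qed

text \<open>\<alpha> and \<beta> may differ. Transporting top and bottom along different
  isomorphisms changes the class only by the columns built from the pairs \<open>\<alpha> n\<close>,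
  \<open>\<beta> n\<close>.\<close>

lemma dses_isoI:
  assumes "binary_acyclic C P" "binary_acyclic C Q"
    "\<And>n. isomorphism C (\<alpha> n)" "\<And>n. isomorphism C (\<beta> n)"
    "\<And>n. \<alpha> n \<in> Hom C (obj P n) (obj Q n)" "\<And>n. \<beta> n \<in> Hom C (obj P n) (obj Q n)"
    "\<And>n. \<alpha> n \<odot> top_diff P n = top_diff Q n \<odot> \<alpha> (Suc n)"
    "\<And>n. \<beta> n \<odot> bot_diff P n = bot_diff Q n \<odot> \<beta> (Suc n)"
  shows "dses ZC P Q (\<lambda>n. Zero C Z0 (obj P n)) \<alpha> (\<lambda>n. Zero C Z0 (obj P n)) \<beta>"
proof -
  note c = chain_complexD[OF binary_acyclicD(3)[OF assms(1)]] chain_complexD[OF binary_acyclicD(4)[OF assms(1)]]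
  have "(Zero C Z0 (obj P n), \<alpha> n) \<in> Ses C" "(Zero C Z0 (obj P n), \<beta> n) \<in> Ses C" for n
    using Ses_iso_epi[OF assms(3)[of n]] Ses_iso_epi[OF assms(4)[of n]] assms(5,6)[of n]
    by (simp_all add: Hom_def)
  then show ?thesis
    unfolding dses_def ses_cx_def using assms c by (simp add: Hom_def)
qed

lemma nenashev_iso:
  assumes R: "nenashev R b" and l: "len b P" "len b Q"
    and "binary_acyclic C P" "binary_acyclic C Q"
    "\<And>n. isomorphism C (\<alpha> n)" "\<And>n. \<alpha> n \<in> Hom C (obj P n) (obj Q n)"
    "\<And>n. \<alpha> n \<odot> top_diff P n = top_diff Q n \<odot> \<alpha> (Suc n)"
    "\<And>n. \<alpha> n \<odot> bot_diff P n = bot_diff Q n \<odot> \<alpha> (Suc n)"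
  shows "frag_of P - frag_of Q \<in> zspan R"
proof -
  have "bses ZC P Q (\<lambda>n. Zero C Z0 (obj P n)) \<alpha>" by (rule dses_isoI) (use assms in auto)
  then have "frag_of P - frag_of ZC - frag_of Q \<in> zspan R" by (rule nenashev_bses[OF R]) (use l in auto)
  then have "(frag_of P - frag_of ZC - frag_of Q) + frag_of ZC \<in> zspan R"
    by (rule zspan_add) (rule nenashev_diag[OF R]; simp)
  then show ?thesis by (simp add: algebra_simps)
qed

lemma K0_relator_bses:
  assumes "bses A B D f g"
  shows "frag_of B - frag_of A - frag_of D \<in> K0_relators (Bq C)"
proof -
  have ba: "binary_acyclic C A" "binary_acyclic C B" "binary_acyclic C D"
    and s: "ses_cx (obj A) (top_diff A) (obj B) (top_diff B) (obj D) (top_diff D) f g"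
    and s': "ses_cx (obj A) (bot_diff A) (obj B) (bot_diff B) (obj D) (bot_diff D) f g"
    using assms unfolding dses_def by auto
  let ?i = "\<lparr>map_src = A, map_trg = B, map_at = f\<rparr>" and ?p = "\<lparr>map_src = B, map_trg = D, map_at = g\<rparr>"
  have "(?i, ?p) \<in> Ses (Bq C)"
    unfolding Bq_def using ba ses_cxD[OF s] ses_cxD[OF s'] by (simp add: binary_chain_map_def Hom_def)
  then have "frag_of (Src (Bq C) ?p) - frag_of (Src (Bq C) ?i) - frag_of (Trg (Bq C) ?p) \<in> K0_relators (Bq C)"
    unfolding K0_relators_def by blast
  then show ?thesis by (simp add: Bq_def)
qed

lemma bses_of_Ses_Bq:
  assumes "(i, p) \<in> Ses (Bq C)"
  obtains A B D f g where "bses A B D f g" "Src (Bq C) i = A" "Src (Bq C) p = B" "Trg (Bq C) p = D"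
proof -
  have m: "binary_chain_map C i" "binary_chain_map C p" "map_trg i = map_src p"
    "\<And>n. (map_at i n, map_at p n) \<in> Ses C"
    using assms unfolding Bq_def by auto
  have "bses (map_src i) (map_src p) (map_trg p) (map_at i) (map_at p)"
    using m unfolding dses_def ses_cx_def binary_chain_map_def Let_def by (auto simp: Hom_def)
  then show ?thesis by (rule that) (simp_all add: Bq_def)
qed

lemma G_bses: "bses A B D f g \<Longrightarrow> frag_of B - frag_of A - frag_of D \<in> zspan (K0_Omega_relators C)"
  unfolding K0_Omega_relators_def by (rule zspan_base) (use K0_relator_bses in blast)

lemma G_diag: "binary_acyclic C P \<Longrightarrow> diagonal P \<Longrightarrow> frag_of P \<in> zspan (K0_Omega_relators C)"
  unfolding K0_Omega_relators_def by (rule zspan_base) (auto simp: Bq_def)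

section \<open>The shortening construction\<close>

definition Hobj :: "(nat \<Rightarrow> 'o) \<Rightarrow> 'o \<Rightarrow> nat \<Rightarrow> 'o" where
  "Hobj P X = case_nat (P 0 \<oplus>\<oplus> X) (case_nat (P (Suc 0) \<oplus>\<oplus> (P (Suc (Suc 0)) \<oplus>\<oplus> X))
     (case_nat (P (Suc (Suc (Suc 0))) \<oplus>\<oplus> X) (\<lambda>n. P (Suc (Suc (Suc (Suc n)))))))"

text \<open>One half of a shortening, where \<open>X\<close> stands for the sum of both kernels.
  \<open>u\<close> ends the upper piece in degree 0, \<open>i\<close> starts the lower piece in
  degree 2, and \<open>e\<close>, \<open>e'\<close> are the differentials of the contractible
  summands.\<close>

definition Hdiff :: "(nat \<Rightarrow> 'o) \<Rightarrow> 'o \<Rightarrow> 'a \<Rightarrow> (nat \<Rightarrow> 'a) \<Rightarrow> 'a \<Rightarrow> 'a \<Rightarrow> 'a \<Rightarrow> 'a \<Rightarrow> nat \<Rightarrow> 'a" where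
  "Hdiff P X d0 d u e i e' =
     case_nat (cp (pr d0 (Zero C (P (Suc 0)) X))
                (cp (pr (Zero C (P (Suc (Suc 0))) (P 0)) u) (pr (Zero C X (P 0)) e)))
     (case_nat (cp (pr (Zero C (P (Suc (Suc (Suc 0)))) (P (Suc 0)))
                      (pr (d (Suc (Suc 0))) (Zero C (P (Suc (Suc (Suc 0)))) X)))
                   (pr i (pr (Zero C X (P (Suc (Suc 0)))) e')))
     (case_nat (pr (d (Suc (Suc (Suc 0)))) (Zero C (P (Suc (Suc (Suc (Suc 0))))) X))
        (\<lambda>n. d (Suc (Suc (Suc (Suc n)))))))"

definition Hmap :: "(nat \<Rightarrow> 'a) \<Rightarrow> 'a \<Rightarrow> nat \<Rightarrow> 'a" where
  "Hmap f w = case_nat (dg (f 0) w) (case_nat (dg (f (Suc 0)) (dg (f (Suc (Suc 0))) w))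
     (case_nat (dg (f (Suc (Suc (Suc 0)))) w) (\<lambda>n. f (Suc (Suc (Suc (Suc n)))))))"

lemma H_simps[simp]:
  "Hobj P X 0 = P 0 \<oplus>\<oplus> X" "Hobj P X (Suc 0) = P (Suc 0) \<oplus>\<oplus> (P (Suc (Suc 0)) \<oplus>\<oplus> X)"
  "Hobj P X (Suc (Suc 0)) = P (Suc (Suc (Suc 0))) \<oplus>\<oplus> X"
  "Hobj P X (Suc (Suc (Suc n))) = P (Suc (Suc (Suc (Suc n))))"
  "Hdiff P X d0 d u e i e' 0 = cp (pr d0 (Zero C (P (Suc 0)) X))
                (cp (pr (Zero C (P (Suc (Suc 0))) (P 0)) u) (pr (Zero C X (P 0)) e))"
  "Hdiff P X d0 d u e i e' (Suc 0) = cp (pr (Zero C (P (Suc (Suc (Suc 0)))) (P (Suc 0)))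
                      (pr (d (Suc (Suc 0))) (Zero C (P (Suc (Suc (Suc 0)))) X)))
                   (pr i (pr (Zero C X (P (Suc (Suc 0)))) e'))"
  "Hdiff P X d0 d u e i e' (Suc (Suc 0)) = pr (d (Suc (Suc (Suc 0)))) (Zero C (P (Suc (Suc (Suc (Suc 0))))) X)"
  "Hdiff P X d0 d u e i e' (Suc (Suc (Suc n))) = d (Suc (Suc (Suc (Suc n))))"
  "Hmap f w 0 = dg (f 0) w" "Hmap f w (Suc 0) = dg (f (Suc 0)) (dg (f (Suc (Suc 0))) w)"
  "Hmap f w (Suc (Suc 0)) = dg (f (Suc (Suc (Suc 0)))) w"
  "Hmap f w (Suc (Suc (Suc n))) = f (Suc (Suc (Suc (Suc n))))"
  by (simp_all add: Hobj_def Hdiff_def Hmap_def)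

lemma biproductD:
  assumes "biproduct C A B S i j p q"
  shows "i \<in> Ar C" "Src C i = A" "Trg C i = S" "j \<in> Ar C" "Src C j = B" "Trg C j = S"
    "p \<in> Ar C" "Src C p = S" "Trg C p = A" "q \<in> Ar C" "Src C q = S" "Trg C q = B"
    "p \<odot> i = Ident C A" "q \<odot> j = Ident C B" "p \<odot> j = Zero C B A" "q \<odot> i = Zero C A B"
    "i \<odot> p \<boxplus> j \<odot> q = Ident C S" "j \<odot> q \<boxplus> i \<odot> p = Ident C S"
proof -
  show 1: "i \<in> Ar C" "Src C i = A" "Trg C i = S" "j \<in> Ar C" "Src C j = B" "Trg C j = S"
    "p \<in> Ar C" "Src C p = S" "Trg C p = A" "q \<in> Ar C" "Src C q = S" "Trg C q = B"
    "p \<odot> i = Ident C A" "q \<odot> j = Ident C B" "p \<odot> j = Zero C B A" "q \<odot> i = Zero C A B"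
    "i \<odot> p \<boxplus> j \<odot> q = Ident C S"
    using assms unfolding biproduct_def Hom_def by auto
  then show "j \<odot> q \<boxplus> i \<odot> p = Ident C S" using Plus_comm[of "j \<odot> q" "i \<odot> p"] by simp
qed

lemma acyclic_bounded: "acyclic_complex C P d \<Longrightarrow> \<exists>b. \<forall>n>b. zero_object C (P n)"
  using chain_complexD(6) acyclicD by blast

text \<open>\<open>A\<close> is the kernel belonging to this half, \<open>B\<close> the one from the
  other half. The biproduct is abstract so that the bottom can be treated with the summands of
  \<open>X\<close> interchanged, and \<open>s\<close> leaves room for the sign.\<close>

lemma acyclic_H:
  assumes bi: "biproduct C A B X iA iB pA pB"
    and s: "s \<in> Hom C A A" "s' \<in> Hom C A A" "s' \<odot> s = Ident C A" "s \<odot> s' = Ident C A"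
    and i: "(\<iota>, d0) \<in> Ses C" "Src C \<iota> = A" "Trg C \<iota> = P (Suc 0)" "Trg C d0 = P 0"
    and ac: "acyclic_complex C (tail_obj B P) (tail_ar \<rho> d)"
  shows "acyclic_complex C (Hobj P X) (Hdiff P X d0 d (iB \<odot> \<rho>) (iA \<odot> (s \<odot> pA)) (\<iota> \<odot> pA) (iB \<odot> pB))"
    (is "acyclic_complex C ?P ?d")
proof -
  note b = biproductD[OF bi]
  have s: "s \<in> Ar C" "s' \<in> Ar C" "Src C s = A" "Trg C s = A" "Src C s' = A" "Trg C s' = A"
    "s' \<odot> s = Ident C A" "s \<odot> s' = Ident C A" using s by (auto simp: Hom_def)
  note ti = SesD[OF i(1)]
  have O: "A \<in> Ob C" "B \<in> Ob C" "X \<in> Ob C" "P 0 \<in> Ob C" "P (Suc 0) \<in> Ob C"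
    using Src_Ob[OF b(1)] Src_Ob[OF b(4)] Trg_Ob[OF b(1)] Trg_Ob[OF ti(1)] Trg_Ob[OF ti(2)] b i by auto
  note c = chain_complexD[OF acyclicD[OF ac]]
  have ch: "P (Suc (Suc n)) \<in> Ob C" "d (Suc (Suc n)) \<in> Ar C"
    "Src C (d (Suc (Suc n))) = P (Suc (Suc (Suc n)))" "Trg C (d (Suc (Suc n))) = P (Suc (Suc n))" for n
    using c(1-4)[of "Suc n"] by auto
  have rho: "\<rho> \<in> Ar C" "Src C \<rho> = P (Suc (Suc 0))" "Trg C \<rho> = B" using c(2-4)[of 0] by auto
  obtain Z z \<zeta> where Z: "cut (tail_obj B P) (tail_ar \<rho> d) Z z \<zeta>" using acyclic_cut[OF ac] by blast
  then have z: "(z, \<rho>) \<in> Ses C" "Src C z = Z" "\<zeta> \<in> Ar C" "Src C \<zeta> = P (Suc (Suc (Suc 0)))" "Trg C \<zeta> = Z"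
     "d (Suc (Suc 0)) = z \<odot> \<zeta>"
    and acZ: "acyclic_complex C (tail_obj Z (tail_obj B P)) (tail_ar \<zeta> (tail_ar \<rho> d))"
    unfolding cut_def precut_def Hom_def by auto
  note tz = SesD[OF z(1)]
  obtain Y y \<eta> where Y: "cut (tail_obj Z (tail_obj B P)) (tail_ar \<zeta> (tail_ar \<rho> d)) Y y \<eta>"
    using acyclic_cut[OF acZ] by blast
  then have y: "(y, \<zeta>) \<in> Ses C" "Src C y = Y" "\<eta> \<in> Ar C" "Src C \<eta> = P (Suc (Suc (Suc (Suc 0))))" "Trg C \<eta> = Y"
     "d (Suc (Suc (Suc 0))) = y \<odot> \<eta>"
    and acY: "acyclic_complex C (tail_obj Y (tail_obj Z (tail_obj B P))) (tail_ar \<eta> (tail_ar \<zeta> (tail_ar \<rho> d)))"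
    unfolding cut_def precut_def Hom_def by auto
  note ty = SesD[OF y(1)]
  have OZ: "Z \<in> Ob C" "Y \<in> Ob C" using z(3,5) y(3,5) by auto
  \<comment> \<open>The kernel of the lowest differential: \<open>A\<close> in \<open>P 1\<close>,
    \<open>Z\<close> in \<open>P 2\<close> and the summand \<open>B\<close> of \<open>X\<close>. The
    images of \<open>P 2\<close> and \<open>X\<close> are \<open>B\<close> and \<open>A\<close>,
    which together fill the target copy of \<open>X\<close>.\<close>
  let ?J = "A \<oplus>\<oplus> (Z \<oplus>\<oplus> B)"
  let ?I = "dg \<iota> (dg z iB)"
  let ?p = "cp (pr (Zero C (P (Suc (Suc (Suc 0)))) A) (pr \<zeta> (Zero C (P (Suc (Suc (Suc 0)))) B)))
     (pr pA (pr (Zero C X Z) pB))"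
  have sB: "(iB, pA) \<in> Ses C" by (rule Ses_split[of iB pA iA pB]) (use b in auto)
  have ic: "isomorphism C (cp iB (iA \<odot> s))"
  proof (rule isomorphismI[of _ "pr pB (s' \<odot> pA)"])
    have 1: "pA \<odot> (iA \<odot> s) = s" "pB \<odot> (iA \<odot> s) = Zero C A B" "s' \<odot> (pA \<odot> iB) = Zero C B A"
      using Comp_red[of s iA pA] Comp_red[of s iA pB] b s O by auto
    have 2: "s \<odot> (s' \<odot> pA) = pA"
      using Comp_red[of pA s' s "Ident C A"] b s O by auto
    show "pr pB (s' \<odot> pA) \<odot> cp iB (iA \<odot> s) = Ident C (Src C (cp iB (iA \<odot> s)))"
      using b s O 1 by (simp add: Ident_dsum)
    show "cp iB (iA \<odot> s) \<odot> pr pB (s' \<odot> pA) = Ident C (Trg C (cp iB (iA \<odot> s)))"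
      using b s O 2 by simp
  qed (use b s in auto)
  obtain c' where c': "c' \<in> Ar C" "Src C c' = X" "Trg C c' = B \<oplus>\<oplus> A"
    "c' \<odot> cp iB (iA \<odot> s) = Ident C (B \<oplus>\<oplus> A)" "cp iB (iA \<odot> s) \<odot> c' = Ident C X"
    using isomorphismE[OF ic] b s by (metis Comp_Ar(1,2,3) cp_Ar(2,3))
  have ic2: "isomorphism C (dg (Ident C (P 0)) (cp iB (iA \<odot> s)))"
    by (rule isomorphismI[of _ "dg (Ident C (P 0)) c'"]) (use c' b s O in \<open>simp_all del: Comp_cp\<close>)
  have s0: "(?I, ?d 0) \<in> Ses C"
    by (rule Ses_closed_iso[OF Ses_dg[OF i(1) Ses_dg[OF z(1) sB]], of "Ident C ?J"
          "Ident C (P (Suc 0) \<oplus>\<oplus> (P (Suc (Suc 0)) \<oplus>\<oplus> X))" "dg (Ident C (P 0)) (cp iB (iA \<odot> s))"])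
      (use ic2 i ti z tz b s O OZ ch rho in \<open>simp_all add: Hom_def dg_def\<close>)
  have d1: "?d (Suc 0) = ?I \<odot> ?p"
    using i ti z tz b s O OZ ch rho by (simp add: dg_def)
  have iX: "isomorphism C (pr pA pB)"
    by (rule isomorphismI[of _ "cp iA iB"]) (use b O in \<open>auto simp: Ident_dsum\<close>)
  let ?T = "dg \<zeta> (pr pA pB)"
  have sT: "(dg y (Zero C Z0 X), ?T) \<in> Ses C"
    using Ses_dg[OF y(1) Ses_iso_epi[OF iX]] b by simp
  \<comment> \<open>Moves the summands \<open>Z\<close>, \<open>A\<close>, \<open>B\<close> into the
    order used in \<open>?J\<close>.\<close>
  let ?m = "cp (pr (Zero C Z A) (pr (Ident C Z) (Zero C Z B))) (dg (Ident C A) (pr (Zero C B Z) (Ident C B)))"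
  let ?m' = "cp (pr (Zero C A Z) (pr (Ident C A) (Zero C A B))) (dg (Ident C Z) (pr (Zero C B A) (Ident C B)))"
  have im: "isomorphism C ?m"
    by (rule isomorphismI[of _ ?m']) (use O OZ in \<open>simp_all add: dg_def Ident_dsum\<close>)
  have iY: "isomorphism C (cp (Ident C Y) (Zero C Z0 Y))"
    by (rule isomorphismI[of _ "pr (Ident C Y) (Zero C Y Z0)"]) (use OZ in \<open>auto simp: Ident_dsum\<close>)
  have s1: "(pr y (Zero C Y X), ?p) \<in> Ses C"
    by (rule Ses_closed_iso[OF sT, of "cp (Ident C Y) (Zero C Z0 Y)" "Ident C (P (Suc (Suc (Suc 0))) \<oplus>\<oplus> X)" ?m])
      (use im iY y ty z b O OZ ch in \<open>simp_all add: Hom_def dg_def\<close>)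
  have bnd: "\<exists>b. \<forall>n>b. zero_object C (?P n)"
  proof -
    obtain b where b: "\<forall>n>b. zero_object C (tail_obj B P n)" using c(6) by blast
    have "zero_object C (?P n)" if n: "n > b + 2" for n
    proof -
      obtain m where m: "n = Suc (Suc (Suc m))" using n by (metis less_iff_Suc_add add_2_eq_Suc' add_Suc add_Suc_right add.commute)
      have "zero_object C (tail_obj B P (Suc (Suc (Suc m))))"
        by (rule b[rule_format]) (use n m in simp)
      then show ?thesis by (simp add: m)
    qed
    then show ?thesis by blast
  qed
  \<comment> \<open>Past degree two the complex is the upper piece moved along unchanged, so two
    cuts here leave the same complex as the two cuts of the upper piece above.\<close>
  have te: "tail_obj Y (tail_obj ?J ?P) = tail_obj Y (tail_obj Z (tail_obj B P))"
    "tail_ar \<eta> (tail_ar ?p ?d) = tail_ar \<eta> (tail_ar \<zeta> (tail_ar \<rho> d))"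
    by (rule ext, rule_tac n=x in all_nat3I; simp)+
  have "cut (tail_obj ?J ?P) (tail_ar ?p ?d) Y (pr y (Zero C Y X)) \<eta>"
    unfolding cut_def precut_def te
    using s1 acY y ty z b O OZ ch by (simp add: Hom_def)
  then have "acyclic_complex C (tail_obj ?J ?P) (tail_ar ?p ?d)"
  proof (rule acyclic_uncut)
    obtain b where b: "\<forall>n>b. zero_object C (?P n)" using bnd by blast
    then have "zero_object C (tail_obj ?J ?P n)" if "n > Suc b" for n using that by (cases n) auto
    then show "\<exists>b. \<forall>n>b. zero_object C (tail_obj ?J ?P n)" by blast
  qed
  then have "cut ?P ?d ?J ?I ?p"
    unfolding cut_def precut_def
    using s0 d1 i ti z tz b s O OZ ch rho by (simp add: Hom_def del: H_simps(6))
  then show ?thesis using acyclic_uncut bnd by blast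
qed

lemma Hmap_comm:
  assumes f: "\<And>n. f n \<in> Hom C (P n) (Q n)" and w: "w \<in> Hom C X Y"
    and dP: "\<And>n. dP (Suc (Suc n)) \<in> Hom C (P (Suc (Suc (Suc n)))) (P (Suc (Suc n)))"
    and dQ: "\<And>n. dQ (Suc (Suc n)) \<in> Hom C (Q (Suc (Suc (Suc n)))) (Q (Suc (Suc n)))"
    and d: "\<And>n. f (Suc (Suc n)) \<odot> dP (Suc (Suc n)) = dQ (Suc (Suc n)) \<odot> f (Suc (Suc (Suc n)))"
    and d0: "d0P \<in> Hom C (P (Suc 0)) (P 0)" "d0Q \<in> Hom C (Q (Suc 0)) (Q 0)" "f 0 \<odot> d0P = d0Q \<odot> f (Suc 0)"
    and u: "uP \<in> Hom C (P (Suc (Suc 0))) X" "uQ \<in> Hom C (Q (Suc (Suc 0))) Y" "w \<odot> uP = uQ \<odot> f (Suc (Suc 0))"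
    and e: "eP \<in> Hom C X X" "eQ \<in> Hom C Y Y" "w \<odot> eP = eQ \<odot> w"
    and i: "iP \<in> Hom C X (P (Suc 0))" "iQ \<in> Hom C Y (Q (Suc 0))" "f (Suc 0) \<odot> iP = iQ \<odot> w"
    and e': "eP' \<in> Hom C X X" "eQ' \<in> Hom C Y Y" "w \<odot> eP' = eQ' \<odot> w"
  shows "Hmap f w n \<odot> Hdiff P X d0P dP uP eP iP eP' n = Hdiff Q Y d0Q dQ uQ eQ iQ eQ' n \<odot> Hmap f w (Suc n)"
proof -
  have t: "f n \<in> Ar C" "Src C (f n) = P n" "Trg C (f n) = Q n" for n using f[of n] by (auto simp: Hom_def)
  have tw: "w \<in> Ar C" "Src C w = X" "Trg C w = Y" using w by (auto simp: Hom_def)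
  have O: "P n \<in> Ob C" "Q n \<in> Ob C" "X \<in> Ob C" "Y \<in> Ob C" for n
    using Src_Ob[OF t(1)[of n]] Trg_Ob[OF t(1)[of n]] Src_Ob[OF tw(1)] Trg_Ob[OF tw(1)] t[of n] tw by auto
  note h = dP[unfolded Hom_def] dQ[unfolded Hom_def] d0[unfolded Hom_def] u[unfolded Hom_def]
    e[unfolded Hom_def] i[unfolded Hom_def] e'[unfolded Hom_def]
  show ?thesis
    by (rule all_nat3I[of _ n]) (use t tw O h d in \<open>simp_all add: dg_def\<close>)
qed

lemma Ses_Hmap:
  assumes "\<And>n. (f n, g n) \<in> Ses C" "(x, y) \<in> Ses C"
  shows "(Hmap f x n, Hmap g y n) \<in> Ses C"
  by (rule all_nat3I[of _ n]) (use assms Ses_dg in simp_all)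

text \<open>Besides \<open>P\<close>, the data are the kernels \<open>J\<close>, \<open>K\<close> of the top and bottom differentials
  \<open>P 1 \<rightarrow> P 0\<close>. The top complex is the direct sum of \<open>\<dots> \<rightarrow> P 3 \<rightarrow> P 2 \<rightarrow> K\<close> (with the bottom differential
  of \<open>P\<close>, and \<open>K\<close> in degree 0), of \<open>J \<rightarrow> P 1 \<rightarrow> P 0\<close>, and of the contractible complexes on \<open>K\<close> in degrees
  2, 1 and on \<open>J\<close> in degrees 1, 0. The bottom complex has the roles of top and bottom exchanged,
  and a sign on \<open>K\<close> in degrees 1, 0, without which the class of the complex would be off by the
  class of the exchange of the summands of \<open>J \<oplus> J\<close>.\<close>

definition Qs :: "('o, 'a) bcx \<Rightarrow> 'o \<Rightarrow> 'a \<Rightarrow> 'a \<Rightarrow> 'o \<Rightarrow> 'a \<Rightarrow> 'a \<Rightarrow> ('o, 'a) bcx" where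
  "Qs P J \<iota> \<pi> K \<kappa> \<rho> = \<lparr>obj = Hobj (obj P) (J \<oplus>\<oplus> K),
     top_diff = Hdiff (obj P) (J \<oplus>\<oplus> K) (top_diff P 0) (bot_diff P)
       (pr (Zero C (obj P (Suc (Suc 0))) J) \<rho>) (dg (Ident C J) (Zero C K K))
       (cp \<iota> (Zero C K (obj P (Suc 0)))) (dg (Zero C J J) (Ident C K)),
     bot_diff = Hdiff (obj P) (J \<oplus>\<oplus> K) (bot_diff P 0) (top_diff P)
       (pr \<pi> (Zero C (obj P (Suc (Suc 0))) K)) (dg (Zero C J J) (ng (Ident C K)))
       (cp (Zero C J (obj P (Suc 0))) \<kappa>) (dg (Ident C J) (Zero C K K))\<rparr>"

lemma Qs_simps[simp]:
  "obj (Qs P J \<iota> \<pi> K \<kappa> \<rho>) = Hobj (obj P) (J \<oplus>\<oplus> K)"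
  "top_diff (Qs P J \<iota> \<pi> K \<kappa> \<rho>) = Hdiff (obj P) (J \<oplus>\<oplus> K) (top_diff P 0) (bot_diff P)
       (pr (Zero C (obj P (Suc (Suc 0))) J) \<rho>) (dg (Ident C J) (Zero C K K))
       (cp \<iota> (Zero C K (obj P (Suc 0)))) (dg (Zero C J J) (Ident C K))"
  "bot_diff (Qs P J \<iota> \<pi> K \<kappa> \<rho>) = Hdiff (obj P) (J \<oplus>\<oplus> K) (bot_diff P 0) (top_diff P)
       (pr \<pi> (Zero C (obj P (Suc (Suc 0))) K)) (dg (Zero C J J) (ng (Ident C K)))
       (cp (Zero C J (obj P (Suc 0))) \<kappa>) (dg (Ident C J) (Zero C K K))"
  by (simp_all add: Qs_def)

lemma cutD:
  assumes "cut P d J \<iota> \<pi>"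
  shows "(\<iota>, d 0) \<in> Ses C" "\<iota> \<in> Ar C" "Src C \<iota> = J" "Trg C \<iota> = P (Suc 0)" "\<pi> \<in> Ar C"
    "Src C \<pi> = P (Suc (Suc 0))" "Trg C \<pi> = J" "d (Suc 0) = \<iota> \<odot> \<pi>" "J \<in> Ob C"
    "d 0 \<in> Ar C" "Src C (d 0) = P (Suc 0)" "Trg C (d 0) = P 0" "precut P d J \<iota> \<pi>"
    "acyclic_complex C (tail_obj J P) (tail_ar \<pi> d)" "d 0 \<odot> \<iota> = Zero C J (P 0)"
proof -
  show 1: "(\<iota>, d 0) \<in> Ses C" and 2: "Src C \<iota> = J" "\<pi> \<in> Ar C"
    "Src C \<pi> = P (Suc (Suc 0))" "Trg C \<pi> = J" "d (Suc 0) = \<iota> \<odot> \<pi>"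
    "d 0 \<in> Ar C" "Src C (d 0) = P (Suc 0)" "Trg C (d 0) = P 0" "precut P d J \<iota> \<pi>"
    "acyclic_complex C (tail_obj J P) (tail_ar \<pi> d)"
    using assms unfolding cut_def precut_def Hom_def by auto
  show "\<iota> \<in> Ar C" "Trg C \<iota> = P (Suc 0)" "J \<in> Ob C" "d 0 \<odot> \<iota> = Zero C J (P 0)"
    using SesD[OF 1] 2 Src_Ob[of \<iota>] by auto
qed

text \<open>\<open>acyclic_H\<close> is applied with \<open>A = J\<close> and \<open>s\<close> the
  identity for the top, and with \<open>J\<close> and \<open>K\<close> interchanged and
  \<open>s\<close> minus the identity for the bottom.\<close>

lemma binary_acyclic_Qs:
  assumes P: "binary_acyclic C P" and t: "cut (obj P) (top_diff P) J \<iota> \<pi>" and b: "cut (obj P) (bot_diff P) K \<kappa> \<rho>"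
  shows "binary_acyclic C (Qs P J \<iota> \<pi> K \<kappa> \<rho>)"
proof -
  note tt = cutD[OF t] and tb = cutD[OF b]
  note c = chain_complexD[OF binary_acyclicD(3)[OF P]] chain_complexD[OF binary_acyclicD(4)[OF P]]
  have bi: "biproduct C J K (J \<oplus>\<oplus> K) (pr (Ident C J) (Zero C J K)) (pr (Zero C K J) (Ident C K))
     (cp (Ident C J) (Zero C K J)) (cp (Zero C J K) (Ident C K))"
    unfolding biproduct_def using tt(9) tb(9) by (simp add: Hom_def Ident_dsum)
  then have bi': "biproduct C K J (J \<oplus>\<oplus> K) (pr (Zero C K J) (Ident C K)) (pr (Ident C J) (Zero C J K))
     (cp (Zero C J K) (Ident C K)) (cp (Ident C J) (Zero C K J))"
    unfolding biproduct_def using tt(9) tb(9) by (simp add: Hom_def Ident_dsum)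
  have "acyclic_complex C (obj (Qs P J \<iota> \<pi> K \<kappa> \<rho>)) (top_diff (Qs P J \<iota> \<pi> K \<kappa> \<rho>))"
    using acyclic_H[OF bi, of "Ident C J" "Ident C J" \<iota> "top_diff P 0" "obj P" \<rho> "bot_diff P"]
      tt(1-7,9-15) tb(1-7,9-15) c(1) by (simp add: Hom_def dg_def)
  moreover have "acyclic_complex C (obj (Qs P J \<iota> \<pi> K \<kappa> \<rho>)) (bot_diff (Qs P J \<iota> \<pi> K \<kappa> \<rho>))"
    using acyclic_H[OF bi', of "ng (Ident C K)" "ng (Ident C K)" \<kappa> "bot_diff P 0" "obj P" \<pi> "top_diff P"]
      tt(1-7,9-15) tb(1-7,9-15) c(1) by (simp add: Hom_def dg_def)
  ultimately show ?thesis unfolding binary_acyclic_def by simp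
qed

lemma len_Qs:
  assumes "len (Suc b) P" "2 \<le> b"
  shows "len b (Qs P J \<iota> \<pi> K \<kappa> \<rho>)"
  unfolding len_def
proof (intro allI impI)
  fix n assume n: "b < n"
  then obtain m where m: "n = Suc (Suc (Suc m))"
    using assms(2) by (metis less_iff_Suc_add add_2_eq_Suc add_Suc le_less_trans)
  then show "zero_object C (obj (Qs P J \<iota> \<pi> K \<kappa> \<rho>) n)"
    using assms(1) n unfolding len_def by simp
qed

lemma Qs_map_comm:
  assumes P: "binary_acyclic C P" and Q: "binary_acyclic C Q"
    and f: "\<And>n. f n \<in> Hom C (obj P n) (obj Q n)"
    and ft: "\<And>n. f n \<odot> top_diff P n = top_diff Q n \<odot> f (Suc n)"
    and fb: "\<And>n. f n \<odot> bot_diff P n = bot_diff Q n \<odot> f (Suc n)"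
    and tP: "cut (obj P) (top_diff P) J \<iota> \<pi>" and bP: "cut (obj P) (bot_diff P) K \<kappa> \<rho>"
    and tQ: "cut (obj Q) (top_diff Q) J' \<iota>' \<pi>'" and bQ: "cut (obj Q) (bot_diff Q) K' \<kappa>' \<rho>'"
    and x: "x \<in> Ar C" "Src C x = J" "Trg C x = J'" "\<iota>' \<odot> x = f (Suc 0) \<odot> \<iota>" "x \<odot> \<pi> = \<pi>' \<odot> f (Suc (Suc 0))"
    and v: "v \<in> Ar C" "Src C v = K" "Trg C v = K'" "\<kappa>' \<odot> v = f (Suc 0) \<odot> \<kappa>" "v \<odot> \<rho> = \<rho>' \<odot> f (Suc (Suc 0))"
  shows "Hmap f (dg x v) n \<odot> top_diff (Qs P J \<iota> \<pi> K \<kappa> \<rho>) n =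
      top_diff (Qs Q J' \<iota>' \<pi>' K' \<kappa>' \<rho>') n \<odot> Hmap f (dg x v) (Suc n)"
    "Hmap f (dg x v) n \<odot> bot_diff (Qs P J \<iota> \<pi> K \<kappa> \<rho>) n =
      bot_diff (Qs Q J' \<iota>' \<pi>' K' \<kappa>' \<rho>') n \<odot> Hmap f (dg x v) (Suc n)"
proof -
  have d: "top_diff P n \<in> Hom C (obj P (Suc n)) (obj P n)" "bot_diff P n \<in> Hom C (obj P (Suc n)) (obj P n)"
    "top_diff Q n \<in> Hom C (obj Q (Suc n)) (obj Q n)" "bot_diff Q n \<in> Hom C (obj Q (Suc n)) (obj Q n)" for n
    using chain_complexD(2-4)[OF binary_acyclicD(3)[OF P]] chain_complexD(2-4)[OF binary_acyclicD(4)[OF P]]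
      chain_complexD(2-4)[OF binary_acyclicD(3)[OF Q]] chain_complexD(2-4)[OF binary_acyclicD(4)[OF Q]]
    by (simp_all add: Hom_def)
  have O: "obj P n \<in> Ob C" "obj Q n \<in> Ob C" for n
    using chain_complexD(1)[OF binary_acyclicD(3)[OF P]] chain_complexD(1)[OF binary_acyclicD(3)[OF Q]] by auto
  have f': "f n \<in> Ar C" "Src C (f n) = obj P n" "Trg C (f n) = obj Q n" for n using f[of n] by (auto simp: Hom_def)
  note k = cutD(2-7,9)[OF tP] cutD(2-7,9)[OF bP] cutD(2-7,9)[OF tQ] cutD(2-7,9)[OF bQ]
  have w: "dg x v \<in> Hom C (J \<oplus>\<oplus> K) (J' \<oplus>\<oplus> K')" using x v by (simp add: Hom_def)
  show "Hmap f (dg x v) n \<odot> top_diff (Qs P J \<iota> \<pi> K \<kappa> \<rho>) n =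
      top_diff (Qs Q J' \<iota>' \<pi>' K' \<kappa>' \<rho>') n \<odot> Hmap f (dg x v) (Suc n)"
    unfolding Qs_simps
    by (rule Hmap_comm; use k x v f' O d ft fb in \<open>simp add: Hom_def dg_def\<close>)
  show "Hmap f (dg x v) n \<odot> bot_diff (Qs P J \<iota> \<pi> K \<kappa> \<rho>) n =
      bot_diff (Qs Q J' \<iota>' \<pi>' K' \<kappa>' \<rho>') n \<odot> Hmap f (dg x v) (Suc n)"
    unfolding Qs_simps
    by (rule Hmap_comm; use k x v f' O d ft fb in \<open>simp add: Hom_def dg_def\<close>)
qed

text \<open>In every degree a shortening is a direct sum of objects of \<open>P\<close> and of the
  two kernels. The conflations of complexes and the induced conflations of kernels add up, whatever
  cuts are chosen on the three complexes.\<close>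

lemma bses_Qs:
  assumes s: "bses P' P P'' f g"
    and t': "cut (obj P') (top_diff P') J' \<iota>' \<pi>'" and b': "cut (obj P') (bot_diff P') K' \<kappa>' \<rho>'"
    and t: "cut (obj P) (top_diff P) J \<iota> \<pi>" and b: "cut (obj P) (bot_diff P) K \<kappa> \<rho>"
    and t'': "cut (obj P'') (top_diff P'') J'' \<iota>'' \<pi>''" and b'': "cut (obj P'') (bot_diff P'') K'' \<kappa>'' \<rho>''"
  shows "\<exists>f' g'. bses (Qs P' J' \<iota>' \<pi>' K' \<kappa>' \<rho>') (Qs P J \<iota> \<pi> K \<kappa> \<rho>) (Qs P'' J'' \<iota>'' \<pi>'' K'' \<kappa>'' \<rho>'') f' g'"
proof -
  have ba: "binary_acyclic C P'" "binary_acyclic C P" "binary_acyclic C P''"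
    and st: "ses_cx (obj P') (top_diff P') (obj P) (top_diff P) (obj P'') (top_diff P'') f g"
    and sb: "ses_cx (obj P') (bot_diff P') (obj P) (bot_diff P) (obj P'') (bot_diff P'') f g"
    using s unfolding dses_def by auto
  obtain x y where T: "ses_cx (tail_obj J' (obj P')) (tail_ar \<pi>' (top_diff P')) (tail_obj J (obj P)) (tail_ar \<pi> (top_diff P))
      (tail_obj J'' (obj P'')) (tail_ar \<pi>'' (top_diff P'')) (tail_ar x f) (tail_ar y g)"
      "\<iota> \<odot> x = f (Suc 0) \<odot> \<iota>'" "\<iota>'' \<odot> y = g (Suc 0) \<odot> \<iota>"
    using ses_cx_tail[OF st cutD(13)[OF t'] cutD(13)[OF t] cutD(13)[OF t'']] by blast
  obtain v w where B: "ses_cx (tail_obj K' (obj P')) (tail_ar \<rho>' (bot_diff P')) (tail_obj K (obj P)) (tail_ar \<rho> (bot_diff P))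
      (tail_obj K'' (obj P'')) (tail_ar \<rho>'' (bot_diff P'')) (tail_ar v f) (tail_ar w g)"
      "\<kappa> \<odot> v = f (Suc 0) \<odot> \<kappa>'" "\<kappa>'' \<odot> w = g (Suc 0) \<odot> \<kappa>"
    using ses_cx_tail[OF sb cutD(13)[OF b'] cutD(13)[OF b] cutD(13)[OF b'']] by blast
  note xs = ses_cxD[OF T(1), of 0, simplified] and vs = ses_cxD[OF B(1), of 0, simplified]
  note ft = ses_cxD[OF st] and fb = ses_cxD[OF sb]
  let ?Q' = "Qs P' J' \<iota>' \<pi>' K' \<kappa>' \<rho>'" and ?Q = "Qs P J \<iota> \<pi> K \<kappa> \<rho>" and ?Q'' = "Qs P'' J'' \<iota>'' \<pi>'' K'' \<kappa>'' \<rho>''"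
  have cf: "Hmap f (dg x v) n \<odot> top_diff ?Q' n = top_diff ?Q n \<odot> Hmap f (dg x v) (Suc n)"
    "Hmap f (dg x v) n \<odot> bot_diff ?Q' n = bot_diff ?Q n \<odot> Hmap f (dg x v) (Suc n)" for n
    by (rule Qs_map_comm[OF ba(1,2) _ ft(8) fb(8) t' b' t b];
        use ft(2-5) xs(2,4,5,8) vs(2,4,5,8) T(2) B(2) in \<open>simp add: Hom_def\<close>)+
  have cg: "Hmap g (dg y w) n \<odot> top_diff ?Q n = top_diff ?Q'' n \<odot> Hmap g (dg y w) (Suc n)"
    "Hmap g (dg y w) n \<odot> bot_diff ?Q n = bot_diff ?Q'' n \<odot> Hmap g (dg y w) (Suc n)" for n
    by (rule Qs_map_comm[OF ba(2,3) _ ft(9) fb(9) t b t'' b''];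
        use ft(3,6,7) xs(3,6,7,9) vs(3,6,7,9) T(3) B(3) in \<open>simp add: Hom_def\<close>)+
  have sxv: "(Hmap f (dg x v) n, Hmap g (dg y w) n) \<in> Ses C" for n
    by (rule Ses_Hmap[OF ft(1) Ses_dg[OF xs(1) vs(1)]])
  have ty: "Src C (Hmap f (dg x v) n) = obj ?Q' n" "Trg C (Hmap f (dg x v) n) = obj ?Q n"
    "Trg C (Hmap g (dg y w) n) = obj ?Q'' n" for n
    using ft(2-7) xs(2-7) vs(2-7) by (rule_tac n=n in all_nat3I; simp)+
  have "ses_cx (obj ?Q') (top_diff ?Q') (obj ?Q) (top_diff ?Q) (obj ?Q'') (top_diff ?Q'') (Hmap f (dg x v)) (Hmap g (dg y w))"
    "ses_cx (obj ?Q') (bot_diff ?Q') (obj ?Q) (bot_diff ?Q) (obj ?Q'') (bot_diff ?Q'') (Hmap f (dg x v)) (Hmap g (dg y w))"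
    unfolding ses_cx_def using cf cg sxv ty by blast+
  then have "bses ?Q' ?Q ?Q'' (Hmap f (dg x v)) (Hmap g (dg y w))"
    unfolding dses_def using binary_acyclic_Qs[OF ba(1) t' b'] binary_acyclic_Qs[OF ba(2) t b]
      binary_acyclic_Qs[OF ba(3) t'' b''] by blast
  then show ?thesis by blast
qed

section \<open>Complexes that are diagonal above degree one\<close>

definition pickn :: "'x \<Rightarrow> 'x \<Rightarrow> 'x \<Rightarrow> (nat \<Rightarrow> 'x) \<Rightarrow> nat \<Rightarrow> 'x" where
  "pickn a b c f = case_nat a (case_nat b (case_nat c f))"

lemma pickn_simps[simp]:
  "pickn a b c f 0 = a" "pickn a b c f (Suc 0) = b" "pickn a b c f (Suc (Suc 0)) = c"
  "pickn a b c f (Suc (Suc (Suc n))) = f n"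
  by (simp_all add: pickn_def)

lemma Ses_in2_pr1:
  assumes "A \<in> Ob C" "B \<in> Ob C"
  shows "(pr (Zero C B A) (Ident C B), cp (Ident C A) (Zero C B A)) \<in> Ses C"
  by (rule Ses_split[of _ _ "pr (Ident C A) (Zero C A B)" "cp (Zero C A B) (Ident C B)"])
    (use assms in \<open>simp_all add: Ident_dsum\<close>)

text \<open>Columns 1 and 2 enter the alternating sum with opposite signs, so it is enough that
  their classes agree.\<close>

lemma dses_diag_dcols:
  assumes R: "nenashev R 2" and d: "dses A B D f g f' g'" and l: "len 2 A" "len 2 B" "len 2 D"
    and A: "diagonal A"
    and c0: "frag_of (dcol A B D f g f' g' 0) \<in> zspan R"
    and c12: "frag_of (dcol A B D f g f' g' (Suc 0)) - frag_of (dcol A B D f g f' g' (Suc (Suc 0))) \<in> zspan R"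
  shows "frag_of D - frag_of B \<in> zspan R"
proof -
  have a: "frag_of A \<in> zspan R"
    using nenashev_diag[OF R _ l(1) A] d unfolding dses_def by blast
  have "(frag_of D - frag_of B + frag_of A - dcols 2 A B D f g f' g') +
     (frag_of (dcol A B D f g f' g' 0) -
      (frag_of (dcol A B D f g f' g' (Suc 0)) - frag_of (dcol A B D f g f' g' (Suc (Suc 0))))) - frag_of A \<in> zspan R"
    by (rule zspan_diff[OF zspan_add[OF nenashev_dses[OF R d l] zspan_diff[OF c0 c12]] a])
  then show ?thesis by (simp add: dcols_def sum_atMost_2 algebra_simps)
qed

lemma isomorphism_swap:
  assumes "X \<in> Ob C"
  shows "isomorphism C (cp (pr (Zero C X X) (Ident C X)) (pr (Ident C X) (Zero C X X)))"
  by (rule isomorphismI[of _ "cp (pr (Zero C X X) (Ident C X)) (pr (Ident C X) (Zero C X X))"])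
    (use assms in \<open>simp_all add: Ident_dsum\<close>)

lemma isomorphism_dg:
  assumes "isomorphism C f" "isomorphism C g"
  shows "isomorphism C (dg f g)"
proof -
  obtain f' where f: "f \<in> Ar C" "f' \<in> Ar C" "Src C f' = Trg C f" "Trg C f' = Src C f"
    "f' \<odot> f = Ident C (Src C f)" "f \<odot> f' = Ident C (Trg C f)" by (rule isomorphismE[OF assms(1)])
  obtain g' where g: "g \<in> Ar C" "g' \<in> Ar C" "Src C g' = Trg C g" "Trg C g' = Src C g"
    "g' \<odot> g = Ident C (Src C g)" "g \<odot> g' = Ident C (Trg C g)" by (rule isomorphismE[OF assms(2)])
  show ?thesis by (rule isomorphismI[of _ "dg f' g'"]) (use f g in simp_all)
qed

text \<open>The complex with top maps \<open>(p, j, k) \<mapsto> (d p, j)\<close>, \<open>(j, k) \<mapsto> (\<iota> j, 0, k)\<close> and bottom maps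
  \<open>(p, j, k) \<mapsto> (d' p, k)\<close>, \<open>(j, k) \<mapsto> (\<kappa> k, j, 0)\<close>. Exchanging \<open>j\<close> and \<open>k\<close> in degrees 1 and 2 turns
  the bottom into the same form as the top; the two exchanges cancel in the Nenashev relation.\<close>

definition Rcx :: "'o \<Rightarrow> 'o \<Rightarrow> 'o \<Rightarrow> 'a \<Rightarrow> 'a \<Rightarrow> 'a \<Rightarrow> 'a \<Rightarrow> ('o, 'a) bcx" where
  "Rcx A B X d \<iota> d' \<kappa> = cx3 (A \<oplus>\<oplus> X) (B \<oplus>\<oplus> (X \<oplus>\<oplus> X)) (X \<oplus>\<oplus> X)
     (dg d (cp (Ident C X) (Zero C X X))) (pr (cp \<iota> (Zero C X B)) (dg (Zero C X X) (Ident C X)))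
     (dg d' (cp (Zero C X X) (Ident C X))) (pr (cp (Zero C X B) \<kappa>) (dg (Ident C X) (Zero C X X)))"

text \<open>The first is the sum of the given conflation and a split one; the second arises from it
  by exchanging the two copies of \<open>X\<close> in degrees 1 and 2.\<close>

lemma Ses_Rcx:
  assumes "(\<iota>, d) \<in> Ses C" "Src C \<iota> = X" "Trg C \<iota> = B" "Trg C d = A"
  shows "(pr (cp \<iota> (Zero C X B)) (dg (Zero C X X) (Ident C X)), dg d (cp (Ident C X) (Zero C X X))) \<in> Ses C"
    "(pr (cp (Zero C X B) \<iota>) (dg (Ident C X) (Zero C X X)), dg d (cp (Zero C X X) (Ident C X))) \<in> Ses C"
proof -
  note t = SesD[OF assms(1)]
  have O: "X \<in> Ob C" "B \<in> Ob C" "A \<in> Ob C" using assms t Src_Ob[OF t(1)] Trg_Ob[OF t(1)] Trg_Ob[OF t(2)] by auto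
  show 1: "(pr (cp \<iota> (Zero C X B)) (dg (Zero C X X) (Ident C X)), dg d (cp (Ident C X) (Zero C X X))) \<in> Ses C"
    using Ses_dg[OF assms(1) Ses_in2_pr1[OF O(1,1)]] assms t O by (simp add: dg_def)
  let ?s = "cp (pr (Zero C X X) (Ident C X)) (pr (Ident C X) (Zero C X X))"
  show "(pr (cp (Zero C X B) \<iota>) (dg (Ident C X) (Zero C X X)), dg d (cp (Zero C X X) (Ident C X))) \<in> Ses C"
    by (rule Ses_closed_iso[OF 1, of ?s "dg (Ident C B) ?s" "Ident C (A \<oplus>\<oplus> X)"])
      (use isomorphism_swap[OF O(1)] isomorphism_dg[of "Ident C B" ?s] isomorphism_Ident[of "A \<oplus>\<oplus> X"] assms t O in \<open>simp_all add: Hom_def dg_def Ident_dsum\<close>)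
qed

lemma binary_acyclic_Rcx:
  assumes s: "(\<iota>, d) \<in> Ses C" "Src C \<iota> = X" "Trg C \<iota> = B" "Trg C d = A"
    and s': "(\<kappa>, d') \<in> Ses C" "Src C \<kappa> = X" "Trg C \<kappa> = B" "Trg C d' = A"
  shows "binary_acyclic C (Rcx A B X d \<iota> d' \<kappa>)"
proof -
  note t = SesD[OF s(1)] and t' = SesD[OF s'(1)]
  have O: "X \<in> Ob C" "B \<in> Ob C" "A \<in> Ob C" using s t Src_Ob[OF t(1)] Trg_Ob[OF t(1)] Trg_Ob[OF t(2)] by auto
  show ?thesis
    unfolding Rcx_def
    by (rule binary_acyclic_cx3[OF Ses_Rcx(1)[OF s] _ _ _ Ses_Rcx(2)[OF s']]) (use O s s' t t' in simp_all)
qed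

text \<open>\<open>?F\<close> has its bottom in the same form as its top. It is compared with
  \<open>Rcx\<close> by identities on top and exchanges on the bottom; being the same on both sides,
  the extra summands then split off \<open>?F\<close> as the diagonal complex
  \<open>?G\<close>.\<close>

lemma nenashev_Rcx:
  assumes R: "nenashev R 2"
    and s: "(\<iota>, d) \<in> Ses C" "Src C \<iota> = X" "Trg C \<iota> = B" "Trg C d = A"
    and s': "(\<kappa>, d') \<in> Ses C" "Src C \<kappa> = X" "Trg C \<kappa> = B" "Trg C d' = A"
  shows "frag_of (Rcx A B X d \<iota> d' \<kappa>) - frag_of (cx3 A B X d \<iota> d' \<kappa>) \<in> zspan R"
proof -
  note t = SesD[OF s(1)] and t' = SesD[OF s'(1)]
  have O: "X \<in> Ob C" "B \<in> Ob C" "A \<in> Ob C" using s t Src_Ob[OF t(1)] Trg_Ob[OF t(1)] Trg_Ob[OF t(2)] by auto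
  define W where "W = X \<oplus>\<oplus> X"
  define sw where "sw = cp (pr (Zero C X X) (Ident C X)) (pr (Ident C X) (Zero C X X))"
  have OW: "W \<in> Ob C" using O by (simp add: W_def)
  have sw: "sw \<in> Ar C" "Src C sw = W" "Trg C sw = W" "isomorphism C sw"
    using O isomorphism_swap by (simp_all add: sw_def W_def)
  let ?R = "Rcx A B X d \<iota> d' \<kappa>"
  let ?F = "cx3 (A \<oplus>\<oplus> X) (B \<oplus>\<oplus> W) W
     (dg d (cp (Ident C X) (Zero C X X))) (pr (cp \<iota> (Zero C X B)) (dg (Zero C X X) (Ident C X)))
     (dg d' (cp (Ident C X) (Zero C X X))) (pr (cp \<kappa> (Zero C X B)) (dg (Zero C X X) (Ident C X)))"
  have baR: "binary_acyclic C ?R" by (rule binary_acyclic_Rcx[OF s s'])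
  have baF: "binary_acyclic C ?F"
    by (rule binary_acyclic_cx3[OF Ses_Rcx(1)[OF s] _ _ _ Ses_Rcx(1)[OF s']]) (use O s s' t t' in \<open>simp_all add: W_def\<close>)
  let ?\<alpha> = "pick3 (Ident C (A \<oplus>\<oplus> X)) (Ident C (B \<oplus>\<oplus> W)) (Ident C W) (Ident C Z0)"
  let ?\<beta> = "pick3 (Ident C (A \<oplus>\<oplus> X)) (dg (Ident C B) sw) sw (Ident C Z0)"
  let ?z = "\<lambda>n. Zero C Z0 (obj ?F n)"
  have d1: "dses ZC ?F ?R ?z ?\<alpha> ?z ?\<beta>"
  proof (rule dses_isoI[OF baF baR])
    fix n
    show "isomorphism C (?\<alpha> n)" by (rule all_nat3I[of _ n]) (use O OW in simp_all)
    show "isomorphism C (?\<beta> n)" by (rule all_nat3I[of _ n]) (use O OW sw isomorphism_dg in simp_all)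
    show "?\<alpha> n \<in> Hom C (obj ?F n) (obj ?R n)" "?\<beta> n \<in> Hom C (obj ?F n) (obj ?R n)"
      by (rule all_nat3I[of _ n]; use O OW sw in \<open>simp add: Hom_def Rcx_def W_def\<close>)+
    show "?\<alpha> n \<odot> top_diff ?F n = top_diff ?R n \<odot> ?\<alpha> (Suc n)"
      by (rule all_nat3I[of _ n]) (use O OW t s in \<open>simp_all add: Rcx_def W_def\<close>)
    show "?\<beta> n \<odot> bot_diff ?F n = bot_diff ?R n \<odot> ?\<beta> (Suc n)"
      by (rule all_nat3I[of _ n]) (use O OW t' s' in \<open>simp_all add: Rcx_def W_def sw_def dg_def Ident_dsum\<close>)
  qed
  let ?c = "dcol ZC ?F ?R ?z ?\<alpha> ?z ?\<beta>"
  have ba: "binary_acyclic C (?c k)" for k by (rule binary_acyclic_dcol[OF d1])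
  have lc: "len 2 (?c k)" for k by (simp add: dcol_def)
  have c0: "frag_of (?c 0) \<in> zspan R"
    by (rule nenashev_diag[OF R ba lc]) (simp add: dcol_def diagonal_def)
  \<comment> \<open>Column 1 is column 2 plus this diagonal complex, because the exchange in degree
    1 does not touch the summand \<open>B\<close>. Hence both columns have the same class.\<close>
  let ?D = "cx3 B B Z0 (Ident C B) (Zero C Z0 B) (Ident C B) (Zero C Z0 B)"
  have baD: "binary_acyclic C ?D"
    using Ses_iso_epi[of "Ident C B"] O by (intro binary_acyclic_cx3) simp_all
  have c1: "?c (Suc 0) = cx3 (B \<oplus>\<oplus> W) (B \<oplus>\<oplus> W) Z0 (Ident C (B \<oplus>\<oplus> W)) (Zero C Z0 (B \<oplus>\<oplus> W)) (dg (Ident C B) sw) (Zero C Z0 (B \<oplus>\<oplus> W))"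
    and c2: "?c (Suc (Suc 0)) = cx3 W W Z0 (Ident C W) (Zero C Z0 W) sw (Zero C Z0 W)"
    by (simp_all add: dcol_def Rcx_def W_def)
  let ?f = "pick3 (pr (Zero C W B) (Ident C W)) (pr (Zero C W B) (Ident C W)) (Zero C Z0 Z0) (Zero C Z0 Z0)"
  let ?g = "pick3 (cp (Ident C B) (Zero C W B)) (cp (Ident C B) (Zero C W B)) (Zero C Z0 Z0) (Zero C Z0 Z0)"
  have "(?f n, ?g n) \<in> Ses C" for n
    by (rule all_nat3I[of _ n]) (use Ses_in2_pr1 O OW Ses_zero_zero in simp_all)
  moreover have "Src C (?f n) = obj (?c (Suc (Suc 0))) n" "Trg C (?f n) = obj (?c (Suc 0)) n" "Trg C (?g n) = obj ?D n" for n
    unfolding c1 c2 by (rule all_nat3I[of _ n]; use O OW in simp)+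
  moreover have "?f n \<odot> top_diff (?c (Suc (Suc 0))) n = top_diff (?c (Suc 0)) n \<odot> ?f (Suc n)"
    "?f n \<odot> bot_diff (?c (Suc (Suc 0))) n = bot_diff (?c (Suc 0)) n \<odot> ?f (Suc n)"
    "?g n \<odot> top_diff (?c (Suc 0)) n = top_diff ?D n \<odot> ?g (Suc n)"
    "?g n \<odot> bot_diff (?c (Suc 0)) n = bot_diff ?D n \<odot> ?g (Suc n)" for n
    unfolding c1 c2 by (rule all_nat3I[of _ n]; use O OW sw(1-3) in \<open>simp add: dg_def\<close>)+
  ultimately have "bses (?c (Suc (Suc 0))) (?c (Suc 0)) ?D ?f ?g"
    unfolding dses_def ses_cx_def using ba baD by blast
  then have "frag_of (?c (Suc 0)) - frag_of (?c (Suc (Suc 0))) - frag_of ?D \<in> zspan R"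
    by (rule nenashev_bses[OF R]) (use lc in simp_all)
  moreover have "frag_of ?D \<in> zspan R"
    by (rule nenashev_diag[OF R baD]) (simp_all add: diagonal_def)
  ultimately have c12: "frag_of (?c (Suc 0)) - frag_of (?c (Suc (Suc 0))) \<in> zspan R"
    using zspan_add by fastforce
  have RF: "frag_of ?R - frag_of ?F \<in> zspan R"
    by (rule dses_diag_dcols[OF R d1 _ _ _ _ c0 c12]) (simp_all add: Rcx_def)
  let ?S = "cx3 A B X d \<iota> d' \<kappa>"
  have baS: "binary_acyclic C ?S" by (rule binary_acyclic_cx3[OF s s'])
  let ?G = "cx3 X W X (cp (Ident C X) (Zero C X X)) (pr (Zero C X X) (Ident C X)) (cp (Ident C X) (Zero C X X)) (pr (Zero C X X) (Ident C X))"
  have baG: "binary_acyclic C ?G"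
    by (rule binary_acyclic_cx3) (use O Ses_in2_pr1 in \<open>simp_all add: W_def\<close>)
  let ?i = "pick3 (pr (Ident C A) (Zero C A X)) (pr (Ident C B) (Zero C B W)) (pr (Ident C X) (Zero C X X)) (Zero C Z0 Z0)"
  let ?p = "pick3 (cp (Zero C A X) (Ident C X)) (cp (Zero C B W) (Ident C W)) (cp (Zero C X X) (Ident C X)) (Zero C Z0 Z0)"
  have "(?i n, ?p n) \<in> Ses C" for n
    by (rule all_nat3I[of _ n]) (use Ses_in1_pr2 O OW Ses_zero_zero in simp_all)
  moreover have "Src C (?i n) = obj ?S n" "Trg C (?i n) = obj ?F n" "Trg C (?p n) = obj ?G n" for n
    by (rule all_nat3I[of _ n]; use O OW in \<open>simp add: W_def\<close>)+
  moreover have "?i n \<odot> top_diff ?S n = top_diff ?F n \<odot> ?i (Suc n)"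
    "?i n \<odot> bot_diff ?S n = bot_diff ?F n \<odot> ?i (Suc n)"
    "?p n \<odot> top_diff ?F n = top_diff ?G n \<odot> ?p (Suc n)"
    "?p n \<odot> bot_diff ?F n = bot_diff ?G n \<odot> ?p (Suc n)" for n
    by (rule all_nat3I[of _ n]; use O t s t' s' in \<open>simp add: dg_def W_def Ident_dsum\<close>)+
  ultimately have "bses ?S ?F ?G ?i ?p"
    unfolding dses_def ses_cx_def using baS baF baG by blast
  then have "frag_of ?F - frag_of ?S - frag_of ?G \<in> zspan R"
    by (rule nenashev_bses[OF R]) simp_all
  moreover have "frag_of ?G \<in> zspan R"
    by (rule nenashev_diag[OF R baG]) (simp_all add: diagonal_def)
  ultimately have "(frag_of ?R - frag_of ?F) + ((frag_of ?F - frag_of ?S - frag_of ?G) + frag_of ?G) \<in> zspan R"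
    using RF by (intro zspan_add)
  then show ?thesis by simp
qed

text \<open>When both halves share the upper piece, that piece can be embedded by arrows commuting
  with both differentials at once; the quotient retains only the part around degrees 0 and
  1.\<close>

lemma key_bses:
  assumes P: "binary_acyclic C P" and t: "cut (obj P) (top_diff P) J \<iota> \<pi>" and b: "cut (obj P) (bot_diff P) J \<kappa> \<pi>"
    and d: "\<And>n. top_diff P (Suc (Suc n)) = bot_diff P (Suc (Suc n))"
  shows "\<exists>E f g. bses E (Qs P J \<iota> \<pi> J \<kappa> \<pi>)
      (Rcx (obj P 0) (obj P (Suc 0)) J (top_diff P 0) \<iota> (bot_diff P 0) \<kappa>) f g \<and>
    diagonal E \<and> obj E = tail_obj J (obj P)"
proof -
  note kt = cutD(1-7,9-12,14-)[OF t] and kb = cutD(1-7,9-12,14-)[OF b]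
  note c = chain_complexD[OF binary_acyclicD(3)[OF P]]
  have O: "obj P n \<in> Ob C" for n using c(1) .
  define E where "E = \<lparr>obj = tail_obj J (obj P), top_diff = tail_ar \<pi> (top_diff P), bot_diff = tail_ar \<pi> (top_diff P)\<rparr>"
  let ?Q = "Qs P J \<iota> \<pi> J \<kappa> \<pi>"
  let ?R = "Rcx (obj P 0) (obj P (Suc 0)) J (top_diff P 0) \<iota> (bot_diff P 0) \<kappa>"
  define W where "W = J \<oplus>\<oplus> J"
  have OW: "W \<in> Ob C" using kt(8) by (simp add: W_def)
  have p: "\<pi> \<odot> top_diff P (Suc (Suc 0)) = Zero C (obj P (Suc (Suc (Suc 0)))) J"
    using chain_complexD(5)[OF acyclicD[OF kt(12)], of 0] by simp
  have baE: "binary_acyclic C E" using kt(12) by (simp add: binary_acyclic_def E_def)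
  have baQ: "binary_acyclic C ?Q" by (rule binary_acyclic_Qs[OF P t b])
  have baR: "binary_acyclic C ?R" by (rule binary_acyclic_Rcx) (use kt kb in simp_all)
  let ?P0 = "obj P 0" and ?P1 = "obj P (Suc 0)" and ?P2 = "obj P (Suc (Suc 0))" and ?P3 = "obj P (Suc (Suc (Suc 0)))"
  let ?I = "Ident C"
  \<comment> \<open>In degree 0 the copy of \<open>J\<close> is the diagonal of
    \<open>J \<oplus>\<oplus> J\<close>. This forces the entries \<pi> and \<open>ng \<pi>\<close>
    in degree 1: on the two copies of \<open>J\<close> the top differential keeps the first and the
    bottom one the negative of the second. Accordingly \<open>?g\<close> takes the difference of the
    copies in degree 0.\<close>
  let ?f = "pickn (pr (Zero C J ?P0) (pr (?I J) (?I J)))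
     (pr (Zero C ?P2 ?P1) (pr (?I ?P2) (pr \<pi> (ng \<pi>))))
     (pr (?I ?P3) (Zero C ?P3 W)) (\<lambda>n. ?I (obj P (Suc (Suc (Suc (Suc n))))))"
  let ?g = "pickn (dg (?I ?P0) (cp (?I J) (ng (?I J))))
     (cp (pr (?I ?P1) (Zero C ?P1 W)) (cp (pr (Zero C ?P2 ?P1) (pr (ng \<pi>) \<pi>)) (pr (Zero C W ?P1) (?I W))))
     (cp (Zero C ?P3 W) (?I W)) (\<lambda>n. Zero C (obj P (Suc (Suc (Suc (Suc n))))) Z0)"
  have "(?f n, ?g n) \<in> Ses C" for n
  proof (rule all_nat3I[of _ n])
    show "(?f 0, ?g 0) \<in> Ses C"
      by (rule Ses_split[of _ _ "dg (?I ?P0) (pr (?I J) (Zero C J J))" "cp (Zero C ?P0 J) (cp (Zero C J J) (?I J))"])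
        (use kt O in \<open>simp_all add: dg_def Ident_dsum\<close>)
    show "(?f (Suc 0), ?g (Suc 0)) \<in> Ses C"
      by (rule Ses_split[of _ _ "cp (pr (?I ?P1) (pr (Zero C ?P1 ?P2) (Zero C ?P1 W)))
          (pr (Zero C W ?P1) (pr (Zero C W ?P2) (?I W)))" "cp (Zero C ?P1 ?P2) (cp (?I ?P2) (Zero C W ?P2))"])
        (use kt O OW in \<open>simp_all add: dg_def Ident_dsum W_def\<close>)
    show "(?f (Suc (Suc 0)), ?g (Suc (Suc 0))) \<in> Ses C"
      using Ses_in1_pr2[of ?P3 W] O OW by simp
    fix n show "(?f (Suc (Suc (Suc n))), ?g (Suc (Suc (Suc n)))) \<in> Ses C"
      using Ses_iso_mono[of "?I (obj P (Suc (Suc (Suc (Suc n)))))"] O by simp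
  qed
  moreover have "Src C (?f n) = obj E n" "Trg C (?f n) = obj ?Q n" "Trg C (?g n) = obj ?R n" for n
    by (rule all_nat3I[of _ n]; use kt O OW in \<open>simp add: E_def Rcx_def; simp add: W_def\<close>)+
  moreover have "?f n \<odot> top_diff E n = top_diff ?Q n \<odot> ?f (Suc n)" for n
    by (rule all_nat3I[of _ n]; use kt kb O c(2-5) p d[symmetric] in \<open>simp add: E_def dg_def W_def\<close>)
  moreover have "?f n \<odot> bot_diff E n = bot_diff ?Q n \<odot> ?f (Suc n)" for n
    by (rule all_nat3I[of _ n]; use kt kb O c(2-5) p in \<open>simp add: E_def dg_def W_def\<close>)
  moreover have "?g n \<odot> top_diff ?Q n = top_diff ?R n \<odot> ?g (Suc n)" for n
    by (rule all_nat3I[of _ n]; use kt kb O c(2-5) p d[symmetric] in \<open>simp add: Rcx_def dg_def W_def Ident_dsum\<close>)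
  moreover have "?g n \<odot> bot_diff ?Q n = bot_diff ?R n \<odot> ?g (Suc n)" for n
    by (rule all_nat3I[of _ n]; use kt kb O c(2-5) p in \<open>simp add: Rcx_def dg_def W_def Ident_dsum\<close>)
  ultimately have "bses E ?Q ?R ?f ?g"
    unfolding dses_def ses_cx_def using baE baQ baR by blast
  moreover have "diagonal E" "obj E = tail_obj J (obj P)" by (simp_all add: E_def diagonal_def)
  ultimately show ?thesis by blast
qed

text \<open>The choice depends only on the objects and one differential, so on a diagonal complex
  top and bottom receive the same cut.\<close>

definition cutdat :: "(nat \<Rightarrow> 'o) \<Rightarrow> (nat \<Rightarrow> 'a) \<Rightarrow> 'o \<times> 'a \<times> 'a" where
  "cutdat P d = (SOME (J, \<iota>, \<pi>). cut P d J \<iota> \<pi>)"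

lemma cutdat:
  assumes "acyclic_complex C P d"
  shows "case cutdat P d of (J, \<iota>, \<pi>) \<Rightarrow> cut P d J \<iota> \<pi>"
proof -
  have "\<exists>x. case x of (J, \<iota>, \<pi>) \<Rightarrow> cut P d J \<iota> \<pi>" using acyclic_cut[OF assms] by auto
  then show ?thesis unfolding cutdat_def by (rule someI_ex)
qed

definition shorten :: "('o, 'a) bcx \<Rightarrow> ('o, 'a) bcx" where
  "shorten P = (case (cutdat (obj P) (top_diff P), cutdat (obj P) (bot_diff P)) of
     ((J, \<iota>, \<pi>), (K, \<kappa>, \<rho>)) \<Rightarrow> Qs P J \<iota> \<pi> K \<kappa> \<rho>)"

lemma shortenE:
  assumes "binary_acyclic C P"
  obtains J \<iota> \<pi> K \<kappa> \<rho> where "cut (obj P) (top_diff P) J \<iota> \<pi>" "cut (obj P) (bot_diff P) K \<kappa> \<rho>"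
    "shorten P = Qs P J \<iota> \<pi> K \<kappa> \<rho>" "diagonal P \<Longrightarrow> (K, \<kappa>, \<rho>) = (J, \<iota>, \<pi>)"
proof -
  obtain J \<iota> \<pi> where t: "cutdat (obj P) (top_diff P) = (J, \<iota>, \<pi>)" using prod_cases3 by blast
  obtain K \<kappa> \<rho> where b: "cutdat (obj P) (bot_diff P) = (K, \<kappa>, \<rho>)" using prod_cases3 by blast
  show ?thesis
    by (rule that[of J \<iota> \<pi> K \<kappa> \<rho>])
      (use cutdat[OF binary_acyclicD(1)[OF assms]] cutdat[OF binary_acyclicD(2)[OF assms]] t b in
        \<open>auto simp: shorten_def diagonal_def\<close>)
qed

lemma binary_acyclic_shorten:
  assumes "binary_acyclic C P"
  shows "binary_acyclic C (shorten P)"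
  by (rule shortenE[OF assms]) (simp only: binary_acyclic_Qs[OF assms])

lemma len_shorten:
  assumes "binary_acyclic C P" "len (Suc b) P" "2 \<le> b"
  shows "len b (shorten P)"
  by (rule shortenE[OF assms(1)]) (use len_Qs[OF assms(2,3)] in simp)

lemma bses_shorten:
  assumes "bses A B D f g"
  shows "\<exists>f' g'. bses (shorten A) (shorten B) (shorten D) f' g'"
proof -
  have ba: "binary_acyclic C A" "binary_acyclic C B" "binary_acyclic C D" using assms unfolding dses_def by auto
  obtain J \<iota> \<pi> K \<kappa> \<rho> where 1: "cut (obj A) (top_diff A) J \<iota> \<pi>" "cut (obj A) (bot_diff A) K \<kappa> \<rho>"
    "shorten A = Qs A J \<iota> \<pi> K \<kappa> \<rho>" by (rule shortenE[OF ba(1)])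
  obtain J' \<iota>' \<pi>' K' \<kappa>' \<rho>' where 2: "cut (obj B) (top_diff B) J' \<iota>' \<pi>'" "cut (obj B) (bot_diff B) K' \<kappa>' \<rho>'"
    "shorten B = Qs B J' \<iota>' \<pi>' K' \<kappa>' \<rho>'" by (rule shortenE[OF ba(2)])
  obtain J'' \<iota>'' \<pi>'' K'' \<kappa>'' \<rho>'' where 3: "cut (obj D) (top_diff D) J'' \<iota>'' \<pi>''" "cut (obj D) (bot_diff D) K'' \<kappa>'' \<rho>''"
    "shorten D = Qs D J'' \<iota>'' \<pi>'' K'' \<kappa>'' \<rho>''" by (rule shortenE[OF ba(3)])
  show ?thesis unfolding 1(3) 2(3) 3(3) by (rule bses_Qs[OF assms 1(1,2) 2(1,2) 3(1,2)])
qed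

lemma bses_ZC_id:
  assumes "binary_acyclic C P"
  shows "bses ZC P P (\<lambda>n. Zero C Z0 (obj P n)) (\<lambda>n. Ident C (obj P n))"
  by (rule dses_isoI[OF assms assms])
    (use chain_complexD[OF binary_acyclicD(3)[OF assms]] chain_complexD[OF binary_acyclicD(4)[OF assms]] in
      \<open>simp_all add: Hom_def\<close>)

text \<open>Two cuts of \<open>P\<close> are compared through the conflation from \<open>P\<close>
  onto itself with zero kernel, as \<open>bses_Qs\<close> allows a different cut on each copy. The
  shortened zero complex has class zero because it is an extension of itself by itself.\<close>

lemma shorten_Qs:
  assumes R: "\<And>A B D f g. bses A B D f g \<Longrightarrow> len b A \<Longrightarrow> len b B \<Longrightarrow> len b D \<Longrightarrow>
      frag_of B - frag_of A - frag_of D \<in> zspan R"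
    and P: "binary_acyclic C P" "len (Suc b) P" "2 \<le> b"
    and t: "cut (obj P) (top_diff P) J \<iota> \<pi>" and b: "cut (obj P) (bot_diff P) K \<kappa> \<rho>"
  shows "frag_of (shorten P) - frag_of (Qs P J \<iota> \<pi> K \<kappa> \<rho>) \<in> zspan R"
proof -
  have lz: "len b (shorten ZC)" by (rule len_shorten) (use P in simp_all)
  obtain f g where "bses (shorten ZC) (shorten ZC) (shorten ZC) f g"
    using bses_shorten bses_ZC_id ZC(1) by (metis (no_types, lifting) bses_ZC_id)
  then have "frag_of (shorten ZC) - frag_of (shorten ZC) - frag_of (shorten ZC) \<in> zspan R"
    by (rule R) (use lz in auto)
  then have z: "frag_of (shorten ZC) \<in> zspan R" by simp
  obtain J' \<iota>' \<pi>' K' \<kappa>' \<rho>' where 1: "cut (obj ZC) (top_diff ZC) J' \<iota>' \<pi>'" "cut (obj ZC) (bot_diff ZC) K' \<kappa>' \<rho>'"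
    "shorten ZC = Qs ZC J' \<iota>' \<pi>' K' \<kappa>' \<rho>'" by (rule shortenE[OF ZC(1)])
  obtain J'' \<iota>'' \<pi>'' K'' \<kappa>'' \<rho>'' where 2: "cut (obj P) (top_diff P) J'' \<iota>'' \<pi>''" "cut (obj P) (bot_diff P) K'' \<kappa>'' \<rho>''"
    "shorten P = Qs P J'' \<iota>'' \<pi>'' K'' \<kappa>'' \<rho>''" by (rule shortenE[OF P(1)])
  obtain f g where "bses (shorten ZC) (shorten P) (Qs P J \<iota> \<pi> K \<kappa> \<rho>) f g"
    using bses_Qs[OF bses_ZC_id[OF P(1)] 1(1,2) 2(1,2) t b] unfolding 1(3) 2(3) by blast
  then have "frag_of (shorten P) - frag_of (shorten ZC) - frag_of (Qs P J \<iota> \<pi> K \<kappa> \<rho>) \<in> zspan R"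
    by (rule R) (use lz len_shorten[OF P] len_Qs[OF P(2,3)] in auto)
  then have "(frag_of (shorten P) - frag_of (shorten ZC) - frag_of (Qs P J \<iota> \<pi> K \<kappa> \<rho>)) + frag_of (shorten ZC) \<in> zspan R"
    using z by (rule zspan_add)
  then show ?thesis by simp
qed

text \<open>The shortening may be longer than two and then is no generator of \<open>K1N\<close>.
  Hence an extension is recorded: its diagonal part is ready for the next shortening, and its
  length-two part is trivial for every \<open>R\<close> with \<open>nenashev R 2\<close>.\<close>

lemma shorten_diag_bses:
  assumes P: "binary_acyclic C P" "len (Suc b) P" "2 \<le> b" and d: "diagonal P"
  shows "\<exists>E F f g. bses E (shorten P) F f g \<and> diagonal E \<and> len b E \<and> len 2 F \<and>
    (\<forall>R. nenashev R 2 \<longrightarrow> frag_of F \<in> zspan R)"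
proof -
  obtain J \<iota> \<pi> where 1: "cut (obj P) (top_diff P) J \<iota> \<pi>" "cut (obj P) (bot_diff P) J \<iota> \<pi>" "shorten P = Qs P J \<iota> \<pi> J \<iota> \<pi>"
    using shortenE[OF P(1)] d by (metis Pair_inject)
  have e: "top_diff P = bot_diff P" using d by (simp add: diagonal_def)
  let ?F = "Rcx (obj P 0) (obj P (Suc 0)) J (top_diff P 0) \<iota> (bot_diff P 0) \<iota>"
  obtain E f g where E: "bses E (shorten P) ?F f g" "diagonal E" "obj E = tail_obj J (obj P)"
    using key_bses[OF P(1) 1(1,2)] e unfolding 1(3) by metis
  have "len b E"
    unfolding len_def
  proof (intro allI impI)
    fix n assume n: "b < n"
    then obtain m where "n = Suc m" by (cases n) auto
    then show "zero_object C (obj E n)" using n P(2) unfolding E(3) len_def by simp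
  qed
  moreover have "frag_of ?F \<in> zspan R" if R: "nenashev R 2" for R
  proof -
    note k = cutD[OF 1(1)] and k' = cutD[OF 1(2)]
    have "frag_of ?F - frag_of (cx3 (obj P 0) (obj P (Suc 0)) J (top_diff P 0) \<iota> (bot_diff P 0) \<iota>) \<in> zspan R"
      by (rule nenashev_Rcx[OF R]) (use k k' in simp_all)
    moreover have "frag_of (cx3 (obj P 0) (obj P (Suc 0)) J (top_diff P 0) \<iota> (bot_diff P 0) \<iota>) \<in> zspan R"
      by (rule nenashev_diag[OF R binary_acyclic_cx3]) (use k k' e in \<open>simp_all add: diagonal_def\<close>)
    ultimately show ?thesis using zspan_add by fastforce
  qed
  ultimately show ?thesis using E by (metis Rcx_def len_cx3 order_refl)
qed

lemma Ses_iso_right: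
  assumes "(i, p) \<in> Ses C" "zero_object C (Src C i)"
  shows "isomorphism C p"
proof -
  note t = SesD[OF assms(1)]
  have "i = Zero C (Src C i) (Trg C i)" using from_zero_eq[OF assms(2), of i] t by simp
  then have "Ident C (Src C p) \<odot> i = Zero C (Src C i) (Trg C (Ident C (Src C p)))" using t by simp
  then obtain g where g: "g \<in> Ar C" "Src C g = Trg C p" "Trg C g = Src C p" "g \<odot> p = Ident C (Src C p)"
    using Ses_cokernel_factor[OF assms(1), of "Ident C (Src C p)"] t(1-3) by (metis Ident_Ar Src_Ob)
  have "(p \<odot> g) \<odot> p = Ident C (Trg C p) \<odot> p" using g t by simp
  then have "p \<odot> g = Ident C (Trg C p)"
    by (rule Ses_epi[OF assms(1)]) (use g t in auto)
  then show ?thesis by (intro isomorphismI[of p g]) (use g t in auto)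
qed

text \<open>For any cut, the kernel \<open>Z\<close> of \<pi> is a quotient of \<open>P 3\<close>,
  hence zero; so \<pi> is invertible and \<open>d (Suc 0)\<close> is itself a kernel of
  \<open>d 0\<close>.\<close>

lemma cut_length_two:
  assumes a: "acyclic_complex C P d" and l: "\<And>n. n > 2 \<Longrightarrow> zero_object C (P n)"
  shows "cut P d (P (Suc (Suc 0))) (d (Suc 0)) (Ident C (P (Suc (Suc 0))))"
proof -
  note c = chain_complexD[OF acyclicD[OF a]]
  obtain J \<iota> \<pi> where k: "cut P d J \<iota> \<pi>" using acyclic_cut[OF a] by blast
  note kk = cutD[OF k]
  obtain Z z \<zeta> where z: "cut (tail_obj J P) (tail_ar \<pi> d) Z z \<zeta>" using acyclic_cut[OF kk(14)] by blast
  note kz = cutD[OF z]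
  obtain Y y \<eta> where y: "cut (tail_obj Z (tail_obj J P)) (tail_ar \<zeta> (tail_ar \<pi> d)) Y y \<eta>"
    using acyclic_cut[OF kz(14)] by blast
  note ky = cutD[OF y]
  have "zero_object C (Trg C y)" using ky(4) l[of 3] by (simp add: numeral_3_eq_3)
  then have "zero_object C Z" using zero_object_epi[OF ky(1)] kz(7) by simp
  then have "isomorphism C \<pi>" using Ses_iso_right[of z \<pi>] kz(1,3) by simp
  then obtain \<pi>' where p: "\<pi>' \<in> Ar C" "Src C \<pi>' = J" "Trg C \<pi>' = P (Suc (Suc 0))"
    "\<pi>' \<odot> \<pi> = Ident C (P (Suc (Suc 0)))" "\<pi> \<odot> \<pi>' = Ident C J"
    using isomorphismE[of \<pi>] kk(6,7) by metis
  have ip: "isomorphism C \<pi>'" by (rule isomorphismI[of _ \<pi>]) (use p kk in simp_all)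
  have s: "(d (Suc 0), d 0) \<in> Ses C"
    by (rule Ses_closed_iso[OF kk(1), of \<pi>' "Ident C (P (Suc 0))" "Ident C (P 0)"])
      (use p kk ip c in \<open>simp_all add: Hom_def\<close>)
  have "cut (tail_obj (P (Suc (Suc 0))) P) (tail_ar (Ident C (P (Suc (Suc 0)))) d) Z0
     (Zero C Z0 (P (Suc (Suc 0)))) (Zero C (P (Suc (Suc (Suc 0)))) Z0)"
    unfolding cut_def precut_def
  proof (intro conjI)
    show "acyclic_complex C (tail_obj Z0 (tail_obj (P (Suc (Suc 0))) P))
       (tail_ar (Zero C (P (Suc (Suc (Suc 0)))) Z0) (tail_ar (Ident C (P (Suc (Suc 0)))) d))"
    proof (rule acyclic_zero)
      fix n show "zero_object C (tail_obj Z0 (tail_obj (P (Suc (Suc 0))) P) n)"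
        by (cases n) (use l in auto)
      show "tail_ar (Zero C (P (Suc (Suc (Suc 0)))) Z0) (tail_ar (Ident C (P (Suc (Suc 0)))) d) n \<in>
        Hom C (tail_obj Z0 (tail_obj (P (Suc (Suc 0))) P) (Suc n)) (tail_obj Z0 (tail_obj (P (Suc (Suc 0))) P) n)"
        by (cases n) (use c in \<open>auto simp: Hom_def\<close>)
    qed
    have z3: "zero_object C (P (Suc (Suc (Suc 0))))" by (rule l) simp
    show "tail_ar (Ident C (P (Suc (Suc 0)))) d (Suc 0) =
      Zero C Z0 (P (Suc (Suc 0))) \<odot> Zero C (P (Suc (Suc (Suc 0)))) Z0"
      using from_zero_eq[OF z3, of "d (Suc (Suc 0))"] c by simp
  qed (use c Ses_iso_epi[of "Ident C (P (Suc (Suc 0)))"] in \<open>simp_all add: Hom_def\<close>)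
  then have "acyclic_complex C (tail_obj (P (Suc (Suc 0))) P) (tail_ar (Ident C (P (Suc (Suc 0)))) d)"
  proof (rule acyclic_uncut)
    have "zero_object C (tail_obj (P (Suc (Suc 0))) P n)" if "n > 1" for n
      using that l[of "Suc n"] by (cases n) auto
    then show "\<exists>b. \<forall>n>b. zero_object C (tail_obj (P (Suc (Suc 0))) P n)" by blast
  qed
  then show ?thesis unfolding cut_def precut_def using s c by (simp add: Hom_def)
qed

text \<open>Identities up to degree 2 and zero arrows between zero objects above form an
  isomorphism.\<close>

lemma nenashev_cx3:
  assumes R: "nenashev R 2" and P: "binary_acyclic C P" "len 2 P"
  defines "S \<equiv> cx3 (obj P 0) (obj P (Suc 0)) (obj P (Suc (Suc 0))) (top_diff P 0) (top_diff P (Suc 0))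
    (bot_diff P 0) (bot_diff P (Suc 0))"
  shows "frag_of S - frag_of P \<in> zspan R"
proof -
  note c = chain_complexD[OF binary_acyclicD(3)[OF P(1)]] chain_complexD[OF binary_acyclicD(4)[OF P(1)]]
  have l: "zero_object C (obj P n)" if "n > 2" for n using P(2) that unfolding len_def by simp
  have baS: "binary_acyclic C S"
    unfolding S_def
    by (rule binary_acyclic_cx3)
      (use cutD(1,4)[OF cut_length_two[OF binary_acyclicD(1)[OF P(1)] l]]
        cutD(1,4)[OF cut_length_two[OF binary_acyclicD(2)[OF P(1)] l]] c in simp_all)
  let ?a = "pickn (Ident C (obj P 0)) (Ident C (obj P (Suc 0))) (Ident C (obj P (Suc (Suc 0))))
    (\<lambda>n. Zero C Z0 (obj P (Suc (Suc (Suc n)))))"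
  show ?thesis
  proof (rule nenashev_iso[OF R _ P(2) baS P(1)])
    have iz: "isomorphism C (Zero C Z0 (obj P (Suc (Suc (Suc n)))))" for n
    proof -
      have "zero_object C (obj P (Suc (Suc (Suc n))))" by (rule l) simp
      then show ?thesis
        by (intro isomorphismI[of _ "Zero C (obj P (Suc (Suc (Suc n)))) Z0"]) (use zero_object_iff in simp_all)
    qed
    fix n
    show "isomorphism C (?a n)" by (rule all_nat3I[of _ n]) (use c iz in simp_all)
    show "?a n \<in> Hom C (obj S n) (obj P n)" by (rule all_nat3I[of _ n]) (use c in \<open>simp_all add: S_def Hom_def\<close>)
    show "?a n \<odot> top_diff S n = top_diff P n \<odot> ?a (Suc n)" "?a n \<odot> bot_diff S n = bot_diff P n \<odot> ?a (Suc n)"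
      by (rule all_nat3I[of _ n]; use c in \<open>simp add: S_def\<close>)+
  qed (simp add: S_def)
qed

text \<open>Here both kernels can be taken to be \<open>P 2\<close>, with \<pi> and \<rho> the
  identity, and the differentials out of degrees three and higher are zero arrows. Thus
  \<open>key_bses\<close> applies although \<open>P\<close> need not be diagonal.\<close>

lemma shorten_length_two:
  assumes R: "nenashev R 2" and P: "binary_acyclic C P" "len 2 P"
  shows "frag_of (shorten P) - frag_of P \<in> zspan R"
proof -
  let ?X = "obj P (Suc (Suc 0))"
  note c = chain_complexD[OF binary_acyclicD(3)[OF P(1)]] chain_complexD[OF binary_acyclicD(4)[OF P(1)]]
  have l: "zero_object C (obj P n)" if "n > 2" for n using P(2) that unfolding len_def by simp
  have t: "cut (obj P) (top_diff P) ?X (top_diff P (Suc 0)) (Ident C ?X)"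
    and b: "cut (obj P) (bot_diff P) ?X (bot_diff P (Suc 0)) (Ident C ?X)"
    using cut_length_two[OF binary_acyclicD(1)[OF P(1)] l] cut_length_two[OF binary_acyclicD(2)[OF P(1)] l] by blast+
  let ?Q = "Qs P ?X (top_diff P (Suc 0)) (Ident C ?X) ?X (bot_diff P (Suc 0)) (Ident C ?X)"
  have l3: "len (Suc 2) P" using len_mono[OF P(2)] by simp
  have 1: "frag_of (shorten P) - frag_of ?Q \<in> zspan R"
    by (rule shorten_Qs[OF _ P(1) l3 _ t b]) (use nenashev_bses[OF R] in auto)
  have eq: "top_diff P (Suc (Suc n)) = bot_diff P (Suc (Suc n))" for n
  proof -
    have z: "zero_object C (obj P (Suc (Suc (Suc n))))" by (rule l) simp
    show ?thesis using from_zero_eq[OF z, of "top_diff P (Suc (Suc n))"] from_zero_eq[OF z, of "bot_diff P (Suc (Suc n))"] c by simp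
  qed
  let ?S = "cx3 (obj P 0) (obj P (Suc 0)) ?X (top_diff P 0) (top_diff P (Suc 0)) (bot_diff P 0) (bot_diff P (Suc 0))"
  let ?F = "Rcx (obj P 0) (obj P (Suc 0)) ?X (top_diff P 0) (top_diff P (Suc 0)) (bot_diff P 0) (bot_diff P (Suc 0))"
  obtain E f g where E: "bses E ?Q ?F f g" "diagonal E" "obj E = tail_obj ?X (obj P)"
    using key_bses[OF P(1) t b eq] by blast
  have lE: "len 2 E"
    unfolding len_def
  proof (intro allI impI)
    fix n :: nat assume n: "2 < n"
    then obtain m where "n = Suc m" by (cases n) auto
    then show "zero_object C (obj E n)" using n l[of "Suc n"] unfolding E(3) by simp
  qed
  have "binary_acyclic C E" using E(1) unfolding dses_def by simp
  then have 2: "frag_of E \<in> zspan R" using nenashev_diag[OF R _ lE E(2)] by simp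
  have 3: "frag_of ?Q - frag_of E - frag_of ?F \<in> zspan R"
    by (rule nenashev_bses[OF R E(1)]) (use lE len_Qs[OF l3] in \<open>simp_all add: Rcx_def\<close>)
  have 4: "frag_of ?F - frag_of ?S \<in> zspan R"
    by (rule nenashev_Rcx[OF R]) (use cutD(1,4)[OF t] cutD(1,4)[OF b] c in simp_all)
  have 5: "frag_of ?S - frag_of P \<in> zspan R" by (rule nenashev_cx3[OF R P])
  have "(frag_of (shorten P) - frag_of ?Q) + ((frag_of ?Q - frag_of E - frag_of ?F) + frag_of E)
    + ((frag_of ?F - frag_of ?S) + (frag_of ?S - frag_of P)) \<in> zspan R"
    by (intro zspan_add 1 2 3 4 5)
  then show ?thesis by simp
qed

section \<open>Injectivity\<close>

abbreviation iter :: "nat \<Rightarrow> ('o, 'a) bcx \<Rightarrow> ('o, 'a) bcx" where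
  "iter k P \<equiv> (shorten ^^ k) P"

lemma binary_acyclic_iter: "binary_acyclic C P \<Longrightarrow> binary_acyclic C (iter k P)"
  by (induction k) (simp_all add: binary_acyclic_shorten)

lemma len_iter: "binary_acyclic C P \<Longrightarrow> len (k + b) P \<Longrightarrow> 2 \<le> b \<Longrightarrow> len b (iter k P)"
proof (induction k arbitrary: b)
  case (Suc k)
  have "len (Suc b) (iter k P)" by (rule Suc.IH) (use Suc.prems in simp_all)
  then show ?case using len_shorten[OF binary_acyclic_iter[OF Suc.prems(1)]] Suc.prems by simp
qed simp

lemma bses_iter: "bses A B D f g \<Longrightarrow> \<exists>f' g'. bses (iter k A) (iter k B) (iter k D) f' g'"
proof (induction k)
  case (Suc k)
  then obtain f' g' where "bses (iter k A) (iter k B) (iter k D) f' g'" by blast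
  then show ?case using bses_shorten by simp
qed auto

lemma dses_binary_acyclic:
  assumes "dses A B D f g f' g'"
  shows "binary_acyclic C A" "binary_acyclic C B" "binary_acyclic C D"
  using assms unfolding dses_def by auto

lemma iter_additive:
  assumes R: "nenashev R 2" and s: "bses A B D f g"
    and l: "len (k + 2) A" "len (k + 2) B" "len (k + 2) D"
  shows "frag_of (iter k B) - frag_of (iter k A) - frag_of (iter k D) \<in> zspan R"
proof -
  obtain f' g' where "bses (iter k A) (iter k B) (iter k D) f' g'" using bses_iter[OF s] by blast
  then show ?thesis
    by (rule nenashev_bses[OF R]) (use len_iter[where b = 2] dses_binary_acyclic[OF s] l in simp_all)
qed

lemma iter_length_two:
  assumes R: "nenashev R 2" and P: "binary_acyclic C P" "len 2 P"
  shows "frag_of (iter k P) - frag_of P \<in> zspan R"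
proof (induction k)
  case (Suc k)
  have "len 2 (iter k P)" by (rule len_iter) (use P len_mono in auto)
  then have "frag_of (shorten (iter k P)) - frag_of (iter k P) \<in> zspan R"
    using shorten_length_two[OF R] binary_acyclic_iter[OF P(1)] by blast
  from zspan_add[OF this Suc] show ?case by simp
qed simp

text \<open>\<open>shorten P\<close> is an extension of a trivial complex of length two by a
  diagonal complex with a smaller length bound. Additivity of the remaining shortenings reduces the
  claim to these two.\<close>

lemma iter_diag:
  assumes R: "nenashev R 2"
  shows "binary_acyclic C P \<Longrightarrow> len (k + 2) P \<Longrightarrow> diagonal P \<Longrightarrow> frag_of (iter k P) \<in> zspan R"
proof (induction k arbitrary: P)
  case 0
  then show ?case using nenashev_diag[OF R] by (simp add: numeral_2_eq_2)
next
  case (Suc k)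
  obtain E F f g where E: "bses E (shorten P) F f g" "diagonal E" "len (k + 2) E" "len 2 F" "frag_of F \<in> zspan R"
    using shorten_diag_bses[of P "k + 2"] Suc.prems R by auto
  note ba = dses_binary_acyclic[OF E(1)]
  have l: "len (k + 2) (shorten P)" using len_shorten[of P "k + 2"] Suc.prems by simp
  have "frag_of (iter k (shorten P)) - frag_of (iter k E) - frag_of (iter k F) \<in> zspan R"
    by (rule iter_additive[OF R E(1,3) l len_mono[OF E(4)]]) simp
  moreover have "frag_of (iter k E) \<in> zspan R" by (rule Suc.IH[OF ba(1) E(3,2)])
  moreover have "frag_of (iter k F) - frag_of F \<in> zspan R" by (rule iter_length_two[OF R ba(3) E(4)])
  ultimately have "(frag_of (iter k (shorten P)) - frag_of (iter k E) - frag_of (iter k F)) + frag_of (iter k E)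
    + ((frag_of (iter k F) - frag_of F) + frag_of F) \<in> zspan R"
    using E(5) by (intro zspan_add)
  then show ?case by (simp add: funpow_swap1)
qed

text \<open>The least such number is 0 on complexes of length two, which makes the left inverse the
  identity on generators.\<close>

definition stage :: "('o, 'a) bcx \<Rightarrow> nat" where
  "stage P = (LEAST k. len (k + 2) P)"

lemma stage:
  assumes "binary_acyclic C P"
  shows "len (stage P + 2) P"
proof -
  obtain b where "len b P" using binary_acyclic_len[OF assms] by blast
  then have "len (b + 2) P" using len_mono by simp
  then show ?thesis unfolding stage_def by (rule LeastI)
qed

text \<open>After \<open>stage P\<close> shortenings the complex has length two, and further ones
  preserve its class.\<close>

lemma iter_stage:
  assumes R: "nenashev R 2" and P: "binary_acyclic C P" "len (k + 2) P"
  shows "frag_of (iter k P) - frag_of (iter (stage P) P) \<in> zspan R"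
proof -
  have "stage P \<le> k" unfolding stage_def by (rule Least_le) (rule P)
  then obtain j where j: "k = j + stage P" by (metis add.commute le_iff_add)
  have "frag_of (iter j (iter (stage P) P)) - frag_of (iter (stage P) P) \<in> zspan R"
    by (rule iter_length_two[OF R binary_acyclic_iter[OF P(1)] len_iter[OF P(1) stage[OF P(1)]]]) simp
  then show ?thesis by (simp add: j funpow_add)
qed

text \<open>The linear extension of \<psi> sends the relators of \<open>K0_Omega\<close> into the
  span of those of \<open>K1N\<close>, and it fixes every combination of complexes of length
  two.\<close>

theorem K1N_injective:
  assumes x: "x \<in> carrier (free_Abelian_group (K1N_generators C))" "x \<in> zspan (K0_Omega_relators C)"
  shows "x \<in> zspan (K1N_relators C)"
proof -
  let ?R = "K1N_relators C"
  note R = nenashev_K1N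
  define \<psi> where "\<psi> = (\<lambda>P. frag_of (iter (stage P) P))"
  have "frag_extend \<psi> r \<in> zspan ?R" if "r \<in> K0_Omega_relators C" for r
  proof -
    from that consider (a) i p where "(i, p) \<in> Ses (Bq C)"
        "r = frag_of (Src (Bq C) p) - frag_of (Src (Bq C) i) - frag_of (Trg (Bq C) p)"
      | (b) P where "binary_acyclic C P" "diagonal P" "r = frag_of P"
      unfolding K0_Omega_relators_def K0_relators_def Bq_def by auto
    then show ?thesis
    proof cases
      case a
      obtain A B D f g where s: "bses A B D f g" and r: "r = frag_of B - frag_of A - frag_of D"
        using bses_of_Ses_Bq[OF a(1)] a(2) by metis
      note ba = dses_binary_acyclic[OF s]
      \<comment> \<open>Additivity needs the same number of shortenings for all three complexes;
        \<open>iter_stage\<close> leads back to the individual stages.\<close>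
      define k where "k = stage A + stage B + stage D"
      have l: "len (k + 2) A" "len (k + 2) B" "len (k + 2) D"
        using stage[OF ba(1)] stage[OF ba(2)] stage[OF ba(3)] by (auto elim!: len_mono simp: k_def)
      have "(frag_of (iter k B) - frag_of (iter k A) - frag_of (iter k D))
        - (frag_of (iter k B) - \<psi> B) + (frag_of (iter k A) - \<psi> A) + (frag_of (iter k D) - \<psi> D) \<in> zspan ?R"
        unfolding \<psi>_def
        by (intro zspan_add zspan_diff iter_additive[OF R s l] iter_stage[OF R ba(1) l(1)]
            iter_stage[OF R ba(2) l(2)] iter_stage[OF R ba(3) l(3)])
      then show ?thesis by (simp add: r frag_extend_diff)
    next
      case b
      then show ?thesis using iter_diag[OF R b(1) stage[OF b(1)] b(2)] by (simp add: \<psi>_def)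
    qed
  qed
  then have "frag_extend \<psi> x \<in> zspan ?R" using frag_extend_zspan x(2) by blast
  moreover have "frag_extend \<psi> x = frag_extend frag_of x"
  proof (rule frag_extend_eq)
    fix P assume "P \<in> Poly_Mapping.keys x"
    then have "len 2 P" using x(1) by (auto simp: K1N_generators_def length_two_len)
    then have "stage P = 0" unfolding stage_def by (intro Least_equality) (simp_all add: numeral_2_eq_2)
    then show "\<psi> P = frag_of P" by (simp add: \<psi>_def)
  qed
  ultimately show ?thesis using frag_expansion[of x] by simp
qed

section \<open>Total complexes\<close>

text \<open>Shifting puts no sign on the differentials; the sign needed in total complexes is placed
  in \<open>tot_diff\<close>.\<close>

definition sho :: "(nat \<Rightarrow> 'o) \<Rightarrow> nat \<Rightarrow> 'o" where
  "sho P = case_nat Z0 P"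

definition sha :: "(nat \<Rightarrow> 'o) \<Rightarrow> (nat \<Rightarrow> 'a) \<Rightarrow> nat \<Rightarrow> 'a" where
  "sha P d = case_nat (Zero C (P 0) Z0) d"

definition shm :: "(nat \<Rightarrow> 'a) \<Rightarrow> nat \<Rightarrow> 'a" where
  "shm f = case_nat (Zero C Z0 Z0) f"

lemma sh_simps[simp]:
  "sho P 0 = Z0" "sho P (Suc n) = P n" "sha P d 0 = Zero C (P 0) Z0" "sha P d (Suc n) = d n"
  "shm f 0 = Zero C Z0 Z0" "shm f (Suc n) = f n"
  by (simp_all add: sho_def sha_def shm_def)

lemma acyclic_shift:
  assumes "acyclic_complex C P d"
  shows "acyclic_complex C (sho P) (sha P d)"
proof -
  obtain J i p where z: "zero_object C (J 0)"
    and h: "\<And>n. i n \<in> Hom C (J (Suc n)) (P n)" "\<And>n. p n \<in> Hom C (P n) (J n)"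
    and s: "\<And>n. (i n, p n) \<in> Ses C" and d: "\<And>n. d n = i n \<odot> p (Suc n)"
    using assms unfolding acyclic_complex_def by blast
  have O: "J 0 \<in> Ob C" using zero_objectD[OF z] .
  have iz: "isomorphism C (Zero C (J 0) Z0)"
    using z O zero_object_iff[of "J 0"] by (intro isomorphismI[of _ "Zero C Z0 (J 0)"]) simp_all
  obtain b where b: "\<forall>n>b. zero_object C (P n)" using acyclic_bounded[OF assms] by blast
  show ?thesis
  proof (rule acyclicI[of _ "sho J" "case_nat (Zero C (J 0) Z0) i" "case_nat (Zero C Z0 Z0) p"])
    have "zero_object C (sho P n)" if "n > Suc b" for n using that b by (cases n) auto
    then show "\<exists>b. \<forall>n>b. zero_object C (sho P n)" by blast
  next
    fix n
    show "case_nat (Zero C (J 0) Z0) i n \<in> Hom C (sho J (Suc n)) (sho P n)"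
      "case_nat (Zero C Z0 Z0) p n \<in> Hom C (sho P n) (sho J n)"
      using h O by (cases n; simp add: Hom_def)+
    show "(case_nat (Zero C (J 0) Z0) i n, case_nat (Zero C Z0 Z0) p n) \<in> Ses C"
      using s Ses_iso_mono[OF iz] O by (cases n) simp_all
    show "sha P d n = case_nat (Zero C (J 0) Z0) i n \<odot> case_nat (Zero C Z0 Z0) p (Suc n)"
      using d h[of 0] O by (cases n) (simp_all add: Hom_def)
  qed simp
qed

lemma chain_shift:
  assumes "chain_complex C P d"
  shows "chain_complex C (sho P) (sha P d)"
proof -
  note c = chain_complexD[OF assms]
  obtain b where b: "\<forall>n>b. zero_object C (P n)" using c(6) by blast
  have "zero_object C (sho P n)" if "n > Suc b" for n using that b by (cases n) auto
  then have "\<exists>b. \<forall>n>b. zero_object C (sho P n)" by blast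
  moreover have "sho P n \<in> Ob C" "sha P d n \<in> Hom C (sho P (Suc n)) (sho P n)"
    "sha P d n \<odot> sha P d (Suc n) = Zero C (sho P (Suc (Suc n))) (sho P n)" for n
    using c(1-5) by (cases n; simp add: Hom_def)+
  ultimately show ?thesis unfolding chain_complex_def by blast
qed

lemma ses_cx_shift:
  assumes "ses_cx A dA B dB D dD f g"
    "chain_complex C A dA" "chain_complex C B dB" "chain_complex C D dD"
  shows "ses_cx (sho A) (sha A dA) (sho B) (sha B dB) (sho D) (sha D dD) (shm f) (shm g)"
  unfolding ses_cx_def
  by (rule all_natI)
    (use ses_cxD[OF assms(1)] Ses_zero_zero[of Z0] chain_complexD(1)[OF assms(2)] chain_complexD(1)[OF assms(3)]
      chain_complexD(1)[OF assms(4)] in simp_all)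

definition tot_obj :: "(nat \<Rightarrow> 'o) \<Rightarrow> (nat \<Rightarrow> 'o) \<Rightarrow> (nat \<Rightarrow> 'o) \<Rightarrow> nat \<Rightarrow> 'o" where
  "tot_obj A B D n = D n \<oplus>\<oplus> (sho B n \<oplus>\<oplus> sho (sho A) n)"

text \<open>The total complex of three rows, \<open>D\<close> in degree 0, \<open>B\<close> in degree 1 and \<open>A\<close> in degree 2;
  the sign sits on the differential of the middle row.\<close>

definition tot_diff :: "(nat \<Rightarrow> 'o) \<Rightarrow> (nat \<Rightarrow> 'a) \<Rightarrow> (nat \<Rightarrow> 'o) \<Rightarrow> (nat \<Rightarrow> 'a) \<Rightarrow>
    (nat \<Rightarrow> 'o) \<Rightarrow> (nat \<Rightarrow> 'a) \<Rightarrow> (nat \<Rightarrow> 'a) \<Rightarrow> (nat \<Rightarrow> 'a) \<Rightarrow> nat \<Rightarrow> 'a" where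
  "tot_diff A dA B dB D dD f g n =
     cp (pr (dD n) (Zero C (D (Suc n)) (sho B n \<oplus>\<oplus> sho (sho A) n)))
       (cp (pr (g n) (pr (ng (sha B dB n)) (Zero C (B n) (sho (sho A) n))))
         (pr (Zero C (sho A n) (D n)) (pr (shm f n) (sha (sho A) (sha A dA) n))))"

text \<open>The differential on the quotient of the total complex by the row
  \<open>D\<close>.\<close>

definition tot1_diff :: "(nat \<Rightarrow> 'o) \<Rightarrow> (nat \<Rightarrow> 'a) \<Rightarrow> (nat \<Rightarrow> 'o) \<Rightarrow> (nat \<Rightarrow> 'a) \<Rightarrow>
    (nat \<Rightarrow> 'a) \<Rightarrow> nat \<Rightarrow> 'a" where
  "tot1_diff A dA B dB f n = cp (pr (ng (sha B dB n)) (Zero C (B n) (sho (sho A) n)))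
         (pr (shm f n) (sha (sho A) (sha A dA) n))"

lemma zero_object_dsum: "zero_object C X \<Longrightarrow> zero_object C Y \<Longrightarrow> zero_object C (X \<oplus>\<oplus> Y)"
  using zero_object_iff by (simp add: Ident_dsum)

lemma tot_chain:
  assumes s: "ses_cx A dA B dB D dD f g"
    and A: "chain_complex C A dA" and B: "chain_complex C B dB" and D: "chain_complex C D dD"
  shows "chain_complex C (tot_obj A B D) (tot_diff A dA B dB D dD f g)"
proof -
  note t = ses_cxD[OF s] and SesD(4)[OF ses_cxD(1)[OF s]]
  note cA = chain_complexD(1-5)[OF A] and cB = chain_complexD(1-5)[OF B] and cD = chain_complexD(1-5)[OF D]
  obtain a b c where z: "\<And>n. n > a \<Longrightarrow> zero_object C (sho (sho A) n)" "\<And>n. n > b \<Longrightarrow> zero_object C (sho B n)"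
    "\<And>n. n > c \<Longrightarrow> zero_object C (D n)"
    using chain_complexD(6)[OF chain_shift[OF chain_shift[OF A]]] chain_complexD(6)[OF chain_shift[OF B]]
      chain_complexD(6)[OF D] by blast
  have gf: "g n \<odot> f n = Zero C (A n) (D n)" for n using SesD(4)[OF t(1)[of n]] t by simp
  have "\<exists>m. \<forall>n>m. zero_object C (tot_obj A B D n)"
    by (intro exI[of _ "a + b + c"]) (auto simp: tot_obj_def intro!: zero_object_dsum z)
  moreover have "tot_obj A B D n \<in> Ob C" "tot_diff A dA B dB D dD f g n \<in> Hom C (tot_obj A B D (Suc n)) (tot_obj A B D n)"
    "tot_diff A dA B dB D dD f g n \<odot> tot_diff A dA B dB D dD f g (Suc n) =
      Zero C (tot_obj A B D (Suc (Suc n))) (tot_obj A B D n)" for n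
    by (rule all_nat3I[of _ n]; use cA cB cD t(2-7) t(8,9)[symmetric] gf in \<open>simp add: tot_obj_def tot_diff_def Hom_def\<close>)+
  ultimately show ?thesis unfolding chain_complex_def by blast
qed

text \<open>Vertical arrows only lead to lower rows, so the lower rows form subcomplexes; the pieces
  of this filtration are the rows, shifted by their index.\<close>

lemma tot_rows:
  assumes s: "ses_cx A dA B dB D dD f g"
    and A: "chain_complex C A dA" and B: "chain_complex C B dB" and D: "chain_complex C D dD"
  shows "ses_cx D dD (tot_obj A B D) (tot_diff A dA B dB D dD f g)
      (\<lambda>n. sho B n \<oplus>\<oplus> sho (sho A) n) (tot1_diff A dA B dB f)
      (\<lambda>n. pr (Ident C (D n)) (Zero C (D n) (sho B n \<oplus>\<oplus> sho (sho A) n)))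
      (\<lambda>n. cp (Zero C (D n) (sho B n \<oplus>\<oplus> sho (sho A) n)) (Ident C (sho B n \<oplus>\<oplus> sho (sho A) n)))" (is ?th1)
    and "ses_cx (sho B) (\<lambda>n. ng (sha B dB n)) (\<lambda>n. sho B n \<oplus>\<oplus> sho (sho A) n) (tot1_diff A dA B dB f)
      (sho (sho A)) (sha (sho A) (sha A dA))
      (\<lambda>n. pr (Ident C (sho B n)) (Zero C (sho B n) (sho (sho A) n)))
      (\<lambda>n. cp (Zero C (sho B n) (sho (sho A) n)) (Ident C (sho (sho A) n)))" (is ?th2)
    and "chain_complex C (\<lambda>n. sho B n \<oplus>\<oplus> sho (sho A) n) (tot1_diff A dA B dB f)" (is ?th3)
proof -
  note t = ses_cxD[OF s]
  note cB = chain_complexD(1-5)[OF chain_shift[OF B]] and cA = chain_complexD(1-5)[OF chain_shift[OF chain_shift[OF A]]]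
    and cD = chain_complexD(1-5)[OF D] and cA0 = chain_complexD(1)[OF chain_shift[OF A]]
  have cB': "sha B dB n \<in> Ar C" "Src C (sha B dB n) = B n" "Trg C (sha B dB n) = sho B n"
    and cA': "sha (sho A) (sha A dA) n \<in> Ar C" "Src C (sha (sho A) (sha A dA) n) = sho A n"
      "Trg C (sha (sho A) (sha A dA) n) = sho (sho A) n" for n using cB(2-4)[of n] cA(2-4)[of n] by auto
  have f: "shm f n \<in> Ar C" "Src C (shm f n) = sho A n" "Trg C (shm f n) = sho B n" for n
    using t(2,4,5) by (cases n; simp)+
  show ?th1
    unfolding ses_cx_def
    using Ses_in1_pr2 cA(1) cB(1) cD cA' cB' f t(2-7) cA0 chain_complexD(1)[OF B]
    by (simp add: tot_obj_def tot_diff_def tot1_diff_def)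
  show ?th2
    unfolding ses_cx_def
    using Ses_in1_pr2 cA(1) cB(1) cA' cB' f t(2-7) cA0 chain_complexD(1)[OF B]
    by (simp add: tot1_diff_def)
  obtain a b where z: "\<And>n. n > a \<Longrightarrow> zero_object C (sho (sho A) n)" "\<And>n. n > b \<Longrightarrow> zero_object C (sho B n)"
    using chain_complexD(6)[OF chain_shift[OF chain_shift[OF A]]] chain_complexD(6)[OF chain_shift[OF B]] by blast
  have "\<exists>m. \<forall>n>m. zero_object C (sho B n \<oplus>\<oplus> sho (sho A) n)"
    by (intro exI[of _ "a + b"]) (auto intro!: zero_object_dsum z)
  moreover have "sho B n \<oplus>\<oplus> sho (sho A) n \<in> Ob C"
    "tot1_diff A dA B dB f n \<in> Hom C (sho B (Suc n) \<oplus>\<oplus> sho (sho A) (Suc n)) (sho B n \<oplus>\<oplus> sho (sho A) n)"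
    "tot1_diff A dA B dB f n \<odot> tot1_diff A dA B dB f (Suc n) =
      Zero C (sho B (Suc (Suc n)) \<oplus>\<oplus> sho (sho A) (Suc (Suc n))) (sho B n \<oplus>\<oplus> sho (sho A) n)" for n
    by (rule all_nat3I[of _ n]; use chain_complexD(1-5)[OF A] chain_complexD(1-5)[OF B] t(2-7) t(8)[symmetric] in \<open>simp add: tot1_diff_def Hom_def\<close>)+
  ultimately show ?th3 unfolding chain_complex_def by blast
qed

text \<open>Horizontal arrows only lead to lower columns, so column 0 is a subcomplex, in degrees 0,
  1 and 2. The other columns start one degree higher, whence the shift of the truncated total
  complex.\<close>

lemma tot_cols:
  assumes s: "ses_cx A dA B dB D dD f g"
    and A: "chain_complex C A dA" and B: "chain_complex C B dB" and D: "chain_complex C D dD"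
  defines "T \<equiv> tot_obj (\<lambda>n. A (Suc n)) (\<lambda>n. B (Suc n)) (\<lambda>n. D (Suc n))"
  shows "ses_cx (pick3 (D 0) (B 0) (A 0) Z0) (pick3 (g 0) (f 0) (Zero C Z0 (A 0)) (Zero C Z0 Z0))
     (tot_obj A B D) (tot_diff A dA B dB D dD f g)
     (sho T) (sha T (tot_diff (\<lambda>n. A (Suc n)) (\<lambda>n. dA (Suc n)) (\<lambda>n. B (Suc n)) (\<lambda>n. dB (Suc n))
        (\<lambda>n. D (Suc n)) (\<lambda>n. dD (Suc n)) (\<lambda>n. f (Suc n)) (\<lambda>n. g (Suc n))))
     (pickn (pr (Ident C (D 0)) (Zero C (D 0) (Z0 \<oplus>\<oplus> Z0)))
        (pr (Zero C (B 0) (D (Suc 0))) (pr (Ident C (B 0)) (Zero C (B 0) Z0)))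
        (pr (Zero C (A 0) (D (Suc (Suc 0)))) (pr (Zero C (A 0) (B (Suc 0))) (Ident C (A 0))))
        (\<lambda>n. Zero C Z0 (tot_obj A B D (Suc (Suc (Suc n))))))
     (pickn (Zero C (D 0 \<oplus>\<oplus> (Z0 \<oplus>\<oplus> Z0)) Z0)
        (dg (Ident C (D (Suc 0))) (dg (Zero C (B 0) Z0) (Zero C Z0 Z0)))
        (dg (Ident C (D (Suc (Suc 0)))) (dg (Ident C (B (Suc 0))) (Zero C (A 0) Z0)))
        (\<lambda>n. Ident C (tot_obj A B D (Suc (Suc (Suc n))))))" (is "ses_cx ?c ?dc ?t ?dt ?s ?ds ?f ?g")
proof -
  note t = ses_cxD[OF s]
  note cA = chain_complexD(1-5)[OF A] and cB = chain_complexD(1-5)[OF B] and cD = chain_complexD(1-5)[OF D]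
  have TO: "D n \<oplus>\<oplus> (B m \<oplus>\<oplus> A k) \<in> Ob C" for n m k using cA(1) cB(1) cD(1) by simp
  have gf: "g n \<odot> f n = Zero C (A n) (D n)" for n using SesD(4)[OF t(1)[of n]] t by simp
  have "(?f n, ?g n) \<in> Ses C" for n
  proof (rule all_nat3I[of _ n])
    show "(?f 0, ?g 0) \<in> Ses C"
      by (rule Ses_split[of _ _ "Zero C Z0 (D 0 \<oplus>\<oplus> (Z0 \<oplus>\<oplus> Z0))" "cp (Ident C (D 0)) (Zero C (Z0 \<oplus>\<oplus> Z0) (D 0))"])
        (use cD in \<open>simp_all add: Ident_dsum\<close>)
    show "(?f (Suc 0), ?g (Suc 0)) \<in> Ses C"
      by (rule Ses_split[of _ _ "dg (Ident C (D (Suc 0))) (dg (Zero C Z0 (B 0)) (Zero C Z0 Z0))"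
          "cp (Zero C (D (Suc 0)) (B 0)) (cp (Ident C (B 0)) (Zero C Z0 (B 0)))"])
        (use cD cB in \<open>simp_all add: dg_def Ident_dsum\<close>)
    show "(?f (Suc (Suc 0)), ?g (Suc (Suc 0))) \<in> Ses C"
      by (rule Ses_split[of _ _ "dg (Ident C (D (Suc (Suc 0)))) (dg (Ident C (B (Suc 0))) (Zero C Z0 (A 0)))"
          "cp (Zero C (D (Suc (Suc 0))) (A 0)) (cp (Zero C (B (Suc 0)) (A 0)) (Ident C (A 0)))"])
        (use cD cB cA in \<open>simp_all add: dg_def Ident_dsum\<close>)
    fix n show "(?f (Suc (Suc (Suc n))), ?g (Suc (Suc (Suc n)))) \<in> Ses C"
      using Ses_iso_epi[of "Ident C (tot_obj A B D (Suc (Suc (Suc n))))"] TO by (simp add: tot_obj_def)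
  qed
  moreover have "Src C (?f n) = ?c n" "Trg C (?f n) = ?t n" "Trg C (?g n) = ?s n" for n
    by (rule all_nat3I[of _ n]; use cA cB cD in \<open>simp add: T_def tot_obj_def\<close>)+
  moreover have "?f n \<odot> ?dc n = ?dt n \<odot> ?f (Suc n)" for n
    by (rule all_nat3I[of _ n]; use cA cB cD t gf in \<open>simp add: tot_obj_def tot_diff_def\<close>)
  moreover have "?g n \<odot> ?dt n = ?ds n \<odot> ?g (Suc n)" for n
  proof (rule all_nat3I[of _ n])
    show "?g (Suc (Suc 0)) \<odot> ?dt (Suc (Suc 0)) = ?ds (Suc (Suc 0)) \<odot> ?g (Suc (Suc (Suc 0)))"
      using cA cB cD t(2-7) by (simp add: tot_obj_def tot_diff_def T_def dg_def)
    fix n show "?g (Suc (Suc (Suc n))) \<odot> ?dt (Suc (Suc (Suc n))) = ?ds (Suc (Suc (Suc n))) \<odot> ?g (Suc (Suc (Suc (Suc n))))"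
      using cA cB cD t(2-7) by (simp add: tot_obj_def tot_diff_def T_def)
  qed (use cA cB cD t(2-7) in \<open>simp_all add: tot_obj_def tot_diff_def T_def dg_def\<close>)
  ultimately show ?thesis unfolding ses_cx_def by blast
qed

section \<open>Total complexes of binary double complexes and their two filtrations\<close>

abbreviation "RG \<equiv> K0_Omega_relators C"

definition shift :: "('o, 'a) bcx \<Rightarrow> ('o, 'a) bcx" where
  "shift P = \<lparr>obj = sho (obj P), top_diff = sha (obj P) (top_diff P), bot_diff = sha (obj P) (bot_diff P)\<rparr>"

lemma shift_simps[simp]:
  "obj (shift P) = sho (obj P)" "top_diff (shift P) = sha (obj P) (top_diff P)"
  "bot_diff (shift P) = sha (obj P) (bot_diff P)"
  by (simp_all add: shift_def)

definition opp :: "('o, 'a) bcx \<Rightarrow> ('o, 'a) bcx" where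
  "opp P = \<lparr>obj = obj P, top_diff = bot_diff P, bot_diff = top_diff P\<rparr>"

lemma opp_simps[simp]:
  "obj (opp P) = obj P" "top_diff (opp P) = bot_diff P" "bot_diff (opp P) = top_diff P"
  by (simp_all add: opp_def)

lemma opp[simp]: "binary_acyclic C P \<Longrightarrow> binary_acyclic C (opp P)" "len b (opp P) \<longleftrightarrow> len b P"
  by (simp_all add: binary_acyclic_def len_def)

lemma binary_acyclic_shift: "binary_acyclic C P \<Longrightarrow> binary_acyclic C (shift P)"
  by (simp add: binary_acyclic_def acyclic_shift)

lemma diagonal_shift: "diagonal P \<Longrightarrow> diagonal (shift P)"
  by (simp add: diagonal_def)

lemma bses_shift:
  assumes "bses A B D f g"
  shows "bses (shift A) (shift B) (shift D) (shm f) (shm g)"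
  using assms ses_cx_shift binary_acyclic_shift binary_acyclicD(3,4) unfolding dses_def by simp

lemma diagonal_zero:
  assumes "binary_acyclic C P" "\<And>n. zero_object C (obj P n)"
  shows "diagonal P"
  unfolding diagonal_def
proof
  fix n
  note c = chain_complexD[OF binary_acyclicD(3)[OF assms(1)]] chain_complexD[OF binary_acyclicD(4)[OF assms(1)]]
  show "top_diff P n = bot_diff P n"
    using to_zero_eq[OF assms(2)[of n], of "top_diff P n"] to_zero_eq[OF assms(2)[of n], of "bot_diff P n"] c by simp
qed

lemma G_zero: "binary_acyclic C P \<Longrightarrow> (\<And>n. zero_object C (obj P n)) \<Longrightarrow> frag_of P \<in> zspan RG"
  using G_diag diagonal_zero by blast

lemma G_iso:
  assumes "binary_acyclic C P" "binary_acyclic C Q"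
    "\<And>n. isomorphism C (\<alpha> n)" "\<And>n. \<alpha> n \<in> Hom C (obj P n) (obj Q n)"
    "\<And>n. \<alpha> n \<odot> top_diff P n = top_diff Q n \<odot> \<alpha> (Suc n)"
    "\<And>n. \<alpha> n \<odot> bot_diff P n = bot_diff Q n \<odot> \<alpha> (Suc n)"
  shows "frag_of P - frag_of Q \<in> zspan RG"
proof -
  have "bses ZC P Q (\<lambda>n. Zero C Z0 (obj P n)) \<alpha>" by (rule dses_isoI) (use assms in auto)
  then have "frag_of P - frag_of ZC - frag_of Q \<in> zspan RG" by (rule G_bses)
  then have "(frag_of P - frag_of ZC - frag_of Q) + frag_of ZC \<in> zspan RG"
    by (rule zspan_add) (simp add: G_diag)
  then show ?thesis by (simp add: algebra_simps)
qed

text \<open>Unlike in \<open>dses\<close>, only the columns are required to be acyclic.\<close>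

definition tri :: "('o, 'a) bcx \<Rightarrow> ('o, 'a) bcx \<Rightarrow> ('o, 'a) bcx \<Rightarrow>
    (nat \<Rightarrow> 'a) \<Rightarrow> (nat \<Rightarrow> 'a) \<Rightarrow> (nat \<Rightarrow> 'a) \<Rightarrow> (nat \<Rightarrow> 'a) \<Rightarrow> bool" where
  "tri A B D f g f' g' \<longleftrightarrow>
     (\<forall>P\<in>{A, B, D}. chain_complex C (obj P) (top_diff P) \<and> chain_complex C (obj P) (bot_diff P)) \<and>
     ses_cx (obj A) (top_diff A) (obj B) (top_diff B) (obj D) (top_diff D) f g \<and>
     ses_cx (obj A) (bot_diff A) (obj B) (bot_diff B) (obj D) (bot_diff D) f' g'"

lemma tri_dses: "dses A B D f g f' g' \<Longrightarrow> tri A B D f g f' g'"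
  unfolding dses_def tri_def using binary_acyclicD(3,4) by blast

definition tl :: "('o, 'a) bcx \<Rightarrow> ('o, 'a) bcx" where
  "tl P = \<lparr>obj = \<lambda>n. obj P (Suc n), top_diff = \<lambda>n. top_diff P (Suc n), bot_diff = \<lambda>n. bot_diff P (Suc n)\<rparr>"

lemma tl_simps[simp]:
  "obj (tl P) = (\<lambda>n. obj P (Suc n))" "top_diff (tl P) = (\<lambda>n. top_diff P (Suc n))"
  "bot_diff (tl P) = (\<lambda>n. bot_diff P (Suc n))"
  by (simp_all add: tl_def)

abbreviation up :: "(nat \<Rightarrow> 'a) \<Rightarrow> nat \<Rightarrow> 'a" where
  "up f \<equiv> \<lambda>n. f (Suc n)"

lemma chain_up:
  assumes "chain_complex C P d"
  shows "chain_complex C (\<lambda>n. P (Suc n)) (up d)"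
proof -
  obtain b where "\<forall>n>b. zero_object C (P n)" using chain_complexD(6)[OF assms] by blast
  then have "\<exists>b. \<forall>n>b. zero_object C (P (Suc n))" by (intro exI[of _ b]) auto
  then show ?thesis using chain_complexD(1-5)[OF assms] unfolding chain_complex_def by (simp add: Hom_def)
qed

text \<open>Dropping column 0 destroys the exactness of the rows in general but keeps the columns;
  hence the inductions over columns run with \<open>tri\<close> instead of
  \<open>dses\<close>.\<close>

lemma tri_tl:
  assumes "tri A B D f g f' g'"
  shows "tri (tl A) (tl B) (tl D) (up f) (up g) (up f') (up g')"
  using assms unfolding tri_def ses_cx_def by (auto intro: chain_up)

definition Tot :: "('o, 'a) bcx \<Rightarrow> ('o, 'a) bcx \<Rightarrow> ('o, 'a) bcx \<Rightarrow>
    (nat \<Rightarrow> 'a) \<Rightarrow> (nat \<Rightarrow> 'a) \<Rightarrow> (nat \<Rightarrow> 'a) \<Rightarrow> (nat \<Rightarrow> 'a) \<Rightarrow> ('o, 'a) bcx" where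
  "Tot A B D f g f' g' = \<lparr>obj = tot_obj (obj A) (obj B) (obj D),
     top_diff = tot_diff (obj A) (top_diff A) (obj B) (top_diff B) (obj D) (top_diff D) f g,
     bot_diff = tot_diff (obj A) (bot_diff A) (obj B) (bot_diff B) (obj D) (bot_diff D) f' g'\<rparr>"

lemma Tot_simps[simp]:
  "obj (Tot A B D f g f' g') = tot_obj (obj A) (obj B) (obj D)"
  "top_diff (Tot A B D f g f' g') = tot_diff (obj A) (top_diff A) (obj B) (top_diff B) (obj D) (top_diff D) f g"
  "bot_diff (Tot A B D f g f' g') = tot_diff (obj A) (bot_diff A) (obj B) (bot_diff B) (obj D) (bot_diff D) f' g'"
  by (simp_all add: Tot_def)

definition rows_below :: "nat \<Rightarrow> ('o, 'a) bcx \<Rightarrow> ('o, 'a) bcx \<Rightarrow> ('o, 'a) bcx \<Rightarrow> bool" where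
  "rows_below b A B D \<longleftrightarrow> (\<forall>n\<ge>b. zero_object C (obj A n) \<and> zero_object C (obj B n) \<and> zero_object C (obj D n))"

lemma rows_below_tl: "rows_below (Suc b) A B D \<Longrightarrow> rows_below b (tl A) (tl B) (tl D)"
  unfolding rows_below_def by simp

lemma rows_below_ex:
  assumes "tri A B D f g f' g'"
  shows "\<exists>b. rows_below b A B D"
proof -
  obtain a b c where "\<forall>n>a. zero_object C (obj A n)" "\<forall>n>b. zero_object C (obj B n)" "\<forall>n>c. zero_object C (obj D n)"
    using assms chain_complexD(6) unfolding tri_def by (metis insert_iff)
  then have "rows_below (a + b + c + 1) A B D" unfolding rows_below_def by auto
  then show ?thesis by blast
qed

lemma zero_Tot:
  assumes "rows_below 0 A B D"
  shows "zero_object C (obj (Tot A B D f g f' g') n)"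
  using assms unfolding rows_below_def
  by (rule_tac n=n in all_nat3I) (simp_all add: tot_obj_def zero_object_dsum)

text \<open>Acyclicity of the truncated total complex is a hypothesis, so that this can be the
  induction step of \<open>binary_acyclic_Tot\<close>.\<close>

lemma Tot_cols:
  assumes t: "tri A B D f g f' g'" and b: "binary_acyclic C (Tot (tl A) (tl B) (tl D) (up f) (up g) (up f') (up g'))"
  shows "\<exists>F G. bses (dcol A B D f g f' g' 0) (Tot A B D f g f' g')
    (shift (Tot (tl A) (tl B) (tl D) (up f) (up g) (up f') (up g'))) F G"
proof -
  have s: "ses_cx (obj A) (top_diff A) (obj B) (top_diff B) (obj D) (top_diff D) f g"
    and s': "ses_cx (obj A) (bot_diff A) (obj B) (bot_diff B) (obj D) (bot_diff D) f' g'"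
    and c: "chain_complex C (obj A) (top_diff A)" "chain_complex C (obj B) (top_diff B)" "chain_complex C (obj D) (top_diff D)"
    and c': "chain_complex C (obj A) (bot_diff A)" "chain_complex C (obj B) (bot_diff B)" "chain_complex C (obj D) (bot_diff D)"
    using t unfolding tri_def by auto
  note r = tot_cols[OF s c] and r' = tot_cols[OF s' c']
  note bs = binary_acyclic_shift[OF b]
  have "binary_acyclic C (dcol A B D f g f' g' 0)"
    unfolding dcol_def by (rule binary_acyclic_cx3) (use ses_cxD[OF s] ses_cxD[OF s'] in simp_all)
  moreover have "binary_acyclic C (Tot A B D f g f' g')"
    unfolding binary_acyclic_def Tot_simps
    using acyclic_extension[OF r _ _ tot_chain[OF s c]] acyclic_extension[OF r' _ _ tot_chain[OF s' c']]
      bs calculation unfolding binary_acyclic_def by (simp add: dcol_def)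
  ultimately show ?thesis
    using bs r r' unfolding dses_def by (simp add: dcol_def) blast
qed

text \<open>Induction on the number of columns: the total complex is an extension of a shifted
  smaller one by its first column, and both are acyclic.\<close>

lemma binary_acyclic_Tot:
  assumes "tri A B D f g f' g'"
  shows "binary_acyclic C (Tot A B D f g f' g')"
proof -
  have "rows_below b A B D \<Longrightarrow> tri A B D f g f' g' \<Longrightarrow> ?thesis" for b
  proof (induction b arbitrary: A B D f g f' g')
    case 0
    then show ?case
      using chain_complexD(2-4)[OF tot_chain] unfolding tri_def
      by (intro binary_acyclic_zero zero_Tot) (auto simp: Hom_def)
  next
    case (Suc b)
    then have "binary_acyclic C (Tot (tl A) (tl B) (tl D) (up f) (up g) (up f') (up g'))"
      using rows_below_tl tri_tl by blast
    then show ?case using Tot_cols[OF Suc.prems(2)] dses_binary_acyclic(2) by blast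
  qed
  then show ?thesis using rows_below_ex[OF assms] assms by blast
qed

lemma Tot_cols_bses:
  assumes "tri A B D f g f' g'"
  shows "\<exists>F G. bses (dcol A B D f g f' g' 0) (Tot A B D f g f' g')
    (shift (Tot (tl A) (tl B) (tl D) (up f) (up g) (up f') (up g'))) F G"
  using Tot_cols[OF assms binary_acyclic_Tot[OF tri_tl[OF assms]]] .

lemma bses_shift_iter: "bses A B D f g \<Longrightarrow> \<exists>f' g'. bses ((shift ^^ j) A) ((shift ^^ j) B) ((shift ^^ j) D) f' g'"
proof (induction j)
  case (Suc j)
  then obtain f' g' where "bses ((shift ^^ j) A) ((shift ^^ j) B) ((shift ^^ j) D) f' g'" by blast
  from bses_shift[OF this] show ?case by auto
qed auto

lemma shift_iter:
  "binary_acyclic C P \<Longrightarrow> binary_acyclic C ((shift ^^ j) P)" "diagonal P \<Longrightarrow> diagonal ((shift ^^ j) P)"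
  by (induction j) (simp_all add: binary_acyclic_shift diagonal_shift)

text \<open>All columns are diagonal, so every piece of the filtration by columns vanishes. Shifts
  accumulate along the filtration; the claim is stated for all \<open>j\<close> because
  \<open>shift_neg\<close> is itself deduced from it.\<close>

lemma Tot_diag:
  assumes "tri A B D f g f g"
  shows "frag_of ((shift ^^ j) (Tot A B D f g f g)) \<in> zspan RG"
proof -
  have "rows_below b A B D \<Longrightarrow> tri A B D f g f g \<Longrightarrow> ?thesis" for b
  proof (induction b arbitrary: A B D f g j)
    case 0
    have "diagonal (Tot A B D f g f g)"
      by (rule diagonal_zero[OF binary_acyclic_Tot[OF 0(2)] zero_Tot[OF 0(1)]])
    then show ?case using G_diag shift_iter binary_acyclic_Tot[OF 0(2)] by blast
  next
    case (Suc b)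
    let ?T = "Tot (tl A) (tl B) (tl D) (up f) (up g) (up f) (up g)"
    obtain F G where 1: "bses (dcol A B D f g f g 0) (Tot A B D f g f g) (shift ?T) F G"
      using Tot_cols_bses[OF Suc.prems(2)] by blast
    obtain F' G' where "bses ((shift ^^ j) (dcol A B D f g f g 0)) ((shift ^^ j) (Tot A B D f g f g)) ((shift ^^ j) (shift ?T)) F' G'"
      using bses_shift_iter[OF 1] by blast
    then have "frag_of ((shift ^^ j) (Tot A B D f g f g)) - frag_of ((shift ^^ j) (dcol A B D f g f g 0))
        - frag_of ((shift ^^ j) (shift ?T)) \<in> zspan RG" by (rule G_bses)
    moreover have "frag_of ((shift ^^ j) (dcol A B D f g f g 0)) \<in> zspan RG"
      using G_diag shift_iter dses_binary_acyclic(1)[OF 1] diagonal_dcol by blast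
    moreover have "frag_of ((shift ^^ j) (shift ?T)) \<in> zspan RG"
      using Suc.IH[OF rows_below_tl[OF Suc.prems(1)] tri_tl[OF Suc.prems(2)], of "Suc j"] by (simp add: funpow_swap1)
    ultimately have "(frag_of ((shift ^^ j) (Tot A B D f g f g)) - frag_of ((shift ^^ j) (dcol A B D f g f g 0))
        - frag_of ((shift ^^ j) (shift ?T))) + frag_of ((shift ^^ j) (dcol A B D f g f g 0))
        + frag_of ((shift ^^ j) (shift ?T)) \<in> zspan RG" by (intro zspan_add)
    then show ?case by simp
  qed
  then show ?thesis using rows_below_ex[OF assms] assms by blast
qed

lemma Tot_rows:
  assumes d: "dses A B D f g f' g'"
  shows "frag_of (Tot A B D f g f' g') - frag_of D - frag_of (shift B) - frag_of (shift (shift A)) \<in> zspan RG"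
proof -
  have s: "ses_cx (obj A) (top_diff A) (obj B) (top_diff B) (obj D) (top_diff D) f g"
    and s': "ses_cx (obj A) (bot_diff A) (obj B) (bot_diff B) (obj D) (bot_diff D) f' g'"
    using d unfolding dses_def by auto
  note ba = dses_binary_acyclic[OF d]
  note c = binary_acyclicD(3)[OF ba(1)] binary_acyclicD(3)[OF ba(2)] binary_acyclicD(3)[OF ba(3)]
  note c' = binary_acyclicD(4)[OF ba(1)] binary_acyclicD(4)[OF ba(2)] binary_acyclicD(4)[OF ba(3)]
  note r = tot_rows[OF s c] and r' = tot_rows[OF s' c']
  let ?T = "Tot A B D f g f' g'"
  define N where "N = \<lparr>obj = sho (obj B), top_diff = \<lambda>n. ng (sha (obj B) (top_diff B) n), bot_diff = \<lambda>n. ng (sha (obj B) (bot_diff B) n)\<rparr>"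
  define T1 where "T1 = \<lparr>obj = \<lambda>n. sho (obj B) n \<oplus>\<oplus> sho (sho (obj A)) n,
    top_diff = tot1_diff (obj A) (top_diff A) (obj B) (top_diff B) f, bot_diff = tot1_diff (obj A) (bot_diff A) (obj B) (bot_diff B) f'\<rparr>"
  have cs: "chain_complex C (sho (obj B)) (sha (obj B) (top_diff B))" "chain_complex C (sho (obj B)) (sha (obj B) (bot_diff B))"
    using chain_shift c(2) c'(2) by auto
  note h = chain_complexD(1-5)[OF cs(1)] chain_complexD(1-5)[OF cs(2)]
  \<comment> \<open>Alternating signs give an isomorphism between the middle row with negated
    differentials and the one with the original differentials.\<close>
  define \<sigma> where "\<sigma> n = (if even n then Ident C (sho (obj B) n) else ng (Ident C (sho (obj B) n)))" for n
  have iso: "isomorphism C (\<sigma> n)" "\<sigma> n \<in> Hom C (sho (obj B) n) (sho (obj B) n)" for n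
    using h by (auto simp: \<sigma>_def Hom_def intro: isomorphismI[of _ "\<sigma> n"])
  have neg: "acyclic_complex C (sho (obj B)) (\<lambda>n. ng (sha (obj B) x n))"
    if ac: "acyclic_complex C (sho (obj B)) (sha (obj B) x)" for x
  proof -
    note k = chain_complexD[OF acyclicD[OF ac]]
    have "chain_complex C (sho (obj B)) (\<lambda>n. ng (sha (obj B) x n))"
      unfolding chain_complex_def using k k(1-4)[of "Suc m" for m] by (simp add: Hom_def)
    moreover have "ses_cx (\<lambda>_. Z0) (\<lambda>_. Zero C Z0 Z0) (sho (obj B)) (\<lambda>n. ng (sha (obj B) x n)) (sho (obj B)) (sha (obj B) x)
        (\<lambda>n. Zero C Z0 (sho (obj B) n)) \<sigma>"
      unfolding ses_cx_def using Ses_iso_epi[OF iso(1)] iso(2) k k(1)[of "Suc m" for m] by (auto simp: Hom_def \<sigma>_def)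
    moreover have "acyclic_complex C (\<lambda>_. Z0) (\<lambda>_. Zero C Z0 Z0)" by (rule acyclic_zero) (simp_all add: Hom_def)
    ultimately show ?thesis using acyclic_extension ac by blast
  qed
  have baN: "binary_acyclic C N"
    using neg binary_acyclicD(1,2)[OF binary_acyclic_shift[OF ba(2)]] by (simp add: binary_acyclic_def N_def)
  have baAA: "binary_acyclic C (shift (shift A))" using binary_acyclic_shift ba(1) by blast
  have "acyclic_complex C (obj T1) (top_diff T1)" "acyclic_complex C (obj T1) (bot_diff T1)"
    using acyclic_extension[OF r(2) _ _ r(3)] acyclic_extension[OF r'(2) _ _ r'(3)] binary_acyclicD(1,2)[OF baN] binary_acyclicD(1,2)[OF baAA]
    by (simp_all add: N_def T1_def)
  then have baT1: "binary_acyclic C T1" by (simp add: binary_acyclic_def)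
  have 1: "frag_of ?T - frag_of D - frag_of T1 \<in> zspan RG"
    by (rule G_bses) (use ba(3) baT1 binary_acyclic_Tot[OF tri_dses[OF d]] r(1) r'(1) in \<open>simp add: dses_def T1_def\<close>)
  have 2: "frag_of T1 - frag_of N - frag_of (shift (shift A)) \<in> zspan RG"
    by (rule G_bses) (use baN baT1 baAA r(2) r'(2) in \<open>simp add: dses_def T1_def N_def\<close>)
  have 3: "frag_of N - frag_of (shift B) \<in> zspan RG"
    by (rule G_iso[OF baN binary_acyclic_shift[OF ba(2)], of \<sigma>]) (use iso h h(1)[of "Suc m" for m] in \<open>auto simp: N_def Hom_def \<sigma>_def\<close>)
  have "(frag_of ?T - frag_of D - frag_of T1) + (frag_of T1 - frag_of N - frag_of (shift (shift A)))
      + (frag_of N - frag_of (shift B)) \<in> zspan RG" by (intro zspan_add 1 2 3)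
  then show ?thesis by (simp add: algebra_simps)
qed

text \<open>In the double complex with rows \<open>P\<close>, \<open>P\<close>, 0 and identity
  columns, the total complex is trivial by columns, while by rows its class is that of
  \<open>P\<close> plus that of its shift.\<close>

lemma shift_neg:
  assumes P: "binary_acyclic C P"
  shows "frag_of (shift P) + frag_of P \<in> zspan RG"
proof -
  let ?f = "\<lambda>n. Zero C Z0 (obj P n)" and ?g = "\<lambda>n. Ident C (obj P n)"
  note d = bses_ZC_id[OF P]
  have 1: "frag_of (Tot ZC P P ?f ?g ?f ?g) \<in> zspan RG" using Tot_diag[OF tri_dses[OF d], of 0] by simp
  have 2: "frag_of (shift (shift ZC)) \<in> zspan RG"
    using G_diag binary_acyclic_shift diagonal_shift ZC by blast
  note zspan_diff[OF zspan_diff[OF 1 Tot_rows[OF d]] 2]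
  then show ?thesis by (simp add: algebra_simps)
qed

text \<open>Each column that is split off costs the rest one shift, that is one sign by
  \<open>shift_neg\<close>; this produces the alternating sum.\<close>

lemma Tot_class_cols:
  assumes "rows_below b A B D" "tri A B D f g f' g'"
  shows "frag_of (Tot A B D f g f' g') - (\<Sum>k<b. frag_cmul ((-1) ^ k) (frag_of (dcol A B D f g f' g' k))) \<in> zspan RG"
  using assms
proof (induction b arbitrary: A B D f g f' g')
  case 0
  then show ?case using G_zero[OF binary_acyclic_Tot[OF 0(2)] zero_Tot[OF 0(1)]] by simp
next
  case (Suc b)
  let ?T = "Tot (tl A) (tl B) (tl D) (up f) (up g) (up f') (up g')"
  let ?c = "dcol A B D f g f' g'"
  let ?S = "\<Sum>k<b. frag_cmul ((-1) ^ k) (frag_of (dcol (tl A) (tl B) (tl D) (up f) (up g) (up f') (up g') k))"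
  have 1: "frag_of (Tot A B D f g f' g') - frag_of (?c 0) - frag_of (shift ?T) \<in> zspan RG"
    using Tot_cols_bses[OF Suc.prems(2)] G_bses by blast
  have 2: "frag_of (shift ?T) + frag_of ?T \<in> zspan RG" by (rule shift_neg[OF binary_acyclic_Tot[OF tri_tl[OF Suc.prems(2)]]])
  have 3: "frag_of ?T - ?S \<in> zspan RG" by (rule Suc.IH[OF rows_below_tl[OF Suc.prems(1)] tri_tl[OF Suc.prems(2)]])
  have "?S = (\<Sum>k<b. frag_cmul ((-1) ^ k) (frag_of (?c (Suc k))))" by (simp add: dcol_def)
  then have S: "(\<Sum>k<Suc b. frag_cmul ((-1) ^ k) (frag_of (?c k))) = frag_of (?c 0) - ?S"
    by (simp only: sum.lessThan_Suc_shift) (simp flip: sum_negf)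
  have "(frag_of (Tot A B D f g f' g') - frag_of (?c 0) - frag_of (shift ?T)) + (frag_of (shift ?T) + frag_of ?T)
     - (frag_of ?T - ?S) \<in> zspan RG" by (intro zspan_add zspan_diff 1 2 3)
  then show ?case unfolding S by (simp add: algebra_simps)
qed

text \<open>The class of the total complex is computed by columns and by rows. The rows are shifted
  0, 1 and 2 times, which gives the signs of the relation.\<close>

theorem nenashev_G:
  assumes "2 \<le> b"
  shows "nenashev RG b"
  unfolding nenashev_def
proof (intro conjI allI impI)
  fix A B D f g f' g'
  assume d: "dses A B D f g f' g'" and l: "len b A" "len b B" "len b D"
  note ba = dses_binary_acyclic[OF d]
  let ?T = "Tot A B D f g f' g'"
  have "rows_below (Suc b) A B D" using l unfolding rows_below_def len_def by auto
  from Tot_class_cols[OF this tri_dses[OF d]]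
  have 1: "frag_of ?T - dcols b A B D f g f' g' \<in> zspan RG"
    by (simp only: dcols_def lessThan_Suc_atMost)
  have "(frag_of ?T - dcols b A B D f g f' g')
    - (frag_of ?T - frag_of D - frag_of (shift B) - frag_of (shift (shift A)))
    - (frag_of (shift B) + frag_of B) - (frag_of (shift (shift A)) + frag_of (shift A)) + (frag_of (shift A) + frag_of A) \<in> zspan RG"
    by (intro zspan_add zspan_diff 1 Tot_rows[OF d] shift_neg binary_acyclic_shift ba)
  then show "frag_of D - frag_of B + frag_of A - dcols b A B D f g f' g' \<in> zspan RG" by (simp add: algebra_simps)
qed (use assms G_diag in auto)

section \<open>The presentation is well defined\<close>

lemma K1N_relators_carrier: "K1N_relators C \<subseteq> carrier FA"
proof
  have c: "(\<Sum>l\<le>(2::nat). frag_cmul ((-1) ^ l) (frag_of (P l))) \<in> carrier FA"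
    if "\<And>l. P l \<in> K1N_generators C" for P :: "nat \<Rightarrow> ('o, 'a) bcx"
    by (rule sum_closed_free_Abelian_group) (use that keys_cmul in \<open>fastforce simp: keys_frag_of\<close>)
  fix x assume "x \<in> K1N_relators C"
  then consider (a) P where "P \<in> K1N_generators C" "x = frag_of P"
    | (b) D where "binary_acyclic_double C D" "double_length_two C D"
      "x = (\<Sum>l\<le>2. frag_cmul ((-1) ^ l) (frag_of (row D l))) - (\<Sum>k\<le>2. frag_cmul ((-1) ^ k) (frag_of (col D k)))"
    unfolding K1N_relators_def by blast
  then show "x \<in> carrier FA"
  proof cases
    case b
    have "row D l \<in> K1N_generators C" "col D l \<in> K1N_generators C" for l
      using b(1,2) unfolding K1N_generators_def binary_acyclic_double_def double_length_two_def length_two_def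
      by (simp_all add: row_def col_def)
    then show ?thesis unfolding b(3) by (intro free_carrier_diff c)
  qed simp
qed

text \<open>By \<open>cut_length_two\<close> the columns are conflations, so the rows form a
  \<open>dses\<close>. The given columns are only isomorphic to the resulting \<open>dcol\<close>,
  which \<open>nenashev_cx3\<close> corrects.\<close>

lemma K1N_relators_G: "K1N_relators C \<subseteq> zspan RG"
proof
  have R: "nenashev RG 2" by (rule nenashev_G) simp
  fix x assume "x \<in> K1N_relators C"
  then consider (a) P where "binary_acyclic C P" "diagonal P" "x = frag_of P"
    | (b) D where "binary_acyclic_double C D" "double_length_two C D"
      "x = (\<Sum>l\<le>2. frag_cmul ((-1) ^ l) (frag_of (row D l))) - (\<Sum>k\<le>2. frag_cmul ((-1) ^ k) (frag_of (col D k)))"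
    unfolding K1N_relators_def K1N_generators_def by blast
  then show "x \<in> zspan RG"
  proof cases
    case a
    then show ?thesis using G_diag by simp
  next
    case b
    have r: "binary_acyclic C (row D l)" "binary_acyclic C (col D l)" "len 2 (row D l)" "len 2 (col D l)" for l
      using b(1,2) unfolding binary_acyclic_double_def double_length_two_def len_def
      by (simp_all add: row_def col_def)
    have m: "horiz D k l \<odot> vert D (Suc k) l = vert D k l \<odot> horiz D k (Suc l)"
      "horiz' D k l \<odot> vert' D (Suc k) l = vert' D k l \<odot> horiz' D k (Suc l)" for k l
      using b(1) unfolding binary_acyclic_double_def by auto
    have cu: "cut (obj (col D k)) (top_diff (col D k)) (dobj D k (Suc (Suc 0))) (vert D k (Suc 0)) (Ident C (dobj D k (Suc (Suc 0))))"
      "cut (obj (col D k)) (bot_diff (col D k)) (dobj D k (Suc (Suc 0))) (vert' D k (Suc 0)) (Ident C (dobj D k (Suc (Suc 0))))" for k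
      using cut_length_two[OF binary_acyclicD(1)[OF r(2)[of k]]] cut_length_two[OF binary_acyclicD(2)[OF r(2)[of k]]]
        r(4)[of k] unfolding len_def by (simp_all add: col_def)
    note k = cutD(1,3,4,12)[OF cu(1)] cutD(1,3,4,12)[OF cu(2)]
    let ?R = "\<lambda>l. row D l" and ?v = "\<lambda>l k. vert D k l" and ?v' = "\<lambda>l k. vert' D k l"
    have d: "dses (?R (Suc (Suc 0))) (?R (Suc 0)) (?R 0) (?v (Suc 0)) (?v 0) (?v' (Suc 0)) (?v' 0)"
      unfolding dses_def ses_cx_def using r(1) k m by (simp add: row_def col_def)
    have 1: "frag_of (?R 0) - frag_of (?R (Suc 0)) + frag_of (?R (Suc (Suc 0)))
        - dcols 2 (?R (Suc (Suc 0))) (?R (Suc 0)) (?R 0) (?v (Suc 0)) (?v 0) (?v' (Suc 0)) (?v' 0) \<in> zspan RG"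
      by (rule nenashev_dses[OF R d r(3) r(3) r(3)])
    have c: "frag_of (dcol (?R (Suc (Suc 0))) (?R (Suc 0)) (?R 0) (?v (Suc 0)) (?v 0) (?v' (Suc 0)) (?v' 0) k)
        - frag_of (col D k) \<in> zspan RG" for k
      using nenashev_cx3[OF R r(2,4)[of k]] by (simp add: dcol_def row_def col_def)
    have "dcols 2 (?R (Suc (Suc 0))) (?R (Suc 0)) (?R 0) (?v (Suc 0)) (?v 0) (?v' (Suc 0)) (?v' 0)
        - (\<Sum>k\<le>2. frag_cmul ((-1) ^ k) (frag_of (col D k))) \<in> zspan RG"
    proof -
      have "(\<Sum>k\<le>2. frag_cmul ((-1) ^ k) (frag_of (dcol (?R (Suc (Suc 0))) (?R (Suc 0)) (?R 0) (?v (Suc 0)) (?v 0) (?v' (Suc 0)) (?v' 0) k)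
        - frag_of (col D k))) \<in> zspan RG"
        by (intro zspan_sum frag_cmul_zspan c)
      then show ?thesis by (simp add: dcols_def sum_atMost_2 algebra_simps)
    qed
    from zspan_add[OF 1 this] show ?thesis by (simp add: b(3) sum_atMost_2 algebra_simps)
  qed
qed

section \<open>Surjectivity\<close>

text \<open>Expresses membership in the image of \<Phi> on the level of free groups.\<close>

definition im :: "(('o, 'a) bcx \<Rightarrow>\<^sub>0 int) \<Rightarrow> bool" where
  "im y \<longleftrightarrow> (\<exists>x\<in>carrier FA. y - x \<in> zspan RG)"

lemma im_zspan: "y \<in> zspan RG \<Longrightarrow> im y"
  unfolding im_def by (rule bexI[of _ 0]) simp_all

lemma im_diff: "im y \<Longrightarrow> im z \<Longrightarrow> im (y - z)"
  unfolding im_def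
proof (elim bexE)
  fix a b assume a: "a \<in> carrier FA" "y - a \<in> zspan RG" "b \<in> carrier FA" "z - b \<in> zspan RG"
  show "\<exists>x\<in>carrier FA. y - z - x \<in> zspan RG"
  proof (rule bexI[of _ "a - b"])
    have "(y - a) - (z - b) \<in> zspan RG" using zspan_diff a by blast
    then show "y - z - (a - b) \<in> zspan RG" by (simp add: algebra_simps)
  qed (rule free_carrier_diff[OF a(1,3)])
qed

lemma im_0: "im 0" by (rule im_zspan) simp

lemma im_minus: "im y \<Longrightarrow> im (- y)"
  using im_diff[OF im_0] by simp

lemma im_add: "im y \<Longrightarrow> im z \<Longrightarrow> im (y + z)"
  using im_diff[of y "- z"] im_minus by simp

lemma im_sum: "(\<And>i. i \<in> I \<Longrightarrow> im (h i)) \<Longrightarrow> im (sum h I)"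
  by (induction I rule: infinite_finite_induct) (auto intro: im_add im_0)

lemma im_cmul: "im x \<Longrightarrow> im (frag_cmul c x)"
proof (induction c rule: int_induct[of _ 0])
  case base then show ?case by (simp add: im_0)
next
  case (step1 i) then show ?case by (simp add: frag_cmul_distrib im_add)
next
  case (step2 i) then show ?case by (simp add: frag_cmul_diff_distrib im_diff)
qed

lemma im_length_two:
  assumes "binary_acyclic C P" "len 2 P"
  shows "im (frag_of P)"
  unfolding im_def by (rule bexI[of _ "frag_of P"]) (use assms in \<open>simp_all add: K1N_generators_def length_two_len\<close>)

text \<open>With \<open>ZC\<close> as third row, \<open>P\<close> and \<open>Q\<close> differ only
  by an alternating sum of columns, and columns have length two.\<close>

lemma im_dses:
  assumes d: "dses ZC P Q f g f' g'" and Q: "im (frag_of Q)"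
  shows "im (frag_of P)"
proof -
  note ba = dses_binary_acyclic[OF d]
  obtain a c where l: "len a P" "len c Q" using binary_acyclic_len ba by meson
  define b where "b = a + c + 2"
  have "len b P" "len b Q" using l by (auto elim: len_mono simp: b_def)
  then have 1: "frag_of Q - frag_of P + frag_of ZC - dcols b ZC P Q f g f' g' \<in> zspan RG"
    by (intro nenashev_dses[OF nenashev_G d]) (simp_all add: b_def)
  have 2: "im (dcols b ZC P Q f g f' g')"
    unfolding dcols_def
    by (intro im_sum im_cmul im_length_two binary_acyclic_dcol[OF d]) (simp add: dcol_def)
  have 3: "im (frag_of ZC)" by (rule im_length_two) simp_all
  have "im (frag_of Q + frag_of ZC - dcols b ZC P Q f g f' g' - (frag_of Q - frag_of P + frag_of ZC - dcols b ZC P Q f g f' g'))"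
    by (intro im_diff im_add Q 2 3 im_zspan[OF 1])
  then show ?thesis by simp
qed

text \<open>Shortening descends to an endomorphism of \<open>K0_Omega\<close>: it respects
  conflations by \<open>bses_shorten\<close> and kills diagonal complexes by
  \<open>shorten_diag_bses\<close>.\<close>

lemma shorten_G:
  assumes "x \<in> zspan RG"
  shows "frag_extend (\<lambda>P. frag_of (shorten P)) x \<in> zspan RG"
proof (rule frag_extend_zspan[OF _ assms])
  have R: "nenashev RG 2" by (rule nenashev_G) simp
  fix r assume "r \<in> RG"
  then consider (a) i p where "(i, p) \<in> Ses (Bq C)"
      "r = frag_of (Src (Bq C) p) - frag_of (Src (Bq C) i) - frag_of (Trg (Bq C) p)"
    | (b) P where "binary_acyclic C P" "diagonal P" "r = frag_of P"
    unfolding K0_Omega_relators_def K0_relators_def Bq_def by auto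
  then show "frag_extend (\<lambda>P. frag_of (shorten P)) r \<in> zspan RG"
  proof cases
    case a
    obtain A B D f g where s: "bses A B D f g" and r: "r = frag_of B - frag_of A - frag_of D"
      using bses_of_Ses_Bq[OF a(1)] a(2) by metis
    obtain f' g' where "bses (shorten A) (shorten B) (shorten D) f' g'" using bses_shorten[OF s] by blast
    then show ?thesis using G_bses by (simp add: r frag_extend_diff)
  next
    case b
    obtain n where "len n P" using binary_acyclic_len[OF b(1)] by blast
    then have l: "len (Suc (n + 2)) P" using len_mono by simp
    obtain E F f g where E: "bses E (shorten P) F f g" "diagonal E" "\<forall>R. nenashev R 2 \<longrightarrow> frag_of F \<in> zspan R"
      using shorten_diag_bses[OF b(1) l _ b(2)] by auto
    have "(frag_of (shorten P) - frag_of E - frag_of F) + frag_of E + frag_of F \<in> zspan RG"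
      using E(3) R G_diag[OF dses_binary_acyclic(1)[OF E(1)] E(2)] G_bses[OF E(1)] by (intro zspan_add) auto
    then show ?thesis by (simp add: b(3))
  qed
qed

text \<open>A shifted complex is zero in degree 0, so all of \<open>P 0\<close> is the kernel of its
  lowest differential.\<close>

lemma cut_shift:
  assumes "acyclic_complex C P d"
  shows "cut (sho P) (sha P d) (P 0) (Ident C (P 0)) (d 0)"
proof -
  note c = chain_complexD[OF acyclicD[OF assms]]
  have "tail_obj (P 0) (sho P) = P" "tail_ar (d 0) (sha P d) = d"
    by (rule ext, case_tac x; simp)+
  then show ?thesis
    unfolding cut_def precut_def using assms c Ses_iso_mono[of "Ident C (P 0)"] by (simp add: Hom_def)
qed

text \<open>Modulo complexes of length two the shortening of \<open>P[1]\<close> is \<open>P\<close> with its differentials exchanged: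
  here both syzygies are \<open>P 0\<close>, and exchanging their copies in the bottom differential yields the
  complex \<open>L\<close>, which is an extension of a diagonal complex by the exchanged \<open>P\<close>.\<close>

lemma im_opp:
  assumes P: "binary_acyclic C P" and sP: "im (frag_of (shorten (shift P)))"
  shows "im (frag_of (opp P))"
proof -
  define X where "X = obj P 0"
  define \<pi> where "\<pi> = top_diff P 0"
  define \<rho> where "\<rho> = bot_diff P 0"
  note c = chain_complexD[OF binary_acyclicD(3)[OF P]] and c' = chain_complexD[OF binary_acyclicD(4)[OF P]]
  have O: "obj P n \<in> Ob C" "X \<in> Ob C" for n using c(1) by (auto simp: X_def)
  have pr: "\<pi> \<in> Ar C" "Src C \<pi> = obj P (Suc 0)" "Trg C \<pi> = X" "\<rho> \<in> Ar C" "Src C \<rho> = obj P (Suc 0)" "Trg C \<rho> = X"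
    "\<pi> \<odot> top_diff P (Suc 0) = Zero C (obj P (Suc (Suc 0))) X" "\<rho> \<odot> bot_diff P (Suc 0) = Zero C (obj P (Suc (Suc 0))) X"
    using c(2-4)[of 0] c(5)[of 0] c'(2-4)[of 0] c'(5)[of 0] by (simp_all add: X_def \<pi>_def \<rho>_def)
  have t: "cut (obj (shift P)) (top_diff (shift P)) X (Ident C X) \<pi>"
    and b: "cut (obj (shift P)) (bot_diff (shift P)) X (Ident C X) \<rho>"
    using cut_shift[OF binary_acyclicD(1)[OF P]] cut_shift[OF binary_acyclicD(2)[OF P]] by (simp_all add: X_def \<pi>_def \<rho>_def)
  let ?Q = "Qs (shift P) X (Ident C X) \<pi> X (Ident C X) \<rho>"
  let ?Q' = "Qs (shift (opp P)) X (Ident C X) \<rho> X (Ident C X) \<pi>"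
  have baS: "binary_acyclic C (shift P)" "binary_acyclic C (shift (opp P))" using P binary_acyclic_shift by auto
  obtain m where "len m (shift P)" using binary_acyclic_len[OF baS(1)] by blast
  then have l: "len (Suc (m + 2)) (shift P)" using len_mono by simp
  have "frag_of (shorten (shift P)) - frag_of ?Q \<in> zspan RG"
    by (rule shorten_Qs[OF _ baS(1) l _ t b]) (use G_bses in auto)
  from im_diff[OF sP im_zspan[OF this]] have Q: "im (frag_of ?Q)" by simp
  have baQ: "binary_acyclic C ?Q" by (rule binary_acyclic_Qs[OF baS(1) t b])
  have baQ': "binary_acyclic C ?Q'" by (rule binary_acyclic_Qs[OF baS(2)]) (use t b in simp_all)
  \<comment> \<open>Both halves of \<open>L\<close> are top halves: that of \<open>?Q\<close>, whose
    upper piece is the bottom of \<open>P\<close>, and that of \<open>?Q'\<close>, whose upper piece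
    is the top of \<open>P\<close>.\<close>
  define L where "L = \<lparr>obj = obj ?Q, top_diff = top_diff ?Q, bot_diff = top_diff ?Q'\<rparr>"
  have baL: "binary_acyclic C L"
    using binary_acyclicD(1)[OF baQ] binary_acyclicD(1)[OF baQ'] by (simp add: binary_acyclic_def L_def)
  define W where "W = X \<oplus>\<oplus> X"
  have OW: "W \<in> Ob C" using O by (simp add: W_def)
  let ?I = "Ident C"
  define sw where "sw = cp (pr (Zero C X X) (?I X)) (pr (?I X) (Zero C X X))"
  \<comment> \<open>In degree 0 a rotation replaces the plain exchange, in order to absorb the sign
    that \<open>Qs\<close> puts on \<open>K\<close> in its bottom differential.\<close>
  define ro where "ro = cp (pr (Zero C X X) (ng (?I X))) (pr (?I X) (Zero C X X))"
  have sw: "sw \<in> Ar C" "Src C sw = W" "Trg C sw = W" "isomorphism C sw"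
    using O isomorphism_swap by (simp_all add: sw_def W_def)
  have ro: "ro \<in> Ar C" "Src C ro = W" "Trg C ro = W" "isomorphism C ro"
    using O isomorphismI[of ro "cp (pr (Zero C X X) (?I X)) (pr (ng (?I X)) (Zero C X X))"]
    by (simp_all add: ro_def W_def Ident_dsum)
  let ?b = "pickn (dg (?I Z0) ro) (dg (?I X) (dg (?I (obj P (Suc 0))) sw)) (dg (?I (obj P (Suc (Suc 0)))) sw)
     (\<lambda>n. ?I (obj P (Suc (Suc (Suc n)))))"
  let ?z = "\<lambda>n. Zero C Z0 (obj L n)"
  have "dses ZC L ?Q ?z (\<lambda>n. ?I (obj L n)) ?z ?b"
  proof (rule dses_isoI[OF baL baQ])
    note cL = chain_complexD[OF binary_acyclicD(3)[OF baL]]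
    fix n
    show "isomorphism C (?I (obj L n))" "?I (obj L n) \<in> Hom C (obj L n) (obj ?Q n)"
      "?I (obj L n) \<odot> top_diff L n = top_diff ?Q n \<odot> ?I (obj L (Suc n))"
      using cL by (simp_all add: L_def Hom_def)
    show "isomorphism C (?b n)"
      by (rule all_nat3I[of _ n]) (use O sw ro isomorphism_dg isomorphism_Ident[of Z0] in \<open>simp_all del: Ident_Z0\<close>)
    show "?b n \<in> Hom C (obj L n) (obj ?Q n)"
      by (rule all_nat3I[of _ n]) (use O sw ro in \<open>simp_all add: L_def Hom_def X_def[symmetric] W_def[symmetric]\<close>)
    show "?b n \<odot> bot_diff L n = bot_diff ?Q n \<odot> ?b (Suc n)"
      by (rule all_nat3I[of _ n])
        (use O pr c(2-5) in \<open>simp_all add: L_def X_def[symmetric] sw_def ro_def dg_def\<close>)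
  qed
  then have L: "im (frag_of L)" using Q by (rule im_dses)
  \<comment> \<open>The summands of \<open>L\<close> outside the exchanged complex; they carry the
    same differentials in both halves.\<close>
  let ?V = "cx3 (Z0 \<oplus>\<oplus> X) (X \<oplus>\<oplus> W) W (dg (Zero C X Z0) (cp (?I X) (Zero C X X)))
     (pr (cp (?I X) (Zero C X X)) (dg (Zero C X X) (?I X))) (dg (Zero C X Z0) (cp (?I X) (Zero C X X)))
     (pr (cp (?I X) (Zero C X X)) (dg (Zero C X X) (?I X)))"
  have sV: "(pr (cp (?I X) (Zero C X X)) (dg (Zero C X X) (?I X)), dg (Zero C X Z0) (cp (?I X) (Zero C X X))) \<in> Ses C"
    by (rule Ses_Rcx(1)) (use Ses_iso_mono[of "?I X"] O in simp_all)
  have baV: "binary_acyclic C ?V"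
    by (rule binary_acyclic_cx3[OF sV _ _ _ sV]) (use O in \<open>simp_all add: W_def\<close>)
  \<comment> \<open>In degree 0 the exchanged complex occupies the second copy of \<open>X\<close>,
    where the upper piece ends.\<close>
  let ?f = "pickn (pr (Zero C X Z0) (pr (Zero C X X) (?I X)))
     (pr (Zero C (obj P (Suc 0)) X) (pr (?I (obj P (Suc 0))) (Zero C (obj P (Suc 0)) W)))
     (pr (?I (obj P (Suc (Suc 0)))) (Zero C (obj P (Suc (Suc 0))) W)) (\<lambda>n. ?I (obj P (Suc (Suc (Suc n)))))"
  let ?g = "pickn (dg (?I Z0) (cp (?I X) (Zero C X X))) (dg (?I X) (cp (Zero C (obj P (Suc 0)) W) (?I W)))
     (cp (Zero C (obj P (Suc (Suc 0))) W) (?I W)) (\<lambda>n. Zero C (obj P (Suc (Suc (Suc n)))) Z0)"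
  have "(?f n, ?g n) \<in> Ses C" for n
  proof (rule all_nat3I[of _ n])
    show "(?f 0, ?g 0) \<in> Ses C"
      by (rule Ses_split[of _ _ "dg (?I Z0) (pr (?I X) (Zero C X X))" "cp (Zero C Z0 X) (cp (Zero C X X) (?I X))"])
        (use O in \<open>simp_all add: dg_def Ident_dsum\<close>)
    show "(?f (Suc 0), ?g (Suc 0)) \<in> Ses C"
      by (rule Ses_split[of _ _ "dg (?I X) (pr (Zero C W (obj P (Suc 0))) (?I W))"
          "cp (Zero C X (obj P (Suc 0))) (cp (?I (obj P (Suc 0))) (Zero C W (obj P (Suc 0))))"])
        (use O OW in \<open>simp_all add: dg_def Ident_dsum\<close>)
    show "(?f (Suc (Suc 0)), ?g (Suc (Suc 0))) \<in> Ses C"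
      using Ses_in1_pr2[of "obj P (Suc (Suc 0))" W] O OW by simp
    fix n show "(?f (Suc (Suc (Suc n))), ?g (Suc (Suc (Suc n)))) \<in> Ses C"
      using Ses_iso_mono[of "?I (obj P (Suc (Suc (Suc n))))"] O by simp
  qed
  moreover have "Src C (?f n) = obj (opp P) n" "Trg C (?f n) = obj L n" "Trg C (?g n) = obj ?V n" for n
    by (rule all_nat3I[of _ n]; use O OW in \<open>simp add: L_def X_def[symmetric] W_def[symmetric]\<close>)+
  moreover have "?f n \<odot> top_diff (opp P) n = top_diff L n \<odot> ?f (Suc n)"
    "?f n \<odot> bot_diff (opp P) n = bot_diff L n \<odot> ?f (Suc n)" for n
    by (rule all_nat3I[of _ n]; use O OW pr c(2-5) c'(2-5) in
        \<open>simp add: L_def X_def[symmetric] W_def[symmetric] \<pi>_def[symmetric] \<rho>_def[symmetric]\<close>; simp add: W_def dg_def)+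
  moreover have "?g n \<odot> top_diff L n = top_diff ?V n \<odot> ?g (Suc n)"
    "?g n \<odot> bot_diff L n = bot_diff ?V n \<odot> ?g (Suc n)" for n
    by (rule all_nat3I[of _ n]; use O OW pr c(2-5) c'(2-5) in
        \<open>simp add: L_def X_def[symmetric] W_def dg_def Ident_dsum\<close>)+
  ultimately have "bses (opp P) L ?V ?f ?g"
    unfolding dses_def ses_cx_def using opp(1)[OF P] baL baV by blast
  then have 1: "frag_of L - frag_of (opp P) - frag_of ?V \<in> zspan RG" by (rule G_bses)
  have "im (frag_of L - (frag_of L - frag_of (opp P) - frag_of ?V) - frag_of ?V)"
    by (intro im_diff L im_zspan[OF 1] im_length_two baV) simp
  then show ?thesis by simp
qed

text \<open>The induction hypothesis covers the shortening of \<open>opp P\<close>. The relation of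
  \<open>shift_neg\<close>, transported by \<open>shorten_G\<close>, carries this over to the
  shortening of its shift, and exchanging twice returns \<open>P\<close>.\<close>

theorem im_all:
  "binary_acyclic C P \<Longrightarrow> len (n + 2) P \<Longrightarrow> im (frag_of P)"
proof (induction n arbitrary: P)
  case 0
  then show ?case using im_length_two by (simp add: numeral_2_eq_2)
next
  case (Suc n)
  let ?P = "opp P"
  have ba: "binary_acyclic C ?P" using Suc.prems by simp
  have 1: "im (frag_of (shorten ?P))"
    by (rule Suc.IH[OF binary_acyclic_shorten[OF ba] len_shorten[OF ba]]) (use Suc.prems in simp_all)
  have 2: "frag_of (shorten (shift ?P)) + frag_of (shorten ?P) \<in> zspan RG"
    using shorten_G[OF shift_neg[OF ba]] by (simp add: frag_extend_add)
  from im_diff[OF im_zspan[OF 2] 1]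
  have "im (frag_of (opp ?P))" by (intro im_opp[OF ba]) simp
  moreover have "opp ?P = P" by (simp add: opp_def)
  ultimately show ?case by simp
qed

end

theorem theorem1p1:
  fixes N :: "('o, 'a) excat"
  assumes "exact_category N"
  shows "(\<exists>\<Phi>. natural_hom N \<Phi>) \<and>
    (\<forall>\<Phi>. natural_hom N \<Phi> \<longrightarrow> \<Phi> \<in> iso (K1N N) (K0_Omega N))"
proof -
  interpret exact_category N by (rule assms)
  show ?thesis
  proof (rule natural_hom_isomorphism[OF K1N_relators_carrier K1N_relators_G K1N_injective])
    fix P assume P: "binary_acyclic N P"
    then obtain b where "len b P" using binary_acyclic_len by blast
    then have "len (b + 2) P" using len_mono by simp
    from im_all[OF P this] show "\<exists>x\<in>carrier FA. frag_of P - x \<in> zspan RG" unfolding im_def .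
  qed
qed

end
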